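(* Let $V=\bigoplus_{i\in\mathbb Z/n\mathbb Z}V_i$ be an $n$-colored vector space over a field $\mathbb F$, let $(\lambda,\epsilon,\mu)$ be a striped $n$-bipartition of signature $\xi(V)$, let $(v,x)\in\mathcal O_{\lambda,\epsilon,\mu}$ (so $x\in\mathcal O_{\lambda,\epsilon}$), and let $\mathcal O_x=K\cdot x$ and $\mathcal O_{v,x}=K\cdot(v,x)$. Then $$\dim\mathcal O_x=\sum_{i\in\mathbb Z/n\mathbb Z}(\dim V_i)^2-\sum_{k=1}^{l(\lambda)}s_{\lambda_k}(x)(\epsilon_k),$$ $$\dim\mathcal O_{v,x}=\sum_{i\in\mathbb Z/n\mathbb Z}(\dim V_i)^2-\sum_{k=1}^{l(\lambda)}s_{\lambda_k}(x)(\epsilon_k)+\sum_{i=1}^{l(\lambda)}\left\lceil\frac{\mu_i}{n}\right\rceil .$$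
   Context: Fix an integer $n\ge 1$; write $[a]$ for the class of $a\in\mathbb Z$ in $\mathbb Z/n\mathbb Z$. An $n$-colored vector space is a finite-dimensional vector space $V$ over a field $\mathbb F$ with a decomposition $V=\bigoplus_{i\in\mathbb Z/n\mathbb Z}V_i$. Its signature is $\xi_i(V)=\dim V_i$. Put $K=\prod_iGL(V_i)$ and $\mathcal N=\{x\in\mathrm{End}(V): x\text{ nilpotent},\ xV_i\subset V_{i+[1]}\ \forall i\}$. $K$ acts on $\mathcal N$ by conjugation and on $V\times\mathcal N$ by $k\cdot(v,x)=(kv,kxk^{-1})$. A partition is a weakly decreasing $\lambda:\mathbb N=\{1,2,\dots\}\to\mathbb Z^{\ge0}$ that is eventually $0$; $l(\lambda)=\#\{i:\lambda_i>0\}$. A colored partition is $(\lambda,\epsilon)$ with $\lambda$ a partition and $\epsilon:\mathbb N\to\mathbb Z/n\mathbb Z$ taking each value infinitely often. Its signature is $\xi_m(\lambda,\epsilon)=\#\{(i,j):1\le j\le\lambda_i,\ \epsilon_i+[\lambda_i-j]=m\}$. For a colored partition of signature $\xi(V)$, a colored Jordan basis of type $(\lambda,\epsilon)$ for $x\in\mathcal N$ is a basis $\{v_{i,j}:1\le i\le l(\lambda),1\le j\le\lambda_i\}$ of $V$ with $v_{i,j}\in V_{\epsilon_i+[\lambda_i-j]}$, $xv_{i,j}=v_{i,j-1}$ for $j>1$ and $xv_{i,1}=0$. Convention: $v_{i,j}=0$ for $j\le0$. $\mathcal O_{\lambda,\epsilon}\subset\mathcal N$ is the $K$-orbit of all $x$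 admitting such a basis. A marking of $\lambda$ is $\mu:\mathbb N\to\mathbb Z$ with $\mu_i\le\lambda_i$; put $\nu=\lambda-\mu$. The triple $(\lambda,\epsilon,\mu)$ (of signature $\xi(\lambda,\epsilon)$) is a striped $n$-bipartition if $\mu_i>-n$ for all $i$, $\mu_j<\mu_i+n$ and $\nu_j<\nu_i+n$ for all $i<j$, and $\epsilon_i+[\nu_i]=\epsilon_j+[\nu_j]$ for all $i,j$. $\mathcal O_{\lambda,\epsilon,\mu}$ is the $K$-orbit of $(v,x)$, where $x\in\mathcal N$ has a colored Jordan basis $\{v_{i,j}\}$ of type $(\lambda,\epsilon)$ and $v=\sum_{i=1}^{l(\lambda)}v_{i,\mu_i}$; it is independent of choices. For $k\ge1$, $s_k(x):\mathbb Z/n\mathbb Z\to\mathbb Z^{\ge0}$ is the signature of $\ker x^k$: $s_k(x)(m)=\dim(\ker x^k\cap V_m)$. *)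

theory Defs
  imports "HOL-Analysis.Analysis"
begin

section \<open>Colored vector spaces\<close>

text \<open>
  The group \<open>\<int>/n\<int>\<close> is represented by the residues \<open>{0..<n}\<close>; an integer \<open>a\<close> is sent to its class
  by \<open>a mod n\<close>.  The vector space is the whole type \<open>'v\<close>, and the values of \<open>V\<close> outside \<open>{0..<n}\<close>
  are irrelevant.
\<close>

locale colored_space = vector_space smul
  for smul :: "'f::field \<Rightarrow> 'v::ab_group_add \<Rightarrow> 'v" +
  fixes n :: int and V :: "int \<Rightarrow> 'v set"
  assumes n_ge_1: "n \<ge> 1"
    and finite_dim: "\<exists>B. finite B \<and> span B = UNIV"
    and subspace_V: "m \<in> {0..<n} \<Longrightarrow> subspace (V m)"
    and direct_sum: "\<exists>!c. (\<forall>m. if m \<in> {0..<n} then c m \<in> V m else c m = 0) \<and>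
                          u = (\<Sum>m\<in>{0..<n}. c m)"

definition colored_GL ::
  "('f::field \<Rightarrow> 'v::ab_group_add \<Rightarrow> 'v) \<Rightarrow> int \<Rightarrow> (int \<Rightarrow> 'v set) \<Rightarrow> ('v \<Rightarrow> 'v) set" where
  "colored_GL smul n V =
     {g. Vector_Spaces.linear smul smul g \<and> bij g \<and> (\<forall>m\<in>{0..<n}. g ` V m = V m)}"

definition colored_nilpotents ::
  "('f::field \<Rightarrow> 'v::ab_group_add \<Rightarrow> 'v) \<Rightarrow> int \<Rightarrow> (int \<Rightarrow> 'v set) \<Rightarrow> ('v \<Rightarrow> 'v) set" where
  "colored_nilpotents smul n V =
     {x. Vector_Spaces.linear smul smul x \<and> (\<exists>k. \<forall>u. (x ^^ k) u = 0) \<and>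
         (\<forall>m\<in>{0..<n}. x ` V m \<subseteq> V ((m + 1) mod n))}"

definition conj_orbit ::
  "('f::field \<Rightarrow> 'v::ab_group_add \<Rightarrow> 'v) \<Rightarrow> int \<Rightarrow> (int \<Rightarrow> 'v set) \<Rightarrow> ('v \<Rightarrow> 'v) \<Rightarrow> ('v \<Rightarrow> 'v) set" where
  "conj_orbit smul n V x = {g \<circ> x \<circ> inv g | g. g \<in> colored_GL smul n V}"

definition enhanced_orbit ::
  "('f::field \<Rightarrow> 'v::ab_group_add \<Rightarrow> 'v) \<Rightarrow> int \<Rightarrow> (int \<Rightarrow> 'v set) \<Rightarrow> 'v \<times> ('v \<Rightarrow> 'v) \<Rightarrow>
     ('v \<times> ('v \<Rightarrow> 'v)) set" where
  "enhanced_orbit smul n V p =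
     {(g (fst p), g \<circ> snd p \<circ> inv g) | g. g \<in> colored_GL smul n V}"

definition kernel_signature ::
  "('f::field \<Rightarrow> 'v::ab_group_add \<Rightarrow> 'v) \<Rightarrow> (int \<Rightarrow> 'v set) \<Rightarrow> ('v \<Rightarrow> 'v) \<Rightarrow> nat \<Rightarrow> int \<Rightarrow> nat" where
  "kernel_signature smul V x k m = vector_space.dim smul {u \<in> V m. (x ^^ k) u = 0}"


section \<open>Colored partitions and striped bipartitions\<close>

text \<open>
  Rows are numbered from \<open>0\<close>: \<open>lam i\<close>, \<open>eps i\<close>, \<open>mu i\<close> stand for
  \<open>\<lambda>\<^bsub>i+1\<^esub>\<close>, \<open>\<epsilon>\<^bsub>i+1\<^esub>\<close>, \<open>\<mu>\<^bsub>i+1\<^esub>\<close>.  Columns \<open>j\<close> are numbered from \<open>1\<close>.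
\<close>

definition is_partition :: "(nat \<Rightarrow> nat) \<Rightarrow> bool" where
  "is_partition lam \<longleftrightarrow> antimono lam \<and> (\<exists>N. \<forall>i\<ge>N. lam i = 0)"

definition plen :: "(nat \<Rightarrow> nat) \<Rightarrow> nat" where
  "plen lam = card {i. lam i > 0}"

definition colored_partition :: "int \<Rightarrow> (nat \<Rightarrow> nat) \<Rightarrow> (nat \<Rightarrow> int) \<Rightarrow> bool" where
  "colored_partition n lam eps \<longleftrightarrow> is_partition lam \<and> (\<forall>i. eps i \<in> {0..<n}) \<and>
     (\<forall>m\<in>{0..<n}. infinite {i. eps i = m})"

definition partition_signature :: "int \<Rightarrow> (nat \<Rightarrow> nat) \<Rightarrow> (nat \<Rightarrow> int) \<Rightarrow> int \<Rightarrow> nat" where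
  "partition_signature n lam eps m =
     card {(i, j). 1 \<le> j \<and> j \<le> lam i \<and> (eps i + (int (lam i) - int j)) mod n = m}"

definition striped_bipartition ::
  "int \<Rightarrow> (nat \<Rightarrow> nat) \<Rightarrow> (nat \<Rightarrow> int) \<Rightarrow> (nat \<Rightarrow> int) \<Rightarrow> bool" where
  "striped_bipartition n lam eps mu \<longleftrightarrow>
     (let nu = (\<lambda>i. int (lam i) - mu i) in
       colored_partition n lam eps \<and>
       (\<forall>i. mu i \<le> int (lam i)) \<and>
       (\<forall>i. mu i > - n) \<and>
       (\<forall>i j. i < j \<longrightarrow> mu j < mu i + n \<and> nu j < nu i + n) \<and>
       (\<forall>i j. (eps i + nu i) mod n = (eps j + nu j) mod n))"

definition colored_Jordan_basis ::
  "('f::field \<Rightarrow> 'v::ab_group_add \<Rightarrow> 'v) \<Rightarrow> int \<Rightarrow> (int \<Rightarrow> 'v set) \<Rightarrow> (nat \<Rightarrow> nat) \<Rightarrow> (nat \<Rightarrow> int) \<Rightarrow>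
     ('v \<Rightarrow> 'v) \<Rightarrow> (nat \<Rightarrow> nat \<Rightarrow> 'v) \<Rightarrow> bool" where
  "colored_Jordan_basis smul n V lam eps x b \<longleftrightarrow>
     (let I = {(i, j). i < plen lam \<and> 1 \<le> j \<and> j \<le> lam i} in
       inj_on (\<lambda>(i, j). b i j) I \<and>
       \<not> module.dependent smul ((\<lambda>(i, j). b i j) ` I) \<and>
       module.span smul ((\<lambda>(i, j). b i j) ` I) = UNIV \<and>
       (\<forall>(i, j)\<in>I. b i j \<in> V ((eps i + (int (lam i) - int j)) mod n) \<and>
                    x (b i j) = (if j > 1 then b i (j - 1) else 0)))"

definition marked_vector ::
  "(nat \<Rightarrow> nat) \<Rightarrow> (nat \<Rightarrow> int) \<Rightarrow> (nat \<Rightarrow> nat \<Rightarrow> 'v::ab_group_add) \<Rightarrow> 'v" where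
  "marked_vector lam mu b = (\<Sum>i<plen lam. if mu i \<le> 0 then 0 else b i (nat (mu i)))"

text \<open>
  The orbit \<open>O\<^bsub>\<lambda>,\<epsilon>,\<mu>\<^esub>\<close>.  It does not depend on the chosen pair, so it is given as the union
  of the orbits over all choices of \<open>x\<close> and of the Jordan basis.
\<close>

definition striped_orbit ::
  "('f::field \<Rightarrow> 'v::ab_group_add \<Rightarrow> 'v) \<Rightarrow> int \<Rightarrow> (int \<Rightarrow> 'v set) \<Rightarrow> (nat \<Rightarrow> nat) \<Rightarrow> (nat \<Rightarrow> int) \<Rightarrow>
     (nat \<Rightarrow> int) \<Rightarrow> ('v \<times> ('v \<Rightarrow> 'v)) set" where
  "striped_orbit smul n V lam eps mu =
     \<Union> {enhanced_orbit smul n V (marked_vector lam mu b, x) | x b.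
         x \<in> colored_nilpotents smul n V \<and> colored_Jordan_basis smul n V lam eps x b}"


section \<open>Zariski topology and dimension\<close>

inductive_set polynomial_functions :: "('p \<Rightarrow> 'k::comm_ring_1) set \<Rightarrow> ('p \<Rightarrow> 'k) set"
  for C :: "('p \<Rightarrow> 'k) set" where
  const: "(\<lambda>_. a) \<in> polynomial_functions C"
| coord: "f \<in> C \<Longrightarrow> f \<in> polynomial_functions C"
| add: "f \<in> polynomial_functions C \<Longrightarrow> h \<in> polynomial_functions C \<Longrightarrow>
          (\<lambda>p. f p + h p) \<in> polynomial_functions C"
| mult: "f \<in> polynomial_functions C \<Longrightarrow> h \<in> polynomial_functions C \<Longrightarrow>
          (\<lambda>p. f p * h p) \<in> polynomial_functions C"

definition zariski :: "('p \<Rightarrow> 'k::field) set \<Rightarrow> 'p topology" where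
  "zariski C = topology_generated_by {{p. f p \<noteq> 0} | f. f \<in> polynomial_functions C}"

lemma topspace_zariski [simp]: "topspace (zariski C) = UNIV"
proof -
  have "(\<lambda>_. 1) \<in> polynomial_functions C"
    by (rule polynomial_functions.const)
  then have "\<Union> {{p. f p \<noteq> 0} | f. f \<in> polynomial_functions C} = UNIV"
    by force
  then show ?thesis
    unfolding zariski_def topology_generated_by_topspace .
qed

lemma closedin_zariski:
  fixes C :: "('p \<Rightarrow> 'k::field) set"
  shows "closedin (zariski C) Z \<longleftrightarrow>
    (\<exists>S\<subseteq>polynomial_functions C. Z = {p. \<forall>f\<in>S. f p = 0})"
proof -
  let ?G = "{{p. f p \<noteq> 0} | f. f \<in> polynomial_functions C}"
  have "\<exists>S\<subseteq>polynomial_functions C. U = (\<Union>f\<in>S. {p. f p \<noteq> 0})"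
    if "generate_topology_on ?G U" for U
    using that
  proof induction
    case Empty
    then show ?case by (intro exI[of _ "{}"]) auto
  next
    case (Int A B)
    then obtain S T where S: "S \<subseteq> polynomial_functions C" "A = (\<Union>f\<in>S. {p. f p \<noteq> 0})"
      and T: "T \<subseteq> polynomial_functions C" "B = (\<Union>f\<in>T. {p. f p \<noteq> 0})" by auto
    let ?R = "{\<lambda>p. f p * h p | f h. f \<in> S \<and> h \<in> T}"
    have "?R \<subseteq> polynomial_functions C"
      using S(1) T(1) by (auto intro: polynomial_functions.mult)
    moreover have "A \<inter> B = (\<Union>f\<in>?R. {p. f p \<noteq> 0})"
    proof (intro equalityI subsetI)
      fix p assume "p \<in> A \<inter> B"
      then obtain f h where "f \<in> S" "h \<in> T" "f p \<noteq> 0" "h p \<noteq> 0"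
        unfolding S(2) T(2) by blast
      then show "p \<in> (\<Union>f\<in>?R. {p. f p \<noteq> 0})"
        by (intro UN_I[of "\<lambda>p. f p * h p"]) auto
    qed (auto simp: S(2) T(2))
    ultimately show ?case by (intro exI[of _ ?R] conjI)
  next
    case (UN K)
    let ?S = "{f \<in> polynomial_functions C. {p. f p \<noteq> 0} \<subseteq> \<Union> K}"
    have "\<Union> K \<subseteq> (\<Union>f\<in>?S. {p. f p \<noteq> 0})"
    proof
      fix p assume "p \<in> \<Union> K"
      then obtain k where k: "k \<in> K" "p \<in> k" by blast
      obtain S where S: "S \<subseteq> polynomial_functions C" "k = (\<Union>f\<in>S. {p. f p \<noteq> 0})"
        using UN.IH[OF k(1)] by blast
      obtain f where f: "f \<in> S" "f p \<noteq> 0" using k(2) unfolding S(2) by blast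
      have "{p. f p \<noteq> 0} \<subseteq> k" unfolding S(2) using f(1) by blast
      then have "f \<in> ?S" using f(1) S(1) k(1) by blast
      then show "p \<in> (\<Union>f\<in>?S. {p. f p \<noteq> 0})" using f(2) by blast
    qed
    then have "\<Union> K = (\<Union>f\<in>?S. {p. f p \<noteq> 0})" by blast
    then show ?case by (intro exI[of _ ?S] conjI) auto
  next
    case (Basis s)
    then obtain f where f: "f \<in> polynomial_functions C" and s: "s = {p. f p \<noteq> 0}" by blast
    show ?case unfolding s using f by (intro exI[of _ "{f}"]) simp
  qed
  note open_imp = this
  have gen: "generate_topology_on ?G (\<Union>f\<in>S. {p. f p \<noteq> 0})"
    if "S \<subseteq> polynomial_functions C" for S
  proof (rule generate_topology_on.UN)
    fix k assume "k \<in> (\<lambda>f. {p. f p \<noteq> 0}) ` S"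
    then obtain f where f: "f \<in> S" "k = {p. f p \<noteq> 0}" by (rule imageE)
    from f(1) that have "f \<in> polynomial_functions C" by (rule subsetD[rotated])
    then have "k \<in> ?G" unfolding f(2) by (intro CollectI exI[of _ f] conjI refl)
    then show "generate_topology_on ?G k" by (rule generate_topology_on.Basis)
  qed
  have *: "openin (zariski C) U \<longleftrightarrow>
      (\<exists>S\<subseteq>polynomial_functions C. U = (\<Union>f\<in>S. {p. f p \<noteq> 0}))" for U
    unfolding zariski_def openin_topology_generated_by_iff
  proof
    assume "\<exists>S\<subseteq>polynomial_functions C. U = (\<Union>f\<in>S. {p. f p \<noteq> 0})"
    then obtain S where "S \<subseteq> polynomial_functions C" and U: "U = (\<Union>f\<in>S. {p. f p \<noteq> 0})"
      by (elim exE conjE)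
    then show "generate_topology_on ?G U" unfolding U by (intro gen)
  qed (rule open_imp)
  have compl: "- (\<Union>f\<in>S. {p. f p \<noteq> 0}) = {p. \<forall>f\<in>S. f p = 0}" for S :: "('p \<Rightarrow> 'k) set"
    by blast
  have "closedin (zariski C) Z \<longleftrightarrow> openin (zariski C) (- Z)"
    by (simp add: closedin_def Compl_eq_Diff_UNIV)
  also have "\<dots> \<longleftrightarrow> (\<exists>S\<subseteq>polynomial_functions C. Z = - (\<Union>f\<in>S. {p. f p \<noteq> 0}))"
    unfolding * using double_complement by metis
  finally show ?thesis unfolding compl .
qed

text \<open>
  \<open>End(W)\<close> and \<open>W \<times> End(W)\<close> as affine spaces: the coordinates on \<open>End(W)\<close> are the functions
  \<open>y \<mapsto> \<phi> (y u)\<close> with \<open>\<phi>\<close> a linear functional.  Only the topology induced on sets of linear maps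
  is of interest.
\<close>

definition coords_End :: "('k::field \<Rightarrow> 'w::ab_group_add \<Rightarrow> 'w) \<Rightarrow> (('w \<Rightarrow> 'w) \<Rightarrow> 'k) set" where
  "coords_End smul = {\<lambda>y. \<phi> (y u) | \<phi> u. Vector_Spaces.linear smul (*) \<phi>}"

definition coords_pair ::
  "('k::field \<Rightarrow> 'w::ab_group_add \<Rightarrow> 'w) \<Rightarrow> ('w \<times> ('w \<Rightarrow> 'w) \<Rightarrow> 'k) set" where
  "coords_pair smul =
     {\<lambda>p. \<phi> (fst p) | \<phi>. Vector_Spaces.linear smul (*) \<phi>} \<union>
     {\<lambda>p. f (snd p) | f. f \<in> coords_End smul}"

definition irreducible_subset :: "'p topology \<Rightarrow> 'p set \<Rightarrow> bool" where
  "irreducible_subset T Z \<longleftrightarrow> Z \<noteq> {} \<and>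
     (\<forall>A B. closedin T A \<and> closedin T B \<and> Z \<subseteq> A \<union> B \<longrightarrow> Z \<subseteq> A \<or> Z \<subseteq> B)"

definition krull_dim :: "'p topology \<Rightarrow> enat" where
  "krull_dim T = Sup {enat r | r. \<exists>Z :: nat \<Rightarrow> 'p set.
     (\<forall>i\<le>r. closedin T (Z i) \<and> irreducible_subset T (Z i)) \<and> (\<forall>i<r. Z i \<subset> Z (Suc i))}"

definition dim_End :: "('k::field \<Rightarrow> 'w::ab_group_add \<Rightarrow> 'w) \<Rightarrow> ('w \<Rightarrow> 'w) set \<Rightarrow> enat" where
  "dim_End smul X = krull_dim (subtopology (zariski (coords_End smul)) X)"

definition dim_pair ::
  "('k::field \<Rightarrow> 'w::ab_group_add \<Rightarrow> 'w) \<Rightarrow> ('w \<times> ('w \<Rightarrow> 'w)) set \<Rightarrow> enat" where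
  "dim_pair smul X = krull_dim (subtopology (zariski (coords_pair smul)) X)"


section \<open>Extension of scalars\<close>

text \<open>
  Over a finite field every orbit is a finite set of points, and its dimension as a variety is only
  visible after enlarging the field.  Therefore dimensions of orbits are taken over an infinite
  field \<open>'k\<close> containing \<open>'f\<close>, for instance the algebraic closure of \<open>'f\<close>, or \<open>'f\<close> itself
  if it is infinite (with \<open>\<iota>\<close> and \<open>\<beta>\<close> the identity).

  The following says that \<open>\<iota>\<close> is a field embedding and that \<open>\<beta>\<close> induces an isomorphism from the
  tensor product of \<open>'k\<close> and \<open>'v\<close> over \<open>'f\<close> onto \<open>'w\<close>.
\<close>

definition scalar_extension ::
  "('f::field \<Rightarrow> 'v::ab_group_add \<Rightarrow> 'v) \<Rightarrow> ('k::field \<Rightarrow> 'w::ab_group_add \<Rightarrow> 'w) \<Rightarrow>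
     ('f \<Rightarrow> 'k) \<Rightarrow> ('v \<Rightarrow> 'w) \<Rightarrow> bool" where
  "scalar_extension smulV smulW \<iota> \<beta> \<longleftrightarrow>
     vector_space smulV \<and> vector_space smulW \<and>
     \<iota> 1 = 1 \<and> (\<forall>a c. \<iota> (a + c) = \<iota> a + \<iota> c) \<and> (\<forall>a c. \<iota> (a * c) = \<iota> a * \<iota> c) \<and>
     (\<forall>u w. \<beta> (u + w) = \<beta> u + \<beta> w) \<and> (\<forall>a u. \<beta> (smulV a u) = smulW (\<iota> a) (\<beta> u)) \<and>
     (\<exists>B. \<not> module.dependent smulV B \<and> module.span smulV B = UNIV \<and>
          inj_on \<beta> B \<and> \<not> module.dependent smulW (\<beta> ` B) \<and> module.span smulW (\<beta> ` B) = UNIV)"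

definition extend_coloring ::
  "('k::field \<Rightarrow> 'w::ab_group_add \<Rightarrow> 'w) \<Rightarrow> ('v \<Rightarrow> 'w) \<Rightarrow> (int \<Rightarrow> 'v set) \<Rightarrow> int \<Rightarrow> 'w set" where
  "extend_coloring smulW \<beta> V m = module.span smulW (\<beta> ` V m)"

definition extends_endo ::
  "('k::field \<Rightarrow> 'w::ab_group_add \<Rightarrow> 'w) \<Rightarrow> ('v \<Rightarrow> 'w) \<Rightarrow> ('v \<Rightarrow> 'v) \<Rightarrow> ('w \<Rightarrow> 'w) \<Rightarrow> bool" where
  "extends_endo smulW \<beta> x y \<longleftrightarrow>
     Vector_Spaces.linear smulW smulW y \<and> (\<forall>u. y (\<beta> u) = \<beta> (x u))"

end

theory Submission
  imports Defs "HOL-Library.Function_Algebras"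
begin

text \<open>
  Let \<open>E\<close> be the algebra of color-preserving endomorphisms of \<open>W\<close>, \<open>A\<close> the space of all \<open>a \<in> E\<close> with
  \<open>ax = xa\<close> and \<open>av = 0\<close>, and \<open>S\<close> a linear complement of \<open>A\<close> in \<open>E\<close>.  For a point \<open>q = g \<cdot> (v, x) = (w, y)\<close>
  of the orbit the set of all \<open>z \<in> E\<close> with \<open>yz = zx\<close> and \<open>zv = w\<close> is the affine space \<open>g(1 + A)\<close>, cut out
  by linear equations whose coefficients are polynomial in \<open>q\<close>.  Near the base point it meets \<open>1 + S\<close> in
  exactly one invertible element, which is a rational function of \<open>q\<close>.  Hence an open subset of the affine
  space \<open>1 + S\<close> is a chart of the orbit, and by homogeneity the orbit has dimension \<open>dim E - dim A\<close>.

  That the dimension of such a space is at most \<open>m = dim S\<close> is seen by counting: a chain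
  \<open>Z\<^sub>0 \<subset> \<dots> \<subset> Z\<^sub>r\<close> of irreducible closed sets yields \<open>r\<close> algebraically independent functions, that is
  \<open>N ^ r\<close> linearly independent monomials, whose pullbacks lie in a space of dimension \<open>O(N ^ m)\<close>.

  For \<open>v = 0\<close> an element of \<open>A\<close> is determined by the images of the generators \<open>v\<^sub>k\<close> of the Jordan blocks,
  which can be chosen freely in the part of color \<open>\<epsilon>\<^sub>k\<close> of the kernel of the \<open>\<lambda>\<^sub>k\<close>-th power of \<open>x\<close>.
  Requiring \<open>av = 0\<close> lowers the dimension by that of \<open>Av\<close>, and the inequalities of a striped
  bipartition say that \<open>Av\<close> is spanned by the \<open>v\<^sub>i\<^sub>,\<^sub>j\<close> with \<open>1 \<le> j \<le> \<mu>\<^sub>i\<close> and \<open>j \<equiv> \<mu>\<^sub>i\<close> modulo \<open>n\<close>.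
\<close>

section \<open>Polynomial functions on affine space\<close>

text \<open>The equations \<open>gx = xg\<close> and \<open>gv = v\<close> are linear in
  \<open>g\<close>, so the stabilizer consists of the invertible elements of the affine space
  \<open>1 + A\<close>. This linearity carries the proof: recovering a group element from a point of
  the orbit means solving linear equations. Charts with rational inverses therefore exist over every
  infinite field and in every characteristic, without tangent spaces or separability. The complement
  \<open>S\<close> is chosen once, at the base point. It still serves nearby because transversality
  of \<open>gA\<close> and \<open>S\<close> is guaranteed by a polynomial that does not vanish at
  the base point. The upper bound compares growth in \<open>N\<close>, so degrees and denominators
  of the pulled back monomials must be bounded linearly in \<open>N\<close>. For the lower bound a
  chain is formed from the closures of the images of coordinate subspaces. There the infinite field
  enters: finitely many polynomial conditions of being nonzero can be met simultaneously on a
  line.\<close>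

lemma polynomial_functions_uminus:
  assumes "f \<in> polynomial_functions C"
  shows "(\<lambda>p. - f p) \<in> polynomial_functions C"
  using polynomial_functions.mult[OF polynomial_functions.const[of "-1"] assms] by simp

lemma polynomial_functions_diff:
  assumes "f \<in> polynomial_functions C" "g \<in> polynomial_functions C"
  shows "(\<lambda>p. f p - g p) \<in> polynomial_functions C"
  using polynomial_functions.add[OF assms(1) polynomial_functions_uminus[OF assms(2)]] by simp

lemma polynomial_functions_sum:
  assumes "\<And>i. i \<in> I \<Longrightarrow> f i \<in> polynomial_functions C"
  shows "(\<lambda>p. \<Sum>i\<in>I. f i p) \<in> polynomial_functions C"
  using assms
proof (induction I rule: infinite_finite_induct)
  case (insert i I)
  then show ?case by (simp add: polynomial_functions.add)
qed (simp_all add: polynomial_functions.const)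

lemma polynomial_functions_power:
  assumes "f \<in> polynomial_functions C"
  shows "(\<lambda>p. f p ^ k) \<in> polynomial_functions C"
  using assms by (induction k) (simp_all add: polynomial_functions.const polynomial_functions.mult)

lemmas polynomial_functions_intros = polynomial_functions.const polynomial_functions.add
  polynomial_functions.mult polynomial_functions_uminus polynomial_functions_diff
  polynomial_functions_sum polynomial_functions_power

text \<open>Sums are brought to a common denominator and products multiply the denominators, hence
  \<open>e + e'\<close> in both cases. The lemma is used in two directions: to pull functions on the
  orbit back along a chart, and to compose a polynomial in the parameters with the rational inverse
  of a chart.\<close>

lemma polynomial_functions_clear_denominators:
  fixes \<phi> :: "'t \<Rightarrow> 'p" and \<delta> :: "'t \<Rightarrow> 'k::field"
  assumes "f \<in> polynomial_functions C" and \<delta>: "\<delta> \<in> polynomial_functions D"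
    and coords: "\<And>c. c \<in> C \<Longrightarrow>
      \<exists>e. \<exists>F\<in>polynomial_functions D. \<forall>t. \<delta> t \<noteq> 0 \<longrightarrow> F t = \<delta> t ^ e * c (\<phi> t)"
  shows "\<exists>e. \<exists>F\<in>polynomial_functions D. \<forall>t. \<delta> t \<noteq> 0 \<longrightarrow> F t = \<delta> t ^ e * f (\<phi> t)"
  using assms(1)
proof induction
  case (const a)
  show ?case
    by (rule exI[of _ 0], rule bexI[of _ "\<lambda>_. a"]) (simp_all add: polynomial_functions.const)
next
  case (coord f)
  then show ?case by (rule coords)
next
  case (add f g)
  obtain e F e' G where F: "F \<in> polynomial_functions D" "\<And>t. \<delta> t \<noteq> 0 \<Longrightarrow> F t = \<delta> t ^ e * f (\<phi> t)"
    and G: "G \<in> polynomial_functions D" "\<And>t. \<delta> t \<noteq> 0 \<Longrightarrow> G t = \<delta> t ^ e' * g (\<phi> t)"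
    using add.IH by metis
  show ?case
  proof (rule exI[of _ "e + e'"], rule bexI[of _ "\<lambda>t. \<delta> t ^ e' * F t + \<delta> t ^ e * G t"])
    show "(\<lambda>t. \<delta> t ^ e' * F t + \<delta> t ^ e * G t) \<in> polynomial_functions D"
      using F(1) G(1) \<delta> by (intro polynomial_functions_intros)
  qed (simp add: F(2) G(2) power_add algebra_simps)
next
  case (mult f g)
  obtain e F e' G where F: "F \<in> polynomial_functions D" "\<And>t. \<delta> t \<noteq> 0 \<Longrightarrow> F t = \<delta> t ^ e * f (\<phi> t)"
    and G: "G \<in> polynomial_functions D" "\<And>t. \<delta> t \<noteq> 0 \<Longrightarrow> G t = \<delta> t ^ e' * g (\<phi> t)"
    using mult.IH by metis
  show ?case
  proof (rule exI[of _ "e + e'"], rule bexI[of _ "\<lambda>t. F t * G t"])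
    show "(\<lambda>t. F t * G t) \<in> polynomial_functions D"
      using F(1) G(1) by (intro polynomial_functions_intros)
  qed (simp add: F(2) G(2) power_add algebra_simps)
qed

text \<open>Points are sequences indexed by all of \<open>nat\<close>, but polynomials see only the
  entries below \<open>m\<close>. Affine spaces of all dimensions thus share one type.\<close>

definition affine_coords :: "nat \<Rightarrow> ((nat \<Rightarrow> 'k) \<Rightarrow> 'k) set" where
  "affine_coords m = {\<lambda>t. t i | i. i < m}"

lemma polynomial_functions_line:
  fixes F :: "(nat \<Rightarrow> 'k::field) \<Rightarrow> 'k"
  assumes "F \<in> polynomial_functions (affine_coords m)"
  shows "\<exists>P. \<forall>s. F (\<lambda>i. a i + s * (b i - a i)) = poly P s"
  using assms
proof induction
  case (const c)
  show ?case by (rule exI[of _ "[:c:]"]) simp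
next
  case (coord f)
  then obtain i where "f = (\<lambda>t. t i)" by (auto simp: affine_coords_def)
  then show ?case by (intro exI[of _ "[:a i, b i - a i:]"]) simp
next
  case (add f g)
  then obtain P Q where "\<And>s. f (\<lambda>i. a i + s * (b i - a i)) = poly P s"
    "\<And>s. g (\<lambda>i. a i + s * (b i - a i)) = poly Q s" by metis
  then show ?case by (intro exI[of _ "P + Q"]) simp
next
  case (mult f g)
  then obtain P Q where "\<And>s. f (\<lambda>i. a i + s * (b i - a i)) = poly P s"
    "\<And>s. g (\<lambda>i. a i + s * (b i - a i)) = poly Q s" by metis
  then show ?case by (intro exI[of _ "P * Q"]) simp
qed

text \<open>On the line through \<open>a\<close> and \<open>b\<close> the functions become
  polynomials in \<open>s\<close>, nonzero at \<open>s = 0\<close> and \<open>s = 1\<close>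
  respectively, and their product has finitely many roots. This is the irreducibility of affine
  space in a form that applies to linear subspaces as well, because the point found stays on the
  line.\<close>

lemma ex_common_nonzero_on_line:
  fixes F G :: "(nat \<Rightarrow> 'k::field) \<Rightarrow> 'k"
  assumes "infinite (UNIV :: 'k set)"
    and "F \<in> polynomial_functions (affine_coords m)" "G \<in> polynomial_functions (affine_coords m)"
    and "F a \<noteq> 0" "G b \<noteq> 0"
  obtains s where "F (\<lambda>i. a i + s * (b i - a i)) \<noteq> 0" "G (\<lambda>i. a i + s * (b i - a i)) \<noteq> 0"
proof -
  obtain P where P: "\<And>s. F (\<lambda>i. a i + s * (b i - a i)) = poly P s"
    using polynomial_functions_line[OF assms(2)] by blast
  obtain Q where Q: "\<And>s. G (\<lambda>i. a i + s * (b i - a i)) = poly Q s"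
    using polynomial_functions_line[OF assms(3)] by blast
  have "poly P 0 \<noteq> 0" "poly Q 1 \<noteq> 0" using P[of 0] Q[of 1] assms by simp_all
  then have "P * Q \<noteq> 0" by auto
  then have "finite {s. poly (P * Q) s = 0}" by (rule poly_roots_finite)
  then obtain s where "poly (P * Q) s \<noteq> 0"
    using assms(1) ex_new_if_finite by blast
  then show thesis by (intro that[of s]) (auto simp: P Q)
qed

section \<open>Linear relations and monomials of bounded degree\<close>

lemma homogeneous_system_nontrivial_solution:
  fixes \<kappa> :: "'a \<Rightarrow> 'b \<Rightarrow> 'k::field"
  assumes "finite B" "finite S" "card B < card S"
  shows "\<exists>c. (\<exists>a\<in>S. c a \<noteq> 0) \<and> (\<forall>b\<in>B. (\<Sum>a\<in>S. c a * \<kappa> a b) = 0)"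
  using assms
proof (induction B arbitrary: S \<kappa> rule: finite_induct)
  case empty
  then obtain a where "a \<in> S" by fastforce
  then show ?case by (intro exI[of _ "\<lambda>_. 1"]) auto
next
  case (insert b B)
  show ?case
  proof (cases "\<forall>a\<in>S. \<kappa> a b = 0")
    case True
    then show ?thesis using insert.IH[of S \<kappa>] insert.prems insert.hyps by auto
  next
    case False
    then obtain a0 where a0: "a0 \<in> S" "\<kappa> a0 b \<noteq> 0" by blast
    let ?S = "S - {a0}"
    have "card B < card ?S" using insert a0 by simp
    \<comment> \<open>Equation \<open>b\<close> eliminates the unknown \<open>a0\<close> from the
      other equations; \<open>d\<close> below is the value at \<open>a0\<close> that equation
      \<open>b\<close> then forces.\<close>
    from insert.IH[OF _ this, of "\<lambda>a b'. \<kappa> a b' - \<kappa> a b / \<kappa> a0 b * \<kappa> a0 b'"] insert.prems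
    obtain c where c: "\<exists>a\<in>?S. c a \<noteq> 0"
      "\<And>b'. b' \<in> B \<Longrightarrow> (\<Sum>a\<in>?S. c a * (\<kappa> a b' - \<kappa> a b / \<kappa> a0 b * \<kappa> a0 b')) = 0"
      by auto
    define d where "d = - (\<Sum>a\<in>?S. c a * \<kappa> a b / \<kappa> a0 b)"
    have sum: "(\<Sum>a\<in>S. (c(a0 := d)) a * \<kappa> a b') =
        (\<Sum>a\<in>?S. c a * (\<kappa> a b' - \<kappa> a b / \<kappa> a0 b * \<kappa> a0 b'))" for b'
    proof -
      have "(\<Sum>a\<in>S. (c(a0 := d)) a * \<kappa> a b') = d * \<kappa> a0 b' + (\<Sum>a\<in>?S. c a * \<kappa> a b')"
        using a0 insert.prems(1) by (subst sum.remove[of _ a0]) (auto intro: sum.cong)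
      then show ?thesis
        by (simp add: d_def algebra_simps sum_subtractf sum_distrib_left sum_distrib_right)
    qed
    show ?thesis
    proof (intro exI[of _ "c(a0 := d)"] conjI ballI)
      fix b' assume "b' \<in> insert b B"
      then show "(\<Sum>a\<in>S. (c(a0 := d)) a * \<kappa> a b') = 0"
        unfolding sum using c(2) a0 by auto
    qed (use c(1) in auto)
  qed
qed

definition multi_monomial :: "nat \<Rightarrow> (nat \<Rightarrow> nat) \<Rightarrow> (nat \<Rightarrow> 'k::comm_ring_1) \<Rightarrow> 'k" where
  "multi_monomial m b t = (\<Prod>i<m. t i ^ b i)"

text \<open>The bound concerns the exponent of each variable separately. The monomials then form a
  box with \<open>(c + 1) ^ m\<close> elements, which makes the count explicit.\<close>

inductive_set bounded_degree :: "nat \<Rightarrow> nat \<Rightarrow> ((nat \<Rightarrow> 'k::comm_ring_1) \<Rightarrow> 'k) set"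
  for m c :: nat where
  monomial: "(\<And>i. i < m \<Longrightarrow> b i \<le> c) \<Longrightarrow> multi_monomial m b \<in> bounded_degree m c"
| add: "f \<in> bounded_degree m c \<Longrightarrow> g \<in> bounded_degree m c \<Longrightarrow>
          (\<lambda>t. f t + g t) \<in> bounded_degree m c"
| scale: "f \<in> bounded_degree m c \<Longrightarrow> (\<lambda>t. a * f t) \<in> bounded_degree m c"

lemma bounded_degree_mono:
  assumes "f \<in> bounded_degree m c" "c \<le> c'"
  shows "f \<in> bounded_degree m c'"
  using assms(1)
proof induction
  case (monomial b)
  with assms(2) show ?case by (intro bounded_degree.monomial) (meson order_trans)
qed (auto intro: bounded_degree.intros)

lemma bounded_degree_mult:
  assumes "f \<in> bounded_degree m c" "g \<in> bounded_degree m c'"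
  shows "(\<lambda>t. f t * g t) \<in> bounded_degree m (c + c')"
  using assms(1)
proof induction
  case (monomial b)
  show ?case using assms(2)
  proof induction
    case (monomial b')
    have "(\<lambda>t :: nat \<Rightarrow> 'a. multi_monomial m b t * multi_monomial m b' t) =
        multi_monomial m (\<lambda>i. b i + b' i)"
      by (auto simp: multi_monomial_def power_add prod.distrib)
    moreover have "(multi_monomial m (\<lambda>i. b i + b' i) :: (nat \<Rightarrow> 'a) \<Rightarrow> 'a)
        \<in> bounded_degree m (c + c')"
      using \<open>\<And>i. i < m \<Longrightarrow> b i \<le> c\<close> monomial by (intro bounded_degree.monomial add_mono)
    ultimately show ?case by simp
  next
    case (add f g)
    then show ?case by (simp add: distrib_left bounded_degree.add)
  next
    case (scale f a)
    from bounded_degree.scale[OF scale.IH, of a] show ?case by (simp add: mult.left_commute)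
  qed
next
  case (add f g)
  then show ?case by (simp add: distrib_right bounded_degree.add)
next
  case (scale f a)
  from bounded_degree.scale[OF scale.IH, of a] show ?case by (simp add: mult.assoc)
qed

lemma bounded_degree_const: "(\<lambda>_. a :: 'a::comm_ring_1) \<in> bounded_degree m c"
proof -
  have "multi_monomial m (\<lambda>_. 0) = (\<lambda>_. 1 :: 'a)" by (auto simp: multi_monomial_def)
  moreover have "(multi_monomial m (\<lambda>_. 0) :: (nat \<Rightarrow> 'a) \<Rightarrow> 'a) \<in> bounded_degree m c"
    by (rule bounded_degree.monomial) simp
  ultimately have "(\<lambda>_. 1 :: 'a) \<in> bounded_degree m c" by simp
  from bounded_degree.scale[OF this, of a] show ?thesis by simp
qed

lemma bounded_degree_power:
  assumes "f \<in> bounded_degree m c"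
  shows "(\<lambda>t. f t ^ k) \<in> bounded_degree m (k * c)"
proof (induction k)
  case (Suc k)
  from bounded_degree_mult[OF assms Suc] show ?case by simp
qed (simp add: bounded_degree_const)

lemma polynomial_functions_bounded_degree:
  assumes "f \<in> polynomial_functions (affine_coords m)"
  shows "\<exists>c. f \<in> bounded_degree m c"
  using assms
proof induction
  case (const a)
  show ?case using bounded_degree_const by blast
next
  case (coord f)
  then obtain i where i: "i < m" "f = (\<lambda>t. t i)" by (auto simp: affine_coords_def)
  have "multi_monomial m (\<lambda>j. if j = i then 1 else 0) = f"
  proof
    fix t :: "nat \<Rightarrow> 'a"
    have "multi_monomial m (\<lambda>j. if j = i then 1 else 0) t = (\<Prod>j<m. if j = i then t j else 1)"
      unfolding multi_monomial_def by (rule prod.cong) auto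
    then show "multi_monomial m (\<lambda>j. if j = i then 1 else 0) t = f t"
      using i by (simp add: prod.delta)
  qed
  moreover have "multi_monomial m (\<lambda>j. if j = i then 1 else 0) \<in> bounded_degree m 1"
    by (rule bounded_degree.monomial) auto
  ultimately show ?case by auto
next
  case (add f g)
  then obtain c c' where "f \<in> bounded_degree m c" "g \<in> bounded_degree m c'" by blast
  then have "f \<in> bounded_degree m (max c c')" "g \<in> bounded_degree m (max c c')"
    by (auto intro: bounded_degree_mono)
  then show ?case using bounded_degree.add by blast
next
  case (mult f g)
  then show ?case using bounded_degree_mult by blast
qed

lemma bounded_degree_expansion:
  assumes "f \<in> bounded_degree m c"
  shows "\<exists>\<kappa>. \<forall>t. f t = (\<Sum>b\<in>{..<m} \<rightarrow>\<^sub>E {..c}. \<kappa> b * multi_monomial m b t)"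
  using assms
proof induction
  case (monomial b)
  \<comment> \<open>Exponents at indices from \<open>m\<close> on do not affect the monomial;
    restricting puts \<open>b\<close> into the finite index set of extensional functions.\<close>
  let ?b = "restrict b {..<m}"
  have "multi_monomial m b t = multi_monomial m ?b t" for t :: "nat \<Rightarrow> 'a"
    by (auto simp: multi_monomial_def intro: prod.cong)
  moreover have "(\<Sum>b'\<in>{..<m} \<rightarrow>\<^sub>E {..c}. (if b' = ?b then 1 else 0) * multi_monomial m b' t) =
      multi_monomial m ?b t" for t :: "nat \<Rightarrow> 'a"
  proof -
    have "?b \<in> {..<m} \<rightarrow>\<^sub>E {..c}" using monomial by auto
    moreover have "finite ({..<m} \<rightarrow>\<^sub>E {..c})" by (intro finite_PiE) auto
    ultimately have "(\<Sum>b'\<in>{..<m} \<rightarrow>\<^sub>E {..c}. if b' = ?b then multi_monomial m b' t else 0) =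
        multi_monomial m ?b t"
      by (simp only: sum.delta if_True)
    moreover have "(if b' = ?b then 1 else 0) * multi_monomial m b' t =
        (if b' = ?b then multi_monomial m b' t else 0)" for b' by simp
    ultimately show ?thesis by (simp only:)
  qed
  ultimately have "multi_monomial m b t =
      (\<Sum>b'\<in>{..<m} \<rightarrow>\<^sub>E {..c}. (if b' = ?b then 1 else 0) * multi_monomial m b' t)"
      for t :: "nat \<Rightarrow> 'a"
    by (simp only:)
  then show ?case by (intro exI allI)
next
  case (add f g)
  obtain \<kappa> where "\<forall>t. f t = (\<Sum>b\<in>{..<m} \<rightarrow>\<^sub>E {..c}. \<kappa> b * multi_monomial m b t)"
    using add.IH(1) by (rule exE)
  moreover obtain \<kappa>' where "\<forall>t. g t = (\<Sum>b\<in>{..<m} \<rightarrow>\<^sub>E {..c}. \<kappa>' b * multi_monomial m b t)"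
    using add.IH(2) by (rule exE)
  ultimately show ?case
    by (intro exI[of _ "\<lambda>b. \<kappa> b + \<kappa>' b"]) (simp add: sum.distrib distrib_right)
next
  case (scale f a)
  obtain \<kappa> where "\<forall>t. f t = (\<Sum>b\<in>{..<m} \<rightarrow>\<^sub>E {..c}. \<kappa> b * multi_monomial m b t)"
    using scale.IH by (rule exE)
  then show ?case by (intro exI[of _ "\<lambda>b. a * \<kappa> b"]) (simp add: sum_distrib_left mult.assoc)
qed

text \<open>
  Gaussian elimination over the ring of polynomial functions, with pivots that are nonzero at \<open>p\<^sub>0\<close>.
  It replaces determinants and also applies to infinitely many rows.
\<close>

lemma overdetermined_cramer:
  fixes M :: "'z \<Rightarrow> 'j \<Rightarrow> 'p \<Rightarrow> 'k::field" and C :: "('p \<Rightarrow> 'k) set"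
  assumes "finite J"
    and "\<And>z j. j \<in> J \<Longrightarrow> M z j \<in> polynomial_functions C"
    and "\<And>c. (\<And>z. (\<Sum>j\<in>J. M z j p\<^sub>0 * c j) = 0) \<Longrightarrow> (\<And>j. j \<in> J \<Longrightarrow> c j = 0)"
  shows "\<exists>D\<in>polynomial_functions C. D p\<^sub>0 \<noteq> 0 \<and>
    (\<forall>b. (\<forall>z. b z \<in> polynomial_functions C) \<longrightarrow>
      (\<exists>\<tau>. (\<forall>j. \<tau> j \<in> polynomial_functions C) \<and>
        (\<forall>q c. (\<forall>z. (\<Sum>j\<in>J. M z j q * c j) = b z q) \<longrightarrow> (\<forall>j\<in>J. D q * c j = \<tau> j q))))"
  using assms
proof (induction J arbitrary: M rule: finite_induct)
  case empty
  show ?case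
    by (rule bexI[of _ "\<lambda>_. 1"]) (auto intro: polynomial_functions.const exI[of _ "\<lambda>_ _. 0"])
next
  case (insert a J)
  \<comment> \<open>Without a pivot in column \<open>a\<close>, the unit vector at \<open>a\<close>
    would solve the homogeneous system at \<open>p\<^sub>0\<close>.\<close>
  obtain z0 where z0: "M z0 a p\<^sub>0 \<noteq> 0"
  proof (rule ccontr)
    assume "\<not> thesis"
    then have "M z a p\<^sub>0 = 0" for z using that by blast
    then have "(\<Sum>j\<in>insert a J. M z j p\<^sub>0 * (if j = a then 1 else 0)) = 0" for z
      by (intro sum.neutral) auto
    then show False using insert.prems(2)[of "\<lambda>j. if j = a then 1 else 0" a] by simp
  qed
  \<comment> \<open>Rows are cross-multiplied instead of divided by the pivot, so the reduced
    coefficients remain polynomial.\<close>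
  let ?M = "\<lambda>z j q. M z0 a q * M z j q - M z a q * M z0 j q"
  have eliminated: "(\<Sum>j\<in>J. ?M z j q * c j) = M z0 a q * (\<Sum>j\<in>insert a J. M z j q * c j)
      - M z a q * (\<Sum>j\<in>insert a J. M z0 j q * c j)" for z q c
    using insert.hyps by (simp add: algebra_simps sum_subtractf sum_distrib_left)
  have "\<exists>D\<in>polynomial_functions C. D p\<^sub>0 \<noteq> 0 \<and>
    (\<forall>b. (\<forall>z. b z \<in> polynomial_functions C) \<longrightarrow>
      (\<exists>\<tau>. (\<forall>j. \<tau> j \<in> polynomial_functions C) \<and>
        (\<forall>q c. (\<forall>z. (\<Sum>j\<in>J. ?M z j q * c j) = b z q) \<longrightarrow> (\<forall>j\<in>J. D q * c j = \<tau> j q))))"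
  proof (rule insert.IH)
    fix z j assume "j \<in> J"
    then show "?M z j \<in> polynomial_functions C"
      using insert.prems(1) by (intro polynomial_functions_intros) auto
  next
    fix c j assume c: "\<And>z. (\<Sum>j\<in>J. ?M z j p\<^sub>0 * c j) = 0" and j: "j \<in> J"
    \<comment> \<open>A solution of the reduced homogeneous system is completed by solving row
      \<open>z0\<close> for the unknown \<open>a\<close>.\<close>
    define d where "d = c(a := - (\<Sum>j\<in>J. M z0 j p\<^sub>0 * c j) / M z0 a p\<^sub>0)"
    have cong: "(\<Sum>j\<in>J. f j * d j) = (\<Sum>j\<in>J. f j * c j)" for f
      using insert.hyps by (intro sum.cong) (auto simp: d_def)
    have "(\<Sum>j\<in>insert a J. M z0 j p\<^sub>0 * d j) = 0"
      using insert.hyps z0 by (simp add: cong) (simp add: d_def)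
    then have "M z0 a p\<^sub>0 * (\<Sum>j\<in>insert a J. M z j p\<^sub>0 * d j) = 0" for z
      using eliminated[where z = z and q = p\<^sub>0 and c = d] c[of z] cong[of "\<lambda>j. ?M z j p\<^sub>0"]
      by (simp only:) simp
    then have "d j = 0" using insert.prems(2)[of d j] z0 j by simp
    then show "c j = 0" using insert.hyps j by (auto simp: d_def split: if_splits)
  qed
  then obtain D where D: "D \<in> polynomial_functions C" "D p\<^sub>0 \<noteq> 0"
    and sol: "\<And>b. (\<And>z. b z \<in> polynomial_functions C) \<Longrightarrow>
      \<exists>\<tau>. (\<forall>j. \<tau> j \<in> polynomial_functions C) \<and>
        (\<forall>q c. (\<forall>z. (\<Sum>j\<in>J. ?M z j q * c j) = b z q) \<longrightarrow> (\<forall>j\<in>J. D q * c j = \<tau> j q))"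
    by blast
  show ?case
  proof (intro bexI[of _ "\<lambda>q. M z0 a q * D q"] conjI allI impI)
    show "(\<lambda>q. M z0 a q * D q) \<in> polynomial_functions C"
      using D insert.prems(1) by (intro polynomial_functions_intros) auto
  next
    fix b :: "'z \<Rightarrow> 'p \<Rightarrow> 'k" assume b: "\<forall>z. b z \<in> polynomial_functions C"
    have "(\<lambda>q. M z0 a q * b z q - M z a q * b z0 q) \<in> polynomial_functions C" for z
      using b insert.prems(1) by (intro polynomial_functions_intros) auto
    from sol[of "\<lambda>z q. M z0 a q * b z q - M z a q * b z0 q", OF this] obtain \<tau> where \<tau>: "\<And>j. \<tau> j \<in> polynomial_functions C"
      and sol': "\<And>q c j. (\<And>z. (\<Sum>j\<in>J. ?M z j q * c j) = M z0 a q * b z q - M z a q * b z0 q) \<Longrightarrow>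
        j \<in> J \<Longrightarrow> D q * c j = \<tau> j q"
      by blast
    \<comment> \<open>Back substitution: row \<open>z0\<close> multiplied by \<open>D q\<close>
      yields the unknown \<open>a\<close> with denominator \<open>M z0 a q * D q\<close>. The other
      numerators are multiplied by the pivot to share this denominator.\<close>
    define \<tau>' where "\<tau>' = (\<lambda>j q. if j = a then D q * b z0 q - (\<Sum>j\<in>J. M z0 j q * \<tau> j q)
      else M z0 a q * \<tau> j q)"
    show "\<exists>\<tau>. (\<forall>j. \<tau> j \<in> polynomial_functions C) \<and>
        (\<forall>q c. (\<forall>z. (\<Sum>j\<in>insert a J. M z j q * c j) = b z q) \<longrightarrow>
          (\<forall>j\<in>insert a J. M z0 a q * D q * c j = \<tau> j q))"
    proof (intro exI[of _ \<tau>'] conjI allI impI ballI)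
      fix j
      have "(\<lambda>q. D q * b z0 q - (\<Sum>j\<in>J. M z0 j q * \<tau> j q)) \<in> polynomial_functions C"
        "(\<lambda>q. M z0 a q * \<tau> j q) \<in> polynomial_functions C"
        using D(1) b \<tau> insert.prems(1) by (auto intro!: polynomial_functions_intros)
      then show "\<tau>' j \<in> polynomial_functions C"
        by (cases "j = a") (simp_all add: \<tau>'_def)
    next
      fix q c j
      assume c: "\<forall>z. (\<Sum>j\<in>insert a J. M z j q * c j) = b z q" and j: "j \<in> insert a J"
      have \<tau>c: "D q * c i = \<tau> i q" if "i \<in> J" for i
        by (rule sol'[OF _ that]) (simp only: eliminated c)
      show "M z0 a q * D q * c j = \<tau>' j q"
      proof (cases "j = a")
        case True
        have b_q: "b z0 q = M z0 a q * c a + (\<Sum>j\<in>J. M z0 j q * c j)"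
          using c[rule_format, of z0] insert.hyps by simp
        have "(\<Sum>j\<in>J. M z0 j q * \<tau> j q) = D q * (\<Sum>j\<in>J. M z0 j q * c j)"
          unfolding sum_distrib_left by (intro sum.cong) (auto simp flip: \<tau>c)
        then show ?thesis using True by (simp add: \<tau>'_def b_q algebra_simps)
      next
        case False
        then show ?thesis using j \<tau>c by (simp add: \<tau>'_def mult.assoc)
      qed
    qed
  qed (use D z0 in auto)
qed

section \<open>Krull dimension and charts\<close>

lemma separating_polynomial:
  assumes "closedin (subtopology (zariski C) X) A" "p \<in> X" "p \<notin> A"
  obtains f where "f \<in> polynomial_functions C" "f p \<noteq> 0" "\<And>q. q \<in> A \<Longrightarrow> f q = 0"
proof -
  obtain A' where A': "closedin (zariski C) A'" "A = A' \<inter> X"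
    using assms(1) by (auto simp: closedin_subtopology)
  then obtain S where "S \<subseteq> polynomial_functions C" "A' = {p. \<forall>f\<in>S. f p = 0}"
    by (auto simp: closedin_zariski)
  with A' assms that show thesis by blast
qed

lemma closedin_zero_set:
  assumes "f \<in> polynomial_functions C"
  shows "closedin (subtopology (zariski C) X) {p \<in> X. f p = 0}"
proof -
  have "closedin (zariski C) {p. f p = 0}"
    unfolding closedin_zariski using assms by (intro exI[of _ "{f}"]) auto
  then show ?thesis unfolding closedin_subtopology by blast
qed

section \<open>The upper bound: monomials along a chain of irreducible closed sets\<close>

lemma sum_lists_Suc:
  "(\<Sum>xs | length xs = Suc j \<and> set xs \<subseteq> K. g xs) =
   (\<Sum>k\<in>K. \<Sum>xs | length xs = j \<and> set xs \<subseteq> K. g (k # xs))" if "finite K"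
proof -
  have "(\<Sum>xs | length xs = Suc j \<and> set xs \<subseteq> K. g xs) =
      (\<Sum>(k, xs)\<in>K \<times> {xs. length xs = j \<and> set xs \<subseteq> K}. g (k # xs))"
    by (rule sum.reindex_bij_witness[of _ "\<lambda>(k, xs). k # xs" "\<lambda>xs. (hd xs, tl xs)"])
       (auto simp: length_Suc_conv)
  then show ?thesis
    using that finite_lists_length_eq[OF that, of j]
    by (subst sum.cartesian_product) (simp add: conj_commute)
qed

text \<open>The exponent of \<open>f j\<close> comes first in a list of length \<open>Suc j\<close>.\<close>

fun list_monomial :: "(nat \<Rightarrow> 'p \<Rightarrow> 'k::comm_ring_1) \<Rightarrow> nat list \<Rightarrow> 'p \<Rightarrow> 'k" where
  "list_monomial f [] q = 1"
| "list_monomial f (k # xs) q = f (length xs) q ^ k * list_monomial f xs q"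

lemma polynomial_functions_list_monomial:
  assumes "\<And>i. i < length xs \<Longrightarrow> f i \<in> polynomial_functions C"
  shows "list_monomial f xs \<in> polynomial_functions C"
  using assms
proof (induction xs)
  case Nil
  have "list_monomial f [] = (\<lambda>_. 1)" by auto
  then show ?case by (simp add: polynomial_functions.const)
next
  case (Cons k xs)
  have "list_monomial f (k # xs) = (\<lambda>q. f (length xs) q ^ k * list_monomial f xs q)" by auto
  with Cons show ?case by (auto intro!: polynomial_functions_intros)
qed

text \<open>
  In a relation on \<open>Z (Suc j)\<close> the lowest power of \<open>f j\<close> can be cancelled, because \<open>f j\<close> does not vanish
  identically on this irreducible set; restricting to \<open>Z j\<close>, where \<open>f j = 0\<close>, leaves a shorter relation.
\<close>

lemma list_monomials_independent_on_chain:
  fixes f :: "nat \<Rightarrow> 'p \<Rightarrow> 'k::field" and Z :: "nat \<Rightarrow> 'p set"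
  assumes irreducible: "\<And>i. i \<le> r \<Longrightarrow> irreducible_subset (subtopology (zariski C) X) (Z i)"
    and sub: "\<And>i. i \<le> r \<Longrightarrow> Z i \<subseteq> X" and mono: "\<And>i. i < r \<Longrightarrow> Z i \<subseteq> Z (Suc i)"
    and f: "\<And>i. i < r \<Longrightarrow> f i \<in> polynomial_functions C"
    and f_zero: "\<And>i q. i < r \<Longrightarrow> q \<in> Z i \<Longrightarrow> f i q = 0"
    and f_nonzero: "\<And>i. i < r \<Longrightarrow> \<exists>q\<in>Z (Suc i). f i q \<noteq> 0"
    and h: "h \<in> polynomial_functions C" "p \<in> Z 0" "h p \<noteq> 0"
  shows "j \<le> r \<Longrightarrow>
    (\<And>q. q \<in> Z j \<Longrightarrow> h q \<noteq> 0 \<Longrightarrow>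
      (\<Sum>xs | length xs = j \<and> set xs \<subseteq> {..<N}. c xs * list_monomial f xs q) = 0) \<Longrightarrow>
    length xs = j \<Longrightarrow> set xs \<subseteq> {..<N} \<Longrightarrow> c xs = 0"
proof (induction j arbitrary: c xs)
  case 0
  have "{xs. length xs = 0 \<and> set xs \<subseteq> {..<N}} = {[] :: nat list}" by auto
  with 0 h show ?case by simp
next
  case (Suc j)
  \<comment> \<open>The coefficient of \<open>f j ^ k\<close> when the relation is read as a
    polynomial in \<open>f j\<close>.\<close>
  define G where "G k q = (\<Sum>xs | length xs = j \<and> set xs \<subseteq> {..<N}. c (k # xs) * list_monomial f xs q)"
    for k q
  have G: "G k \<in> polynomial_functions C" for k
    unfolding G_def using f Suc.prems(1)
    by (intro polynomial_functions_intros polynomial_functions_list_monomial) auto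
  have sum_G: "(\<Sum>k<N. G k q * f j q ^ k) = 0" if "q \<in> Z (Suc j)" "h q \<noteq> 0" for q
  proof -
    have "(\<Sum>k<N. G k q * f j q ^ k) =
        (\<Sum>k<N. \<Sum>xs | length xs = j \<and> set xs \<subseteq> {..<N}. c (k # xs) * list_monomial f (k # xs) q)"
      unfolding G_def sum_distrib_right by (intro sum.cong refl) (auto simp: algebra_simps)
    also have "\<dots> = 0"
      using Suc.prems(2)[OF that] by (subst (asm) sum_lists_Suc) auto
    finally show ?thesis .
  qed
  have "\<forall>xs. length xs = j \<and> set xs \<subseteq> {..<N} \<longrightarrow> c (k # xs) = 0" if "k < N" for k
    using that
  proof (induction k rule: less_induct)
    case (less k)
    \<comment> \<open>The relation is known only where \<open>h\<close> is nonzero. The factor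
      \<open>h\<close> extends the cancelled relation to all points of \<open>Z (Suc j)\<close> with
      \<open>f j q \<noteq> 0\<close>, so that irreducibility applies.\<close>
    define H where "H q = h q * (\<Sum>l\<in>{k..<N}. G l q * f j q ^ (l - k))" for q
    have H: "H \<in> polynomial_functions C"
      unfolding H_def using h G f Suc.prems(1) by (intro polynomial_functions_intros) auto
    have low: "G l q = 0" if "l < k" for l q
      unfolding G_def using less.IH[OF that] less.prems that by (intro sum.neutral) auto
    have "H q = 0" if q: "q \<in> Z (Suc j)" "f j q \<noteq> 0" for q
    proof (cases "h q = 0")
      case False
      have "(\<Sum>l<N. G l q * f j q ^ l) = (\<Sum>l\<in>{k..<N}. G l q * f j q ^ l)"
        using low by (intro sum.mono_neutral_right) auto
      also have "\<dots> = f j q ^ k * (\<Sum>l\<in>{k..<N}. G l q * f j q ^ (l - k))"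
        unfolding sum_distrib_left
        by (intro sum.cong) (auto simp: mult.left_commute simp flip: power_add)
      finally show ?thesis using sum_G[OF q(1) False] q(2) by (simp add: H_def)
    qed (simp add: H_def)
    then have "Z (Suc j) \<subseteq> {q \<in> X. f j q = 0} \<union> {q \<in> X. H q = 0}"
      using sub[OF Suc.prems(1)] by blast
    moreover have "\<not> Z (Suc j) \<subseteq> {q \<in> X. f j q = 0}"
      using f_nonzero[of j] Suc.prems(1) by auto
    moreover have "closedin (subtopology (zariski C) X) {q \<in> X. f j q = 0}"
      "closedin (subtopology (zariski C) X) {q \<in> X. H q = 0}"
      using f[of j] H Suc.prems(1) by (auto intro!: closedin_zero_set)
    ultimately have "Z (Suc j) \<subseteq> {q \<in> X. H q = 0}"
      using irreducible[OF Suc.prems(1)] unfolding irreducible_subset_def by blast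
    then have H0: "H q = 0" if "q \<in> Z j" for q
      using that mono[of j] Suc.prems(1) by auto
    \<comment> \<open>On \<open>Z j\<close> every term of \<open>H\<close> except the lowest
      contains a positive power of \<open>f j\<close>.\<close>
    have "G k q = 0" if q: "q \<in> Z j" "h q \<noteq> 0" for q
    proof -
      have "f j q = 0" using q f_zero Suc.prems(1) by simp
      then have "(\<Sum>l\<in>{k..<N}. G l q * f j q ^ (l - k)) = (\<Sum>l\<in>{k..<N}. if l = k then G l q else 0)"
        by (intro sum.cong) (auto simp: power_0_left)
      then have "H q = h q * G k q" using less.prems by (simp add: H_def)
      then show ?thesis using H0[OF q(1)] q(2) by simp
    qed
    then show ?case
      using Suc.IH[of "\<lambda>xs. c (k # xs)"] Suc.prems(1) unfolding G_def by auto
  qed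
  with Suc.prems(3,4) show ?case by (cases xs) auto
qed

text \<open>
  The map \<open>\<phi>\<close> is only meaningful where \<open>\<delta>\<close> does not vanish, and there its coordinates are regular
  functions with powers of \<open>\<delta>\<close> as denominators.
\<close>

definition chart :: "('p \<Rightarrow> 'k::field) set \<Rightarrow> 'p set \<Rightarrow> nat \<Rightarrow> ((nat \<Rightarrow> 'k) \<Rightarrow> 'p) \<Rightarrow> ((nat \<Rightarrow> 'k) \<Rightarrow> 'k) \<Rightarrow> bool" where
  "chart C X m \<phi> \<delta> \<longleftrightarrow> \<delta> \<in> polynomial_functions (affine_coords m) \<and>
    (\<forall>c\<in>C. \<exists>e. \<exists>F\<in>polynomial_functions (affine_coords m).
      \<forall>t. \<delta> t \<noteq> 0 \<longrightarrow> F t = \<delta> t ^ e * c (\<phi> t)) \<and>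
    (\<forall>t. \<delta> t \<noteq> 0 \<longrightarrow> \<phi> t \<in> X)"

lemma chart_pullback:
  assumes "chart C X m \<phi> \<delta>" "f \<in> polynomial_functions C"
  shows "\<exists>e. \<exists>F\<in>polynomial_functions (affine_coords m). \<forall>t. \<delta> t \<noteq> 0 \<longrightarrow> F t = \<delta> t ^ e * f (\<phi> t)"
proof (rule polynomial_functions_clear_denominators[OF assms(2)])
  show "\<delta> \<in> polynomial_functions (affine_coords m)" using assms(1) by (simp add: chart_def)
  fix c assume "c \<in> C"
  then show "\<exists>e. \<exists>F\<in>polynomial_functions (affine_coords m). \<forall>t. \<delta> t \<noteq> 0 \<longrightarrow> F t = \<delta> t ^ e * c (\<phi> t)"
    using assms(1) unfolding chart_def by (elim conjE bspec)
qed

text \<open>To transfer linear relations, all monomials with exponents below \<open>N\<close> must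
  be multiplied by the same power of \<open>\<delta>\<close>. Each factor with exponent
  \<open>k\<close> is therefore padded with \<open>\<delta> t ^ (e' * (N - k))\<close>. Both this
  power and the degree grow linearly in \<open>N\<close>, with constants that depend only on the
  chart and on \<open>f\<close>.\<close>

lemma chart_list_monomials_bounded:
  fixes f :: "nat \<Rightarrow> 'p \<Rightarrow> 'k::field"
  assumes "chart C X m \<phi> \<delta>" and f: "\<And>i. i < r \<Longrightarrow> f i \<in> polynomial_functions C"
  shows "\<exists>c e. \<forall>N xs. length xs = r \<and> set xs \<subseteq> {..<N} \<longrightarrow>
    (\<exists>g\<in>bounded_degree m (c * N). \<forall>t. \<delta> t \<noteq> 0 \<longrightarrow> g t = \<delta> t ^ (e * N) * list_monomial f xs (\<phi> t))"
  using f
proof (induction r)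
  case 0
  show ?case
    by (intro exI[of _ 0] allI impI bexI[of _ "\<lambda>_. 1"]) (auto simp: bounded_degree_const)
next
  case (Suc r)
  then obtain c e where IH: "\<And>N xs. length xs = r \<Longrightarrow> set xs \<subseteq> {..<N} \<Longrightarrow>
    \<exists>g\<in>bounded_degree m (c * N). \<forall>t. \<delta> t \<noteq> 0 \<longrightarrow> g t = \<delta> t ^ (e * N) * list_monomial f xs (\<phi> t)"
    by (metis less_Suc_eq)
  obtain e' F where F: "F \<in> polynomial_functions (affine_coords m)"
    "\<And>t. \<delta> t \<noteq> 0 \<Longrightarrow> F t = \<delta> t ^ e' * f r (\<phi> t)"
    using chart_pullback[OF assms(1) Suc.prems[of r]] by blast
  obtain a where a: "F \<in> bounded_degree m a"
    using polynomial_functions_bounded_degree[OF F(1)] by blast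
  obtain d where d: "\<delta> \<in> bounded_degree m d"
    using polynomial_functions_bounded_degree assms(1) unfolding chart_def by blast
  show ?case
  proof (rule exI[of _ "a + e' * d + c"], rule exI[of _ "e' + e"], intro allI impI)
    fix N :: nat and xs :: "nat list" assume xs: "length xs = Suc r \<and> set xs \<subseteq> {..<N}"
    then obtain k ys where xs_eq: "xs = k # ys" by (cases xs) auto
    with xs have ys: "xs = k # ys" "length ys = r" "set ys \<subseteq> {..<N}" "k \<le> N" by auto
    from IH[OF ys(2,3)] obtain g where g: "g \<in> bounded_degree m (c * N)"
      "\<And>t. \<delta> t \<noteq> 0 \<Longrightarrow> g t = \<delta> t ^ (e * N) * list_monomial f ys (\<phi> t)" by blast
    let ?g = "\<lambda>t. F t ^ k * \<delta> t ^ (e' * (N - k)) * g t"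
    show "\<exists>g\<in>bounded_degree m ((a + e' * d + c) * N). \<forall>t. \<delta> t \<noteq> 0 \<longrightarrow>
        g t = \<delta> t ^ ((e' + e) * N) * list_monomial f xs (\<phi> t)"
    proof (intro bexI[of _ ?g] allI impI)
      have "?g \<in> bounded_degree m (k * a + e' * (N - k) * d + c * N)"
        by (intro bounded_degree_mult bounded_degree_power a d g)
      moreover have "k * a + e' * (N - k) * d + c * N \<le> (a + e' * d + c) * N"
      proof -
        have "k * a \<le> N * a" "e' * (N - k) * d \<le> e' * N * d"
          using ys(4) by (intro mult_le_mono; simp)+
        then have "k * a + e' * (N - k) * d + c * N \<le> N * a + e' * N * d + c * N"
          by (intro add_le_mono) simp_all
        then show ?thesis by (simp only: distrib_left distrib_right mult_ac)
      qed
      ultimately show "?g \<in> bounded_degree m ((a + e' * d + c) * N)" by (rule bounded_degree_mono)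
    next
      fix t assume t: "\<delta> t \<noteq> 0"
      have "\<delta> t ^ (e' * k) * \<delta> t ^ (e' * (N - k)) = \<delta> t ^ (e' * N)"
        using ys(4) by (simp flip: power_add distrib_left)
      then show "?g t = \<delta> t ^ ((e' + e) * N) * list_monomial f xs (\<phi> t)"
        by (simp add: F(2)[OF t] g(2)[OF t] ys power_mult_distrib distrib_left distrib_right
            power_add mult_ac flip: power_mult)
    qed
  qed
qed

lemma exponent_le_of_power_bound:
  fixes r m c :: nat
  assumes "\<And>N. N ^ r \<le> (c * N + 1) ^ m"
  shows "r \<le> m"
proof (rule ccontr)
  assume "\<not> r \<le> m"
  \<comment> \<open>For \<open>r > m\<close> the hypothesis gives
    \<open>N ^ (m + 1) \<le> ((c + 1) * N) ^ m\<close>, hence \<open>N \<le> (c + 1) ^ m\<close>;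
    this \<open>N\<close> is the first to violate that.\<close>
  define N where "N = (c + 1) ^ m + 1"
  have "N ^ m * N \<le> N ^ r"
    using \<open>\<not> r \<le> m\<close> power_increasing[of "Suc m" r N] by (simp add: N_def mult.commute)
  also have "\<dots> \<le> (c * N + 1) ^ m" by (rule assms)
  also have "\<dots> \<le> ((c + 1) * N) ^ m" by (intro power_mono) (auto simp: N_def)
  also have "\<dots> = N ^ m * (c + 1) ^ m" by (simp only: power_mult_distrib mult.commute)
  finally have "N \<le> (c + 1) ^ m" by (simp add: N_def)
  then show False by (simp add: N_def)
qed

text \<open>A given chain requires a single chart, around a point \<open>p\<close> of its smallest
  member. Relations that hold merely where \<open>h\<close> is nonzero still force all coefficients
  to vanish, because \<open>h p \<noteq> 0\<close> and \<open>p\<close> lies in every member of the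
  chain.\<close>

lemma krull_dim_le_of_charts:
  fixes C :: "('p \<Rightarrow> 'k::field) set"
  assumes charts: "\<And>p. p \<in> X \<Longrightarrow> \<exists>\<phi> \<delta> h. chart C X m \<phi> \<delta> \<and> h \<in> polynomial_functions C \<and> h p \<noteq> 0 \<and>
      (\<forall>q\<in>X. h q \<noteq> 0 \<longrightarrow> (\<exists>t. \<delta> t \<noteq> 0 \<and> \<phi> t = q))"
  shows "krull_dim (subtopology (zariski C) X) \<le> enat m"
  unfolding krull_dim_def
proof (rule Sup_least)
  let ?T = "subtopology (zariski C) X"
  fix k
  assume "k \<in> {enat r | r. \<exists>Z :: nat \<Rightarrow> 'p set.
    (\<forall>i\<le>r. closedin ?T (Z i) \<and> irreducible_subset ?T (Z i)) \<and> (\<forall>i<r. Z i \<subset> Z (Suc i))}"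
  then obtain r and Z :: "nat \<Rightarrow> 'p set" where k: "k = enat r"
    and Z: "\<forall>i\<le>r. closedin ?T (Z i) \<and> irreducible_subset ?T (Z i)" "\<forall>i<r. Z i \<subset> Z (Suc i)"
    by (elim CollectE exE conjE)
  have sub: "Z i \<subseteq> X" if "i \<le> r" for i
    using Z(1) that closedin_subset[of ?T "Z i"] by simp
  obtain p where p: "p \<in> Z 0"
    using Z(1)[rule_format, of 0] unfolding irreducible_subset_def by blast
  have "p \<in> X" using p sub[of 0] by blast
  from charts[OF this] obtain \<phi> \<delta> h where chart: "chart C X m \<phi> \<delta>"
    and h: "h \<in> polynomial_functions C" "h p \<noteq> 0"
    and cover: "\<And>q. q \<in> X \<Longrightarrow> h q \<noteq> 0 \<Longrightarrow> \<exists>t. \<delta> t \<noteq> 0 \<and> \<phi> t = q"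
    by (elim exE conjE) (rule that, auto)
  have "\<exists>f\<in>polynomial_functions C. (\<forall>q\<in>Z i. f q = 0) \<and> (\<exists>q\<in>Z (Suc i). f q \<noteq> 0)" if "i < r" for i
  proof -
    obtain q where q: "q \<in> Z (Suc i)" "q \<notin> Z i"
      using psubset_imp_ex_mem[OF Z(2)[rule_format, OF \<open>i < r\<close>]] by (elim exE DiffE)
    moreover have "q \<in> X" using q(1) sub[of "Suc i"] that by auto
    moreover have "closedin ?T (Z i)" using Z(1) that by simp
    ultimately obtain f where "f \<in> polynomial_functions C" "f q \<noteq> 0" "\<And>q. q \<in> Z i \<Longrightarrow> f q = 0"
      using separating_polynomial[of C X "Z i" q] by blast
    with q(1) show ?thesis by blast
  qed
  then have "\<forall>i. \<exists>f. i < r \<longrightarrow>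
      f \<in> polynomial_functions C \<and> (\<forall>q\<in>Z i. f q = 0) \<and> (\<exists>q\<in>Z (Suc i). f q \<noteq> 0)" by blast
  from choice[OF this] obtain f where f: "\<And>i. i < r \<Longrightarrow> f i \<in> polynomial_functions C"
    "\<And>i q. i < r \<Longrightarrow> q \<in> Z i \<Longrightarrow> f i q = 0" "\<And>i. i < r \<Longrightarrow> \<exists>q\<in>Z (Suc i). f i q \<noteq> 0"
    by blast
  obtain c e where ce: "\<And>N xs. length xs = r \<Longrightarrow> set xs \<subseteq> {..<N} \<Longrightarrow>
    \<exists>g\<in>bounded_degree m (c * N). \<forall>t. \<delta> t \<noteq> 0 \<longrightarrow> g t = \<delta> t ^ (e * N) * list_monomial f xs (\<phi> t)"
    using chart_list_monomials_bounded[OF chart, of r f] f(1) by blast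
  have "N ^ r \<le> (c * N + 1) ^ m" for N
  proof (rule ccontr)
    assume "\<not> N ^ r \<le> (c * N + 1) ^ m"
    let ?S = "{xs. length xs = r \<and> set xs \<subseteq> {..<N}}" and ?B = "{..<m} \<rightarrow>\<^sub>E {..c * N}"
    have "\<exists>\<kappa>. \<forall>t. \<delta> t \<noteq> 0 \<longrightarrow> \<delta> t ^ (e * N) * list_monomial f xs (\<phi> t) =
        (\<Sum>b\<in>?B. \<kappa> b * multi_monomial m b t)" if "xs \<in> ?S" for xs
    proof -
      obtain g where g: "g \<in> bounded_degree m (c * N)"
        "\<And>t. \<delta> t \<noteq> 0 \<Longrightarrow> g t = \<delta> t ^ (e * N) * list_monomial f xs (\<phi> t)"
        using ce[of xs N] \<open>xs \<in> ?S\<close> by blast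
      obtain \<kappa> where "\<forall>t. g t = (\<Sum>b\<in>?B. \<kappa> b * multi_monomial m b t)"
        using bounded_degree_expansion[OF g(1)] by (rule exE)
      with g(2) show ?thesis by (intro exI[of _ \<kappa>]) simp
    qed
    then have "\<forall>xs. \<exists>\<kappa>. xs \<in> ?S \<longrightarrow> (\<forall>t. \<delta> t \<noteq> 0 \<longrightarrow>
        \<delta> t ^ (e * N) * list_monomial f xs (\<phi> t) = (\<Sum>b\<in>?B. \<kappa> b * multi_monomial m b t))"
      by blast
    from choice[OF this] obtain \<kappa> where \<kappa>: "\<And>xs t. xs \<in> ?S \<Longrightarrow> \<delta> t \<noteq> 0 \<Longrightarrow>
        \<delta> t ^ (e * N) * list_monomial f xs (\<phi> t) = (\<Sum>b\<in>?B. \<kappa> xs b * multi_monomial m b t)"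
      by blast
    have "finite ?S" "card ?S = N ^ r"
      using finite_lists_length_eq[of "{..<N}" r] card_lists_length_eq[of "{..<N}" r]
      by (simp_all add: conj_commute)
    moreover have "finite ?B" "card ?B = (c * N + 1) ^ m"
      by (auto intro!: finite_PiE simp: card_PiE)
    ultimately obtain d where d: "\<exists>xs\<in>?S. d xs \<noteq> 0" "\<And>b. b \<in> ?B \<Longrightarrow> (\<Sum>xs\<in>?S. d xs * \<kappa> xs b) = 0"
      using homogeneous_system_nontrivial_solution[of ?B ?S \<kappa>] \<open>\<not> N ^ r \<le> (c * N + 1) ^ m\<close> by auto
    \<comment> \<open>A relation between coefficient vectors becomes one between the monomials
      themselves, since the common factor \<open>\<delta> t ^ (e * N)\<close> is nonzero on the
      chart.\<close>
    have vanish: "(\<Sum>xs\<in>?S. d xs * list_monomial f xs (\<phi> t)) = 0" if "\<delta> t \<noteq> 0" for t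
    proof -
      have "\<delta> t ^ (e * N) * (\<Sum>xs\<in>?S. d xs * list_monomial f xs (\<phi> t)) =
          (\<Sum>xs\<in>?S. d xs * (\<Sum>b\<in>?B. \<kappa> xs b * multi_monomial m b t))"
        unfolding sum_distrib_left using \<kappa>[OF _ that]
        by (intro sum.cong) (auto simp: mult.left_commute sum_distrib_left)
      also have "\<dots> = (\<Sum>b\<in>?B. (\<Sum>xs\<in>?S. d xs * \<kappa> xs b) * multi_monomial m b t)"
        unfolding sum_distrib_left sum_distrib_right by (subst sum.swap) (simp add: mult.assoc)
      also have "\<dots> = 0" using d(2) by (intro sum.neutral) auto
      finally show ?thesis using that by simp
    qed
    have "d xs = 0" if "xs \<in> ?S" for xs
    proof (rule list_monomials_independent_on_chain[where Z = Z and r = r and f = f and h = h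
          and j = r and C = C and X = X and p = p and N = N])
      show "(\<Sum>xs | length xs = r \<and> set xs \<subseteq> {..<N}. d xs * list_monomial f xs q) = 0"
        if "q \<in> Z r" "h q \<noteq> 0" for q
        using cover[of q] vanish sub[of r] that by auto
    qed (use Z f h p sub that in auto)
    with d(1) show False by blast
  qed
  then have "r \<le> m" by (rule exponent_le_of_power_bound)
  then show "k \<le> enat m" by (simp add: k)
qed

text \<open>The chain consists of the closures \<open>Z i\<close> of the images of the coordinate
  subspaces \<open>t j = 0\<close> for \<open>j \<ge> i\<close>. They are irreducible because two
  points of such a subspace are joined by a line inside it. They increase strictly because
  \<open>\<tau> i\<close> vanishes on \<open>Z i\<close> but not on \<open>Z (Suc i)\<close>: the
  quotients \<open>\<tau> j / D\<close> recover the parameters from the point.\<close>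

lemma krull_dim_ge_of_chart:
  fixes C :: "('p \<Rightarrow> 'k::field) set"
  assumes "infinite (UNIV :: 'k set)" and chart: "chart C X m \<phi> \<delta>" and "\<delta> (\<lambda>_. 0) \<noteq> 0"
    and D: "D \<in> polynomial_functions C" "D (\<phi> (\<lambda>_. 0)) \<noteq> 0"
    and \<tau>: "\<And>j. j < m \<Longrightarrow> \<tau> j \<in> polynomial_functions C"
    and \<tau>_chart: "\<And>t j. \<delta> t \<noteq> 0 \<Longrightarrow> j < m \<Longrightarrow> D (\<phi> t) * t j = \<tau> j (\<phi> t)"
  shows "enat m \<le> krull_dim (subtopology (zariski C) X)"
proof -
  let ?T = "subtopology (zariski C) X"
  define L where "L i = {t :: nat \<Rightarrow> 'k. \<delta> t \<noteq> 0 \<and> (\<forall>j\<ge>i. t j = 0)}" for i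
  define Z where "Z i = ?T closure_of (\<phi> ` L i)" for i
  have \<delta>: "\<delta> \<in> polynomial_functions (affine_coords m)" using chart by (simp add: chart_def)
  have LX: "\<phi> ` L i \<subseteq> X" for i using chart by (auto simp: chart_def L_def)
  have L_Z: "\<phi> ` L i \<subseteq> Z i" for i
    unfolding Z_def using LX by (intro closure_of_subset) simp
  have Z_minimal: "Z i \<subseteq> A" if "closedin ?T A" "\<phi> ` L i \<subseteq> A" for i A
    unfolding Z_def using that by (intro closure_of_minimal)
  have irreducible: "irreducible_subset ?T (Z i)" for i
    unfolding irreducible_subset_def
  proof (intro conjI allI impI)
    have "(\<lambda>_. 0) \<in> L i" using assms(3) by (simp add: L_def)
    then show "Z i \<noteq> {}" using L_Z by blast
  next
    fix A B assume AB: "closedin ?T A \<and> closedin ?T B \<and> Z i \<subseteq> A \<union> B"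
    show "Z i \<subseteq> A \<or> Z i \<subseteq> B"
    proof (rule ccontr)
      assume "\<not> (Z i \<subseteq> A \<or> Z i \<subseteq> B)"
      then have "\<not> \<phi> ` L i \<subseteq> A" "\<not> \<phi> ` L i \<subseteq> B"
        using Z_minimal[of A i] Z_minimal[of B i] AB by auto
      then obtain a b where a: "a \<in> L i" "\<phi> a \<notin> A" and b: "b \<in> L i" "\<phi> b \<notin> B" by auto
      have ab_X: "\<phi> a \<in> X" "\<phi> b \<in> X" using a b LX[of i] by auto
      obtain f where f: "f \<in> polynomial_functions C" "f (\<phi> a) \<noteq> 0" "\<And>q. q \<in> A \<Longrightarrow> f q = 0"
        using separating_polynomial[of C X A "\<phi> a"] a ab_X AB by blast
      obtain g where g: "g \<in> polynomial_functions C" "g (\<phi> b) \<noteq> 0" "\<And>q. q \<in> B \<Longrightarrow> g q = 0"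
        using separating_polynomial[of C X B "\<phi> b"] b ab_X AB by blast
      obtain e F where F: "F \<in> polynomial_functions (affine_coords m)"
        "\<And>t. \<delta> t \<noteq> 0 \<Longrightarrow> F t = \<delta> t ^ e * f (\<phi> t)" using chart_pullback[OF chart f(1)] by blast
      obtain e' G where G: "G \<in> polynomial_functions (affine_coords m)"
        "\<And>t. \<delta> t \<noteq> 0 \<Longrightarrow> G t = \<delta> t ^ e' * g (\<phi> t)" using chart_pullback[OF chart g(1)] by blast
      \<comment> \<open>The extra factor \<open>\<delta>\<close> keeps the common point in the
        domain of the chart.\<close>
      have "(\<lambda>t. F t * \<delta> t) \<in> polynomial_functions (affine_coords m)"
        using F \<delta> by (intro polynomial_functions_intros)
      moreover have "F a * \<delta> a \<noteq> 0" "G b \<noteq> 0" using F(2) f G(2) g a b by (auto simp: L_def)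
      ultimately obtain s where s: "F (\<lambda>i. a i + s * (b i - a i)) * \<delta> (\<lambda>i. a i + s * (b i - a i)) \<noteq> 0"
        "G (\<lambda>i. a i + s * (b i - a i)) \<noteq> 0"
        using ex_common_nonzero_on_line[OF assms(1), of "\<lambda>t. F t * \<delta> t" m G a b] G(1) by blast
      let ?t = "\<lambda>i. a i + s * (b i - a i)"
      have "?t \<in> L i" using s a b by (auto simp: L_def)
      then have "\<phi> ?t \<in> A \<union> B" using L_Z AB by blast
      moreover have "f (\<phi> ?t) \<noteq> 0" "g (\<phi> ?t) \<noteq> 0" using s F(2)[of ?t] G(2)[of ?t] by auto
      ultimately show False using f(3) g(3) by blast
    qed
  qed
  have strict: "Z i \<subset> Z (Suc i)" if "i < m" for i
  proof
    have "L i \<subseteq> L (Suc i)" by (auto simp: L_def)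
    then show "Z i \<subseteq> Z (Suc i)" unfolding Z_def by (intro closure_of_mono image_mono)
    have "\<phi> ` L i \<subseteq> {q \<in> X. \<tau> i q = 0}"
      using LX \<tau>_chart[OF _ that] by (force simp: L_def)
    then have vanish: "Z i \<subseteq> {q \<in> X. \<tau> i q = 0}"
      using closedin_zero_set[OF \<tau>[OF that]] Z_minimal by blast
    obtain e F where F: "F \<in> polynomial_functions (affine_coords m)"
      "\<And>t. \<delta> t \<noteq> 0 \<Longrightarrow> F t = \<delta> t ^ e * D (\<phi> t)" using chart_pullback[OF chart D(1)] by blast
    \<comment> \<open>On the line from the origin in direction \<open>i\<close> a point is sought
      where \<open>\<delta>\<close>, \<open>D\<close> and the \<open>i\<close>-th parameter are all
      nonzero.\<close>
    let ?b = "\<lambda>j. if j = i then 1 else (0 :: 'k)"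
    have "(\<lambda>t. F t * \<delta> t) \<in> polynomial_functions (affine_coords m)"
      using F \<delta> by (intro polynomial_functions_intros)
    moreover have "(\<lambda>t. t i) \<in> polynomial_functions (affine_coords m)"
      using that by (auto simp: affine_coords_def intro: polynomial_functions.coord)
    moreover have "F (\<lambda>_. 0) * \<delta> (\<lambda>_. 0) \<noteq> 0" "?b i \<noteq> 0" using F(2) D assms(3) by auto
    ultimately obtain s where s: "F (\<lambda>j. 0 + s * (?b j - 0)) * \<delta> (\<lambda>j. 0 + s * (?b j - 0)) \<noteq> 0"
      "0 + s * (?b i - 0) \<noteq> 0"
      using ex_common_nonzero_on_line[OF assms(1), of "\<lambda>t. F t * \<delta> t" m "\<lambda>t. t i" "\<lambda>_. 0" ?b] by blast
    let ?t = "\<lambda>j. 0 + s * (?b j - 0)"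
    have "?t \<in> L (Suc i)" using s by (auto simp: L_def)
    moreover have "\<tau> i (\<phi> ?t) \<noteq> 0"
      using s F(2)[of ?t] \<tau>_chart[of ?t, OF _ that] by auto
    ultimately show "Z i \<noteq> Z (Suc i)" using vanish L_Z by blast
  qed
  have "closedin ?T (Z i)" for i unfolding Z_def by simp
  with irreducible strict show ?thesis
    unfolding krull_dim_def by (intro Sup_upper) blast
qed

section \<open>Linear algebra\<close>

context vector_space
begin

lemma subspace_common_zeros:
  assumes "subspace S" "\<And>i x y. i \<in> I \<Longrightarrow> \<Phi> i (x + y) = \<Phi> i x + \<Phi> i y"
    "\<And>i c x. i \<in> I \<Longrightarrow> \<Phi> i (scale c x) = c * \<Phi> i x"
  shows "subspace {s \<in> S. \<forall>i\<in>I. \<Phi> i s = 0}"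
proof (rule subspaceI)
  have "\<Phi> i 0 = 0" if "i \<in> I" for i using assms(3)[OF that, of 0 0] by simp
  then show "0 \<in> {s \<in> S. \<forall>i\<in>I. \<Phi> i s = 0}" using assms(1) by (simp add: subspace_0)
qed (use assms in \<open>auto simp: subspace_add subspace_scale\<close>)

text \<open>Each functional lowers the dimension by exactly one: \<open>b i\<close> satisfies the
  other conditions, and subtracting a multiple of it enforces condition \<open>i\<close>. The
  dimensions of color spaces, kernels, \<open>E\<close> and the stabilizer algebras are all counted
  this way. Finiteness is expressed by a spanning set \<open>F\<close> because the ambient space may
  be that of all functions from \<open>W\<close> to \<open>W\<close>.\<close>

lemma dim_dual_functionals:
  fixes \<Phi> :: "'i \<Rightarrow> 'b \<Rightarrow> 'a"
  assumes "finite I" and S: "subspace S" "finite F" "S \<subseteq> span F"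
    and \<Phi>: "\<And>i x y. i \<in> I \<Longrightarrow> \<Phi> i (x + y) = \<Phi> i x + \<Phi> i y"
      "\<And>i c x. i \<in> I \<Longrightarrow> \<Phi> i (scale c x) = c * \<Phi> i x"
    and b: "\<And>i. i \<in> I \<Longrightarrow> b i \<in> S"
      "\<And>i j. i \<in> I \<Longrightarrow> j \<in> I \<Longrightarrow> \<Phi> i (b j) = (if i = j then 1 else 0)"
  shows "dim S = dim {s \<in> S. \<forall>i\<in>I. \<Phi> i s = 0} + card I"
  using assms(1) \<Phi> b
proof (induction I rule: finite_induct)
  case (insert i I)
  let ?S = "{s \<in> S. \<forall>i\<in>I. \<Phi> i s = 0}" and ?S' = "{s \<in> S. \<forall>j\<in>insert i I. \<Phi> j s = 0}"
  have \<Phi>i: "\<Phi> i (x + y) = \<Phi> i x + \<Phi> i y" "\<Phi> i (scale c x) = c * \<Phi> i x" for x y c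
    using insert.prems by simp_all
  have \<Phi>i_0: "\<Phi> i 0 = 0" using \<Phi>i(2)[of 0 0] by simp
  have \<Phi>i_diff: "\<Phi> i (x - y) = \<Phi> i x - \<Phi> i y" for x y
    using \<Phi>i(1)[of "x - y" y] by simp
  have sub: "subspace ?S" using S(1) insert.prems by (intro subspace_common_zeros) auto
  have bi: "b i \<in> ?S" "\<Phi> i (b i) = 1" using insert.prems insert.hyps by auto
  obtain B where B: "B \<subseteq> ?S'" "independent B" "?S' \<subseteq> span B" "card B = dim ?S'"
    by (rule basis_exists)
  have "finite B" using independent_span_bound[OF S(2) B(2)] B(1) S(3) by blast
  have "subspace {x \<in> UNIV. \<forall>j\<in>{i}. \<Phi> j x = 0}"
    using \<Phi>i by (intro subspace_common_zeros) auto
  then have "span B \<subseteq> {x \<in> UNIV. \<forall>j\<in>{i}. \<Phi> j x = 0}"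
    using B(1) by (intro span_minimal) auto
  then have notin: "b i \<notin> span B" using bi(2) by auto
  have "dim ?S = Suc (card B)"
  proof (rule dim_unique)
    show "insert (b i) B \<subseteq> ?S" using bi B(1) by auto
    show "independent (insert (b i) B)" using notin B(2) by (simp add: independent_insertI)
    show "card (insert (b i) B) = Suc (card B)"
      using \<open>finite B\<close> notin span_base by (subst card_insert_disjoint) auto
    show "?S \<subseteq> span (insert (b i) B)"
    proof
      fix s assume s: "s \<in> ?S"
      let ?s = "s - scale (\<Phi> i s) (b i)"
      have "?s \<in> ?S" using s bi sub by (intro subspace_diff subspace_scale)
      moreover have "\<Phi> i ?s = 0" using bi by (simp add: \<Phi>i \<Phi>i_diff)
      ultimately have "?s \<in> span B" using B(3) by auto
      then show "s \<in> span (insert (b i) B)" using span_breakdown_eq by blast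
    qed
  qed
  moreover have "dim S = dim ?S + card I" using insert.prems by (intro insert.IH) auto
  ultimately show ?case using insert.hyps B(4) by simp
qed simp

lemma family_independent:
  assumes "finite K" and zero: "\<And>t k. (\<Sum>k\<in>K. scale (t k) (g k)) = 0 \<Longrightarrow> k \<in> K \<Longrightarrow> t k = 0"
  shows "inj_on g K" "independent (g ` K)"
proof -
  show inj: "inj_on g K"
  proof (rule inj_onI, rule ccontr)
    fix k l assume kl: "k \<in> K" "l \<in> K" "g k = g l" "k \<noteq> l"
    define t where "t j = (if j = k then 1 else 0) - (if j = l then 1 else (0 :: 'a))" for j
    have delta: "(\<Sum>j\<in>K. scale (if j = i then 1 else 0) (g j)) = g i" if "i \<in> K" for i
    proof -
      have "(\<Sum>j\<in>K. scale (if j = i then 1 else 0) (g j)) = (\<Sum>j\<in>K. if j = i then g j else 0)"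
        by (intro sum.cong) auto
      then show ?thesis using assms(1) that by (simp add: sum.delta)
    qed
    have "(\<Sum>j\<in>K. scale (t j) (g j)) = g k - g l"
      using kl by (simp add: t_def scale_left_diff_distrib sum_subtractf delta)
    then have "t k = 0" using zero[of t k] kl by simp
    then show False using kl by (simp add: t_def)
  qed
  show "independent (g ` K)"
  proof (rule independent_if_scalars_zero)
    fix f x assume f: "(\<Sum>x\<in>g ` K. scale (f x) x) = 0" "x \<in> g ` K"
    have "(\<Sum>k\<in>K. scale (f (g k)) (g k)) = 0" using f(1) by (simp add: sum.reindex[OF inj])
    with zero[of "f \<circ> g"] f(2) show "f x = 0" by auto
  qed (use assms in simp)
qed

text \<open>The last property is a dimension count: if \<open>f\<close> is injective on
  \<open>A\<close> and its image meets the span of the \<open>c j\<close> only in 0, both together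
  fill \<open>E\<close>. It is quantified over \<open>f\<close> so that a complement fixed at the
  base point can be used at other points, with \<open>f a\<close> the composition of some
  \<open>g\<close> with \<open>a\<close>.\<close>

lemma complement_family:
  assumes A: "subspace A" "A \<subseteq> E" and E: "subspace E" "finite F" "E \<subseteq> span F"
  obtains c :: "nat \<Rightarrow> 'b" where "\<And>j. j < dim E - dim A \<Longrightarrow> c j \<in> E"
    and "\<And>t j. (\<Sum>j<dim E - dim A. scale (t j) (c j)) \<in> A \<Longrightarrow> j < dim E - dim A \<Longrightarrow> t j = 0"
    and "\<forall>z f. z \<in> E \<and> (\<forall>a\<in>A. f a \<in> E) \<and>
      (\<forall>a b. f (a + b) = f a + f b) \<and> (\<forall>r a. f (scale r a) = scale r (f a)) \<and>
      (\<forall>a\<in>A. \<forall>t. f a = (\<Sum>j<dim E - dim A. scale (t j) (c j)) \<longrightarrow>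
        a = 0 \<and> (\<forall>j<dim E - dim A. t j = 0)) \<longrightarrow>
      (\<exists>a\<in>A. \<exists>t. z = f a + (\<Sum>j<dim E - dim A. scale (t j) (c j)))"
proof -
  obtain B where B: "B \<subseteq> A" "independent B" "A \<subseteq> span B" "card B = dim A"
    by (rule basis_exists)
  obtain B' where B': "B \<subseteq> B'" "B' \<subseteq> E" "independent B'" "E \<subseteq> span B'"
    using maximal_independent_subset_extend[of B E] B A(2) by blast
  have "finite B'" using independent_span_bound[OF E(2) B'(3)] B'(2) E(3) by blast
  have "finite B" using \<open>finite B'\<close> B'(1) by (rule rev_finite_subset)
  have "card B' = dim E" using basis_card_eq_dim[OF B'(2,4,3)] .
  define m where "m = dim E - dim A"
  have "card (B' - B) = m"
    using \<open>finite B\<close> B' B by (simp add: card_Diff_subset \<open>card B' = dim E\<close> m_def)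
  then obtain c where c: "bij_betw c {..<m} (B' - B)"
    using ex_bij_betw_nat_finite[of "B' - B"] \<open>finite B'\<close> by (auto simp: atLeast0LessThan)
  have cE: "c j \<in> E" if "j < m" for j using bij_betwE[OF c] that B'(2) by auto
  have sum_c: "(\<Sum>j<m. scale (t j) (c j)) = (\<Sum>x\<in>B' - B. scale (t (inv_into {..<m} c x)) x)" for t
    unfolding sum.reindex_bij_betw[OF c, symmetric]
    by (intro sum.cong) (auto simp: inv_into_f_f[OF bij_betw_imp_inj_on[OF c]])
  have indep: "t j = 0" if t: "(\<Sum>j<m. scale (t j) (c j)) \<in> A" and j: "j < m" for t j
  proof -
    obtain s where s: "(\<Sum>j<m. scale (t j) (c j)) = (\<Sum>x\<in>B. scale (s x) x)"
      using t B(3) span_finite[OF \<open>finite B\<close>] by auto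
    let ?r = "\<lambda>x. if x \<in> B then - s x else t (inv_into {..<m} c x)"
    have "(\<Sum>x\<in>B'. scale (?r x) x) = (\<Sum>x\<in>B' - B. scale (?r x) x) + (\<Sum>x\<in>B. scale (?r x) x)"
      using B'(1) \<open>finite B'\<close> by (rule sum.subset_diff)
    also have "(\<Sum>x\<in>B' - B. scale (?r x) x) = (\<Sum>j<m. scale (t j) (c j))"
      unfolding sum_c by (intro sum.cong) auto
    also have "(\<Sum>x\<in>B. scale (?r x) x) = - (\<Sum>x\<in>B. scale (s x) x)"
      by (simp add: sum_negf)
    finally have "(\<Sum>x\<in>B'. scale (?r x) x) = 0" using s by simp
    moreover have "c j \<in> B'" "c j \<notin> B" using bij_betwE[OF c] j by auto
    ultimately have "?r (c j) = 0"
      by (intro independentD[OF B'(3) \<open>finite B'\<close> order_refl, of ?r]) assumption+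
    with \<open>c j \<notin> B\<close> j show "t j = 0" by (simp add: inv_into_f_f[OF bij_betw_imp_inj_on[OF c]])
  qed
  have onto: "\<exists>a\<in>A. \<exists>t. z = f a + (\<Sum>j<m. scale (t j) (c j))"
    if z: "z \<in> E" and fE: "\<And>a. a \<in> A \<Longrightarrow> f a \<in> E" and f_add: "\<And>a b. f (a + b) = f a + f b"
      and f_scale: "\<And>r a. f (scale r a) = scale r (f a)"
      and f_inj: "\<And>a t. a \<in> A \<Longrightarrow> f a = (\<Sum>j<m. scale (t j) (c j)) \<Longrightarrow> a = 0 \<and> (\<forall>j<m. t j = 0)"
    for z f
  proof -
    \<comment> \<open>Left indices stand for the basis of \<open>A\<close> moved by
      \<open>f\<close>, right indices for the complement.\<close>
    let ?K = "B <+> {..<m}"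
    let ?g = "case_sum f c"
    have f_0: "f 0 = 0" using f_scale[of 0 0] by simp
    have f_sum: "f (\<Sum>x\<in>B. scale (s x) x) = (\<Sum>x\<in>B. scale (s x) (f x))" for s
      using \<open>finite B\<close> by (induction B rule: finite_induct) (simp_all add: f_0 f_add f_scale)
    have sum_K: "(\<Sum>k\<in>?K. scale (t k) (?g k)) =
        f (\<Sum>x\<in>B. scale (t (Inl x)) x) + (\<Sum>j<m. scale (t (Inr j)) (c j))" for t
      using \<open>finite B\<close> by (simp add: sum.Plus f_sum)
    have zero: "t k = 0" if t: "(\<Sum>k\<in>?K. scale (t k) (?g k)) = 0" and k: "k \<in> ?K" for t k
    proof -
      let ?a = "\<Sum>x\<in>B. scale (t (Inl x)) x"
      have "?a \<in> A" using A(1) B(1) by (intro subspace_sum subspace_scale) auto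
      moreover have "f ?a = (\<Sum>j<m. scale (- t (Inr j)) (c j))"
        using t unfolding sum_K by (simp add: sum_negf eq_neg_iff_add_eq_0)
      ultimately have 0: "?a = 0" "\<forall>j<m. - t (Inr j) = 0" using f_inj[of ?a "\<lambda>j. - t (Inr j)"] by auto
      then have "\<forall>x\<in>B. t (Inl x) = 0"
        using independentD[OF B(2) \<open>finite B\<close> order_refl, of "\<lambda>x. t (Inl x)"] by simp
      with 0 k show "t k = 0" by auto
    qed
    have K: "finite ?K" "card ?K = card B'"
      using \<open>finite B\<close> \<open>card B' = dim E\<close> B(4) card_mono[OF \<open>finite B'\<close> B'(1)]
      by (simp_all add: card_Plus m_def)
    have g_indep: "inj_on ?g ?K" "independent (?g ` ?K)"
      using family_independent[of ?K ?g] K(1) zero by blast+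
    define G where "G = ?g ` ?K"
    have G: "finite G" "card G = card B'"
      using K card_image[OF g_indep(1)] unfolding G_def by simp_all
    have gE: "G \<subseteq> E" using fE B(1) cE by (auto simp: G_def)
    \<comment> \<open>Otherwise \<open>z\<close> and \<open>G\<close> would form an independent
      subset of \<open>E\<close> with more elements than the basis \<open>B'\<close>.\<close>
    have "z \<in> span G"
    proof (rule ccontr)
      assume notin: "z \<notin> span G"
      then have "independent (insert z G)"
        using g_indep(2) by (simp add: independent_insertI G_def)
      moreover have "insert z G \<subseteq> span B'" using gE z B'(4) by auto
      ultimately have "card (insert z G) \<le> card B'"
        using independent_span_bound[OF \<open>finite B'\<close>] by blast
      moreover have "z \<notin> G" using notin span_base[of z G] by argo
      ultimately show False using G by simp
    qed
    then obtain s where "z = (\<Sum>x\<in>G. scale (s x) x)"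
      using G(1) by (auto simp: span_finite)
    also have "\<dots> = (\<Sum>k\<in>?K. scale (s (?g k)) (?g k))"
      by (simp add: G_def sum.reindex[OF g_indep(1)])
    also have "\<dots> = f (\<Sum>x\<in>B. scale (s (f x)) x) + (\<Sum>j<m. scale (s (c j)) (c j))"
      by (simp add: sum_K)
    finally have "z = f (\<Sum>x\<in>B. scale (s (f x)) x) + (\<Sum>j<m. scale (s (c j)) (c j))" .
    moreover have "(\<Sum>x\<in>B. scale (s (f x)) x) \<in> A"
      using A(1) B(1) by (intro subspace_sum subspace_scale) auto
    ultimately show ?thesis by (intro bexI exI[of _ "\<lambda>j. s (c j)"])
  qed
  show thesis
  proof (rule that[of c, folded m_def])
    show "\<forall>z f. z \<in> E \<and> (\<forall>a\<in>A. f a \<in> E) \<and>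
      (\<forall>a b. f (a + b) = f a + f b) \<and> (\<forall>r a. f (scale r a) = scale r (f a)) \<and>
      (\<forall>a\<in>A. \<forall>t. f a = (\<Sum>j<m. scale (t j) (c j)) \<longrightarrow> a = 0 \<and> (\<forall>j<m. t j = 0)) \<longrightarrow>
      (\<exists>a\<in>A. \<exists>t. z = f a + (\<Sum>j<m. scale (t j) (c j)))"
      by (intro allI impI, elim conjE, rule onto) simp_all
  qed (use cE indep in auto)
qed

lemma dim_image_le:
  assumes "\<And>a b. h (a + b) = h a + h b" "\<And>r a. h (scale r a) = scale r (h a)"
    and "finite F" "S \<subseteq> span F"
  shows "dim (h ` S) \<le> dim S"
proof -
  interpret h: module_hom scale scale h
    by standard (rule assms)+
  obtain B where B: "B \<subseteq> S" "independent B" "S \<subseteq> span B" "card B = dim S"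
    by (rule basis_exists)
  have "finite B" using independent_span_bound[OF assms(3) B(2)] B(1) assms(4) by blast
  have "h ` S \<subseteq> span (h ` B)" using B(3) by (auto simp: h.span_image)
  then have "dim (h ` S) \<le> card (h ` B)" using \<open>finite B\<close> by (intro dim_le_card) auto
  also have "\<dots> \<le> card B" using \<open>finite B\<close> by (rule card_image_le)
  finally show ?thesis using B(4) by simp
qed

end

section \<open>Coordinates on a finite-dimensional space and on its endomorphisms\<close>

locale indexed_basis = vector_space smul
  for smul :: "'k::field \<Rightarrow> 'w::ab_group_add \<Rightarrow> 'w" +
  fixes I :: "'i set" and e :: "'i \<Rightarrow> 'w" and coef :: "'i \<Rightarrow> 'w \<Rightarrow> 'k"
  assumes finite_I: "finite I"
    and coef_linear: "Vector_Spaces.linear smul (*) (coef i)"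
    and coef_e: "i \<in> I \<Longrightarrow> j \<in> I \<Longrightarrow> coef i (e j) = (if i = j then 1 else 0)"
    and expand: "(\<Sum>i\<in>I. smul (coef i u) (e i)) = u"
begin

text \<open>Spaces of endomorphisms are treated as subspaces of the space of all functions, with
  pointwise operations.\<close>

sublocale fs: vector_space "\<lambda>c (f :: 'w \<Rightarrow> 'w) u. smul c (f u)"
  by standard (auto simp: fun_eq_iff scale_right_distrib scale_left_distrib)

lemma linear_simps:
  assumes "Vector_Spaces.linear smul smul g"
  shows "g (u + w) = g u + g w" "g (smul c u) = smul c (g u)" "g 0 = 0" "g (u - w) = g u - g w"
    "g (\<Sum>j\<in>J. f j) = (\<Sum>j\<in>J. g (f j))"
proof -
  interpret g: Vector_Spaces.linear smul smul g by fact
  show "g (u + w) = g u + g w" "g (smul c u) = smul c (g u)" "g 0 = 0" "g (u - w) = g u - g w"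
    "g (\<Sum>j\<in>J. f j) = (\<Sum>j\<in>J. g (f j))"
    by (rule g.add g.scale g.zero g.diff g.sum)+
qed

lemma functional_simps:
  assumes "Vector_Spaces.linear smul (*) \<psi>"
  shows "\<psi> (u + w) = \<psi> u + \<psi> w" "\<psi> (smul c u) = c * \<psi> u" "\<psi> 0 = 0" "\<psi> (u - w) = \<psi> u - \<psi> w"
    "\<psi> (\<Sum>j\<in>J. f j) = (\<Sum>j\<in>J. \<psi> (f j))"
proof -
  interpret \<psi>: Vector_Spaces.linear smul "(*)" \<psi> by fact
  show "\<psi> (u + w) = \<psi> u + \<psi> w" "\<psi> (smul c u) = c * \<psi> u" "\<psi> 0 = 0" "\<psi> (u - w) = \<psi> u - \<psi> w"
    "\<psi> (\<Sum>j\<in>J. f j) = (\<Sum>j\<in>J. \<psi> (f j))"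
    by (rule \<psi>.add \<psi>.scale \<psi>.zero \<psi>.diff \<psi>.sum)+
qed

lemmas coef_simps = functional_simps[OF coef_linear]

lemma coef_eqI:
  assumes "\<And>i. i \<in> I \<Longrightarrow> coef i u = coef i w" shows "u = w"
proof -
  have "(\<Sum>i\<in>I. smul (coef i u) (e i)) = (\<Sum>i\<in>I. smul (coef i w) (e i))"
    using assms by simp
  then show ?thesis by (simp only: expand)
qed

lemma coef_sum_e:
  assumes "i \<in> I" shows "coef i (\<Sum>j\<in>I. smul (a j) (e j)) = a i"
proof -
  have "coef i (\<Sum>j\<in>I. smul (a j) (e j)) = (\<Sum>j\<in>I. if j = i then a j else 0)"
    using assms by (auto simp: coef_simps coef_e intro!: sum.cong)
  then show ?thesis using assms finite_I by simp
qed

lemma linear_expand: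
  assumes "Vector_Spaces.linear smul smul g"
  shows "g u = (\<Sum>j\<in>I. smul (coef j u) (g (e j)))"
  by (subst expand[of u, symmetric]) (simp add: linear_simps[OF assms])

lemma functional_expand:
  assumes "Vector_Spaces.linear smul (*) \<psi>"
  shows "\<psi> u = (\<Sum>j\<in>I. coef j u * \<psi> (e j))"
  by (subst expand[of u, symmetric]) (simp add: functional_simps[OF assms])

lemma linearI:
  assumes "\<And>u w. g (u + w) = g u + g w" "\<And>c u. g (smul c u) = smul c (g u)"
  shows "Vector_Spaces.linear smul smul g"
  using assms vector_space_axioms by (simp add: Vector_Spaces.linear_iff)

lemma linear_comp:
  assumes "Vector_Spaces.linear smul smul f" "Vector_Spaces.linear smul smul g"
  shows "Vector_Spaces.linear smul smul (\<lambda>u. f (g u))"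
  by (rule linearI) (simp_all add: linear_simps assms)

lemma functional_comp:
  assumes "Vector_Spaces.linear smul (*) \<psi>" "Vector_Spaces.linear smul smul g"
  shows "Vector_Spaces.linear smul (*) (\<lambda>u. \<psi> (g u))"
  using assms by (simp add: Vector_Spaces.linear_iff)

lemma linear_inv:
  assumes "Vector_Spaces.linear smul smul g" "bij g"
  shows "Vector_Spaces.linear smul smul (inv g)"
proof (rule linearI)
  have "inj g" "surj g" using assms(2) by (auto simp: bij_def)
  fix u w c
  show "inv g (u + w) = inv g u + inv g w" "inv g (smul c u) = smul c (inv g u)"
    by (rule inv_f_eq[OF \<open>inj g\<close>]; simp add: linear_simps[OF assms(1)] surj_f_inv_f[OF \<open>surj g\<close>])+
qed

lemma linear_inj_imp_bij:
  assumes "Vector_Spaces.linear smul smul g" "\<And>u. g u = 0 \<Longrightarrow> u = 0"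
  shows "bij g"
proof -
  have "inj g"
    using assms(2) by (intro injI) (metis eq_iff_diff_eq_0 linear_simps(4)[OF assms(1)])
  moreover have "surj g"
  proof -
    have inj: "inj_on e I"
      by (rule inj_onI) (metis coef_e zero_neq_one)
    have indep: "independent (e ` I)"
    proof (rule family_independent(2)[OF finite_I])
      fix t k assume "(\<Sum>k\<in>I. smul (t k) (e k)) = 0" "k \<in> I"
      then show "t k = 0" using coef_sum_e[of k t] by (simp add: coef_simps)
    qed
    have "span (e ` I) = UNIV"
    proof -
      have "(\<Sum>i\<in>I. smul (coef i u) (e i)) \<in> span (e ` I)" for u
        by (intro span_sum span_scale span_base) auto
      then show ?thesis unfolding expand by auto
    qed
    then interpret fd: finite_dimensional_vector_space smul "e ` I"
      using indep finite_I by unfold_locales auto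
    show ?thesis using fd.linear_inj_imp_surj[OF assms(1) \<open>inj g\<close>] .
  qed
  ultimately show ?thesis by (simp add: bij_def)
qed

text \<open>The matrix units supply the finite spanning set that dimension counts among functions
  require.\<close>

lemma linear_in_span:
  assumes "Vector_Spaces.linear smul smul g"
  shows "g \<in> fs.span ((\<lambda>(i, j) u. smul (coef j u) (e i)) ` (I \<times> I))"
proof -
  have "g = (\<Sum>(i, j)\<in>I \<times> I. (\<lambda>u. smul (coef i (g (e j))) (smul (coef j u) (e i))))"
  proof
    fix u
    have fun_sum: "(\<Sum>x\<in>X. h x) u = (\<Sum>x\<in>X. h x u)" for X :: "('i \<times> 'i) set" and h :: "_ \<Rightarrow> 'w \<Rightarrow> 'w"
      by (induction X rule: infinite_finite_induct) auto
    have "g u = (\<Sum>j\<in>I. smul (coef j u) (\<Sum>i\<in>I. smul (coef i (g (e j))) (e i)))"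
      unfolding expand by (rule linear_expand[OF assms])
    also have "\<dots> = (\<Sum>i\<in>I. \<Sum>j\<in>I. smul (coef i (g (e j))) (smul (coef j u) (e i)))"
      unfolding scale_sum_right by (subst sum.swap) (intro sum.cong refl scale_left_commute)
    finally show "g u = (\<Sum>(i, j)\<in>I \<times> I. (\<lambda>u. smul (coef i (g (e j))) (smul (coef j u) (e i)))) u"
      by (simp add: fun_sum sum.cartesian_product case_prod_unfold)
  qed
  also have "\<dots> \<in> fs.span ((\<lambda>(i, j) u. smul (coef j u) (e i)) ` (I \<times> I))"
    unfolding case_prod_unfold
    by (intro fs.span_sum fs.span_scale[of "\<lambda>u. smul (coef _ u) (e _)"] fs.span_base) force
  finally show ?thesis .
qed

end

text \<open>Only these closure properties of the color-preserving endomorphisms enter the geometry;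
  the acting group is the set of bijective elements of \<open>E\<close>.\<close>

locale endomorphism_algebra = indexed_basis smul I e coef
  for smul :: "'k::field \<Rightarrow> 'w::ab_group_add \<Rightarrow> 'w" and I :: "'i set" and e coef +
  fixes E :: "('w \<Rightarrow> 'w) set"
  assumes E_linear: "g \<in> E \<Longrightarrow> Vector_Spaces.linear smul smul g"
    and E_subspace: "fs.subspace E"
    and E_id: "(\<lambda>u. u) \<in> E"
    and E_comp: "f \<in> E \<Longrightarrow> g \<in> E \<Longrightarrow> (\<lambda>u. f (g u)) \<in> E"
    and E_inv: "g \<in> E \<Longrightarrow> bij g \<Longrightarrow> inv g \<in> E"
begin

text \<open>An element \<open>g\<close> of the group fixes \<open>v\<close> and \<open>x\<close>
  exactly if \<open>g - 1\<close> belongs to this space. For \<open>v = 0\<close> it is the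
  centralizer of \<open>x\<close> in \<open>E\<close>.\<close>

definition stabilizer_algebra :: "'w \<Rightarrow> ('w \<Rightarrow> 'w) \<Rightarrow> ('w \<Rightarrow> 'w) set" where
  "stabilizer_algebra v x = {a \<in> E. (\<forall>u. a (x u) = x (a u)) \<and> a v = 0}"

abbreviation "elementary_maps \<equiv> (\<lambda>(i, j) u. smul (coef j u) (e i)) ` (I \<times> I)"

lemma finite_elementary: "finite elementary_maps"
  using finite_I by simp

lemma E_span: "E \<subseteq> fs.span elementary_maps"
  by (rule subsetI) (rule linear_in_span[OF E_linear])

lemma stabilizer_algebra_subspace:
  assumes "Vector_Spaces.linear smul smul x"
  shows "fs.subspace (stabilizer_algebra v x)" "stabilizer_algebra v x \<subseteq> E"
proof -
  show "fs.subspace (stabilizer_algebra v x)"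
    using E_subspace linear_simps[OF assms]
    by (auto simp: fs.subspace_def stabilizer_algebra_def)
  show "stabilizer_algebra v x \<subseteq> E" unfolding stabilizer_algebra_def by (rule Collect_restrict)
qed

lemma dim_stabilizer_algebra_conj_le:
  assumes x: "Vector_Spaces.linear smul smul x" and g: "g \<in> E" "bij g"
  shows "fs.dim (stabilizer_algebra (g v) (\<lambda>u. g (x (inv g u)))) \<le> fs.dim (stabilizer_algebra v x)"
proof -
  have lin_g: "Vector_Spaces.linear smul smul g" and lin_g': "Vector_Spaces.linear smul smul (inv g)"
    using g E_linear E_inv by auto
  have inv: "g (inv g u) = u" "inv g (g u) = u" for u
    using g(2) by (simp_all add: surj_f_inv_f bij_is_surj inv_f_f bij_is_inj)
  let ?h = "\<lambda>a u. g (a (inv g u))"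
  have sub: "stabilizer_algebra (g v) (\<lambda>u. g (x (inv g u))) \<subseteq> ?h ` stabilizer_algebra v x"
  proof
    fix a assume a: "a \<in> stabilizer_algebra (g v) (\<lambda>u. g (x (inv g u)))"
    let ?a = "\<lambda>u. inv g (a (g u))"
    have "?a \<in> E"
    proof (rule E_comp[OF E_inv[OF g]], rule E_comp[OF _ g(1)])
      show "a \<in> E" using a by (simp add: stabilizer_algebra_def)
    qed
    moreover have "?a (x u) = x (?a u)" for u
    proof -
      have "a (g (x (inv g (g u)))) = g (x (inv g (a (g u))))"
        using a by (simp add: stabilizer_algebra_def)
      then show ?thesis by (simp add: inv)
    qed
    moreover have "?a v = 0"
      using a linear_simps(3)[OF lin_g'] by (simp add: stabilizer_algebra_def)
    ultimately have "?a \<in> stabilizer_algebra v x" by (simp add: stabilizer_algebra_def)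
    moreover have "a = ?h ?a" by (simp add: inv)
    ultimately show "a \<in> ?h ` stabilizer_algebra v x" by (rule rev_image_eqI[where x = ?a])
  qed
  have fin: "stabilizer_algebra v x \<subseteq> fs.span elementary_maps"
    using stabilizer_algebra_subspace(2)[OF x] E_span by (rule subset_trans)
  obtain B where B: "B \<subseteq> ?h ` stabilizer_algebra v x" "fs.independent B"
    "?h ` stabilizer_algebra v x \<subseteq> fs.span B" "card B = fs.dim (?h ` stabilizer_algebra v x)"
    by (rule fs.basis_exists)
  have "?h ` stabilizer_algebra v x \<subseteq> E"
  proof (rule image_subsetI)
    fix a assume "a \<in> stabilizer_algebra v x"
    then have "a \<in> E" using stabilizer_algebra_subspace(2)[OF x] by (rule rev_subsetD)
    then show "?h a \<in> E" by (intro E_comp[OF g(1)] E_comp[OF _ E_inv[OF g]])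
  qed
  with B(1) E_span have "B \<subseteq> fs.span elementary_maps" by (meson order_trans)
  then have "finite B" using fs.independent_span_bound[OF finite_elementary B(2)] by blast
  with sub B(3) have "fs.dim (stabilizer_algebra (g v) (\<lambda>u. g (x (inv g u)))) \<le> card B"
    by (intro fs.dim_le_card) (rule subset_trans)
  also have "\<dots> \<le> fs.dim (stabilizer_algebra v x)"
    unfolding B(4) by (rule fs.dim_image_le[OF _ _ finite_elementary fin])
      (auto simp: fun_eq_iff linear_simps[OF lin_g])
  finally show ?thesis .
qed

lemma dim_stabilizer_algebra_conj:
  assumes x: "Vector_Spaces.linear smul smul x" and g: "g \<in> E" "bij g"
  shows "fs.dim (stabilizer_algebra (g v) (\<lambda>u. g (x (inv g u)))) = fs.dim (stabilizer_algebra v x)"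
proof (rule antisym)
  have inv: "g (inv g u) = u" "inv g (g u) = u" for u
    using g(2) by (simp_all add: surj_f_inv_f bij_is_surj inv_f_f bij_is_inj)
  have lin_g: "Vector_Spaces.linear smul smul g" and lin_g': "Vector_Spaces.linear smul smul (inv g)"
    using g E_linear E_inv by auto
  have "Vector_Spaces.linear smul smul (\<lambda>u. g (x (inv g u)))"
    using linear_comp[OF lin_g linear_comp[OF x lin_g']] .
  from dim_stabilizer_algebra_conj_le[OF this E_inv[OF g] bij_imp_bij_inv[OF g(2)], of "g v"]
  show "fs.dim (stabilizer_algebra v x) \<le> fs.dim (stabilizer_algebra (g v) (\<lambda>u. g (x (inv g u))))"
    by (simp add: inv inv_inv_eq[OF g(2)])
qed (rule dim_stabilizer_algebra_conj_le[OF assms])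

end

section \<open>Charts of orbits\<close>

lemma sum_fun_apply: "(\<Sum>x\<in>X. h x) u = (\<Sum>x\<in>X. h x u :: 'b::comm_monoid_add)"
  by (induction X rule: infinite_finite_induct) auto

lemma affine_coordinate: "i < m \<Longrightarrow> (\<lambda>t. t i) \<in> polynomial_functions (affine_coords m)"
  by (rule polynomial_functions.coord) (auto simp: affine_coords_def)

text \<open>Parameters recovered from a point of the orbit are determined only below
  \<open>m\<close>; this suffices to evaluate \<open>\<delta>\<close> at them.\<close>

lemma polynomial_functions_affine_cong:
  assumes "f \<in> polynomial_functions (affine_coords m)" "\<And>i. i < m \<Longrightarrow> s i = t i"
  shows "f s = f t"
  using assms(1)
proof induction
  case (coord f)
  then obtain i where "i < m" "f = (\<lambda>t. t i)" by (auto simp: affine_coords_def)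
  with assms(2) show ?case by simp
qed auto

text \<open>
  One proof covers \<open>End(W)\<close> and \<open>W \<times> End(W)\<close>: in the first case \<open>mk v x = x\<close> and only \<open>v = 0\<close> is
  allowed, in the second case \<open>mk = Pair\<close>.
\<close>

locale orbit_coordinates = endomorphism_algebra smul I e coef E
  for smul :: "'k::field \<Rightarrow> 'w::ab_group_add \<Rightarrow> 'w" and I :: "'i set" and e coef E +
  fixes mk :: "'w \<Rightarrow> ('w \<Rightarrow> 'w) \<Rightarrow> 'p" and vec :: "'p \<Rightarrow> 'w" and endo :: "'p \<Rightarrow> 'w \<Rightarrow> 'w"
    and C :: "('p \<Rightarrow> 'k) set" and W :: "'w set"
  assumes coord_mk: "f \<in> C \<Longrightarrow>
      (\<exists>\<psi>. Vector_Spaces.linear smul (*) \<psi> \<and> (\<forall>w y. f (mk w y) = \<psi> w)) \<or>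
      (\<exists>\<psi> u. Vector_Spaces.linear smul (*) \<psi> \<and> (\<forall>w y. f (mk w y) = \<psi> (y u)))"
    and vec_polynomial: "Vector_Spaces.linear smul (*) \<psi> \<Longrightarrow> (\<lambda>p. \<psi> (vec p)) \<in> polynomial_functions C"
    and endo_polynomial: "Vector_Spaces.linear smul (*) \<psi> \<Longrightarrow> (\<lambda>p. \<psi> (endo p u)) \<in> polynomial_functions C"
    and endo_mk: "endo (mk w y) = y"
    and vec_mk: "w \<in> W \<Longrightarrow> vec (mk w y) = w"
    and W_linear: "Vector_Spaces.linear smul smul g \<Longrightarrow> w \<in> W \<Longrightarrow> g w \<in> W"
begin

definition orbit :: "'w \<Rightarrow> ('w \<Rightarrow> 'w) \<Rightarrow> 'p set" where
  "orbit v x = {mk (g v) (\<lambda>u. g (x (inv g u))) | g. g \<in> E \<and> bij g}"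

text \<open>Two denominators are involved. Where \<open>\<delta>\<close> is nonzero, the element of
  \<open>1 + S\<close> with parameters \<open>t\<close> is invertible and moves the base point to
  \<open>\<phi> t\<close>. Where \<open>D\<close> is nonzero, the linear system for the parameters
  has at most one solution, with numerators \<open>\<tau> j\<close>. The polynomial \<open>h\<close>
  selects the points of the orbit where \<open>D\<close> is nonzero and \<open>\<delta>\<close> is
  nonzero at the recovered parameters.\<close>

lemma orbit_chart:
  assumes x: "Vector_Spaces.linear smul smul x" and v: "v \<in> W"
    and m: "m = fs.dim E - fs.dim (stabilizer_algebra v x)"
  obtains \<phi> \<delta> D \<tau> h where "chart C (orbit v x) m \<phi> \<delta>" "\<phi> (\<lambda>_. 0) = mk v x" "\<delta> (\<lambda>_. 0) \<noteq> 0"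
    and "D \<in> polynomial_functions C" "D (mk v x) \<noteq> 0" "\<And>j. \<tau> j \<in> polynomial_functions C"
    and "\<And>t j. \<delta> t \<noteq> 0 \<Longrightarrow> j < m \<Longrightarrow> D (\<phi> t) * t j = \<tau> j (\<phi> t)"
    and "h \<in> polynomial_functions C" "h (mk v x) \<noteq> 0"
    and "\<And>q. q \<in> orbit v x \<Longrightarrow> h q \<noteq> 0 \<Longrightarrow> \<exists>t. \<delta> t \<noteq> 0 \<and> \<phi> t = q"
proof -
  note x_simps = linear_simps[OF x]
  obtain c :: "nat \<Rightarrow> 'w \<Rightarrow> 'w" where cE: "\<And>j. j < m \<Longrightarrow> c j \<in> E"
    and c_indep: "\<And>t j. (\<Sum>j<m. (\<lambda>u. smul (t j) (c j u))) \<in> stabilizer_algebra v x \<Longrightarrow> j < m \<Longrightarrow> t j = 0"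
    and c_onto: "\<forall>z f. z \<in> E \<and> (\<forall>a\<in>stabilizer_algebra v x. f a \<in> E) \<and>
      (\<forall>a b. f (a + b) = f a + f b) \<and> (\<forall>r a. f (\<lambda>u. smul r (a u)) = (\<lambda>u. smul r (f a u))) \<and>
      (\<forall>a\<in>stabilizer_algebra v x. \<forall>t. f a = (\<Sum>j<m. (\<lambda>u. smul (t j) (c j u))) \<longrightarrow>
        a = 0 \<and> (\<forall>j<m. t j = 0)) \<longrightarrow>
      (\<exists>a\<in>stabilizer_algebra v x. \<exists>t. z = f a + (\<Sum>j<m. (\<lambda>u. smul (t j) (c j u))))"
    by (rule fs.complement_family[OF stabilizer_algebra_subspace[OF x] E_subspace finite_elementary
          E_span, of v, folded m]) (rule that)
  \<comment> \<open>Thus \<open>Z t\<close> runs through \<open>S\<close> and \<open>z t\<close>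
    through \<open>1 + S\<close>.\<close>
  define Z where "Z t u = (\<Sum>j<m. smul (t j) (c j u))" for t u
  define z where "z t u = u + Z t u" for t u
  have Z_fun: "(\<Sum>j<m. (\<lambda>u. smul (t j) (c j u))) = Z t" for t
    by (auto simp: Z_def sum_fun_apply)
  have ZE: "Z t \<in> E" for t
    unfolding Z_fun[symmetric] using E_subspace cE
    by (intro fs.subspace_sum) (auto simp: fs.subspace_def)
  have zE: "z t \<in> E" for t
  proof -
    have "z t = (\<lambda>u. u) + Z t" by (auto simp: z_def)
    then show ?thesis using fs.subspace_add[OF E_subspace E_id ZE[of t]] by simp
  qed
  have c_lin: "Vector_Spaces.linear smul smul (c j)" if "j < m" for j
    using cE E_linear that by blast
  have z_lin: "Vector_Spaces.linear smul smul (z t)" for t using zE E_linear by blast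
  have functional_z: "\<psi> (z t u) = \<psi> u + (\<Sum>j<m. t j * \<psi> (c j u))"
    if "Vector_Spaces.linear smul (*) \<psi>" for \<psi> t u
    by (simp add: z_def Z_def functional_simps[OF that])
  have z_polynomial: "(\<lambda>t. \<psi> (z t u)) \<in> polynomial_functions (affine_coords m)"
    if "Vector_Spaces.linear smul (*) \<psi>" for \<psi> u
    unfolding functional_z[OF that]
    by (intro polynomial_functions_intros affine_coordinate) auto
  have z_0: "z (\<lambda>_. 0) = (\<lambda>u. u)" by (auto simp: z_def Z_def)
  have coef_z: "coef i (z t u) = (\<Sum>j\<in>I. coef i (z t (e j)) * coef j u)" for i t u
    using functional_expand[OF functional_comp[OF coef_linear z_lin[of t]], of i u]
    by (simp add: mult.commute)

  \<comment> \<open>The elimination is applied to the matrix of \<open>z t\<close>, which is the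
    identity at \<open>t = 0\<close>; \<open>\<delta>\<close> takes the role of its
    determinant.\<close>
  have "\<exists>\<delta>\<in>polynomial_functions (affine_coords m). \<delta> (\<lambda>_. 0) \<noteq> 0 \<and>
    (\<forall>b. (\<forall>i. b i \<in> polynomial_functions (affine_coords m)) \<longrightarrow>
      (\<exists>\<tau>. (\<forall>j. \<tau> j \<in> polynomial_functions (affine_coords m)) \<and>
        (\<forall>q c. (\<forall>i. (\<Sum>j\<in>I. coef i (z q (e j)) * c j) = b i q) \<longrightarrow> (\<forall>j\<in>I. \<delta> q * c j = \<tau> j q))))"
  proof (rule overdetermined_cramer[OF finite_I])
    show "(\<lambda>t. coef i (z t (e j))) \<in> polynomial_functions (affine_coords m)" for i j
      by (rule z_polynomial[OF coef_linear])
  next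
    fix c j assume c: "\<And>i. (\<Sum>j\<in>I. coef i (z (\<lambda>_. 0) (e j)) * c j) = 0" and "j \<in> I"
    have "c j = (\<Sum>l\<in>I. coef j (e l) * c l)"
    proof -
      have "(\<Sum>l\<in>I. coef j (e l) * c l) = (\<Sum>l\<in>I. if l = j then c l else 0)"
        using \<open>j \<in> I\<close> by (intro sum.cong) (auto simp: coef_e)
      then show ?thesis using \<open>j \<in> I\<close> finite_I by simp
    qed
    with c[of j] show "c j = 0" by (simp add: z_0)
  qed
  then obtain \<delta> where \<delta>: "\<delta> \<in> polynomial_functions (affine_coords m)" "\<delta> (\<lambda>_. 0) \<noteq> 0"
    and \<delta>_sol: "\<And>b. (\<And>i. b i \<in> polynomial_functions (affine_coords m)) \<Longrightarrow>
      \<exists>\<tau>. (\<forall>j. \<tau> j \<in> polynomial_functions (affine_coords m)) \<and>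
        (\<forall>q c. (\<forall>i. (\<Sum>j\<in>I. coef i (z q (e j)) * c j) = b i q) \<longrightarrow> (\<forall>j\<in>I. \<delta> q * c j = \<tau> j q))"
    by blast
  have "\<exists>\<sigma>. (\<forall>j. \<sigma> j \<in> polynomial_functions (affine_coords m)) \<and>
        (\<forall>t w. z t w = u \<longrightarrow> (\<forall>j\<in>I. \<delta> t * coef j w = \<sigma> j t))" for u
  proof -
    obtain \<sigma> where "\<forall>j. \<sigma> j \<in> polynomial_functions (affine_coords m)"
      and \<sigma>: "\<forall>q c. (\<forall>i. (\<Sum>j\<in>I. coef i (z q (e j)) * c j) = coef i u) \<longrightarrow> (\<forall>j\<in>I. \<delta> q * c j = \<sigma> j q)"
      using \<delta>_sol[of "\<lambda>i _. coef i u"] polynomial_functions.const by blast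
    moreover have "\<delta> t * coef j w = \<sigma> j t" if "z t w = u" "j \<in> I" for t w j
      using \<sigma>[rule_format, of t "\<lambda>j. coef j w" j] that by (simp flip: coef_z)
    ultimately show ?thesis by blast
  qed
  then have "\<forall>u. \<exists>\<sigma>. (\<forall>j. \<sigma> j \<in> polynomial_functions (affine_coords m)) \<and>
        (\<forall>t w. z t w = u \<longrightarrow> (\<forall>j\<in>I. \<delta> t * coef j w = \<sigma> j t))" by blast
  from choice[OF this] obtain \<sigma> where \<sigma>: "\<And>u j. \<sigma> u j \<in> polynomial_functions (affine_coords m)"
    and \<sigma>_sol: "\<And>t w j. j \<in> I \<Longrightarrow> \<delta> t * coef j w = \<sigma> (z t w) j t" by blast
  \<comment> \<open>Where \<open>\<delta>\<close> is nonzero, \<open>z t w\<close> determines all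
    coordinates of \<open>w\<close>.\<close>
  have z_bij: "bij (z t)" if "\<delta> t \<noteq> 0" for t
  proof (rule linear_inj_imp_bij[OF z_lin])
    fix u assume "z t u = 0"
    then have "\<delta> t * coef j u = \<delta> t * coef j 0" if "j \<in> I" for j
      using \<sigma>_sol[OF that, of t] linear_simps(3)[OF z_lin] by simp
    then show "u = 0" using \<open>\<delta> t \<noteq> 0\<close> by (intro coef_eqI) simp
  qed

  define \<phi> where "\<phi> t = mk (z t v) (\<lambda>u. z t (x (inv (z t) u)))" for t
  have z_inv: "z t (inv (z t) u) = u" if "\<delta> t \<noteq> 0" for t u
    using z_bij[OF that] by (simp add: bij_is_surj surj_f_inv_f)
  have \<phi>_chart: "chart C (orbit v x) m \<phi> \<delta>"
    unfolding chart_def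
  proof (intro conjI allI impI ballI)
    fix t assume "\<delta> t \<noteq> 0"
    then show "\<phi> t \<in> orbit v x" using zE z_bij unfolding orbit_def \<phi>_def by blast
  next
    fix f assume "f \<in> C"
    then consider \<psi> where "Vector_Spaces.linear smul (*) \<psi>" "\<And>w y. f (mk w y) = \<psi> w"
      | \<psi> u where "Vector_Spaces.linear smul (*) \<psi>" "\<And>w y. f (mk w y) = \<psi> (y u)"
      using coord_mk by blast
    then show "\<exists>e. \<exists>F\<in>polynomial_functions (affine_coords m).
        \<forall>t. \<delta> t \<noteq> 0 \<longrightarrow> F t = \<delta> t ^ e * f (\<phi> t)"
    proof cases
      case (1 \<psi>)
      then show ?thesis
        by (intro exI[of _ 0] bexI[of _ "\<lambda>t. \<psi> (z t v)"] z_polynomial) (auto simp: \<phi>_def)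
    next
      case (2 \<psi> u)
      \<comment> \<open>Only \<open>inv (z t)\<close> has a denominator, and a single factor
        \<open>\<delta> t\<close> clears it.\<close>
      let ?F = "\<lambda>t. \<Sum>j\<in>I. \<sigma> u j t * \<psi> (z t (x (e j)))"
      have "?F t = \<delta> t ^ 1 * f (\<phi> t)" if "\<delta> t \<noteq> 0" for t
      proof -
        have "f (\<phi> t) = \<psi> (z t (x (inv (z t) u)))" by (simp add: \<phi>_def 2)
        also have "\<dots> = (\<Sum>j\<in>I. coef j (inv (z t) u) * \<psi> (z t (x (e j))))"
          using functional_expand[OF functional_comp[OF 2(1) linear_comp[OF z_lin x]]] .
        finally show ?thesis
          using \<sigma>_sol[of _ t "inv (z t) u"]
          by (simp add: z_inv[OF that] sum_distrib_left flip: mult.assoc)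
      qed
      moreover have "?F \<in> polynomial_functions (affine_coords m)"
        by (intro polynomial_functions_intros \<sigma> z_polynomial 2)
      ultimately show ?thesis by (intro exI[of _ 1] bexI[of _ ?F]) auto
    qed
  qed (rule \<delta>)

  \<comment> \<open>The unknowns are the parameters \<open>t j\<close>. Rows with
    \<open>None\<close> hold the coordinates of \<open>Z t v\<close>, and rows with
    \<open>Some u\<close> those of \<open>y (Z t u) - Z t (x u)\<close> for
    \<open>y = endo q\<close>. Every vector \<open>u\<close> contributes rows, so there may be
    infinitely many.\<close>
  let ?M = "\<lambda>(s, i) j q. case s of None \<Rightarrow> coef i (c j v)
    | Some u \<Rightarrow> coef i (endo q (c j u)) - coef i (c j (x u))"
  have "\<exists>D\<in>polynomial_functions C. D (mk v x) \<noteq> 0 \<and>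
    (\<forall>b. (\<forall>r. b r \<in> polynomial_functions C) \<longrightarrow>
      (\<exists>\<tau>. (\<forall>j. \<tau> j \<in> polynomial_functions C) \<and>
        (\<forall>q t. (\<forall>r. (\<Sum>j\<in>{..<m}. ?M r j q * t j) = b r q) \<longrightarrow> (\<forall>j\<in>{..<m}. D q * t j = \<tau> j q))))"
  proof (rule overdetermined_cramer)
    fix r :: "'w option \<times> 'i" and j
    show "?M r j \<in> polynomial_functions C"
    proof (cases r)
      case (Pair s i)
      then show ?thesis
        by (cases s) (simp_all add: polynomial_functions.const
            polynomial_functions_diff[OF endo_polynomial[OF coef_linear] polynomial_functions.const])
    qed
  next
    \<comment> \<open>At the base point a solution puts \<open>Z t\<close> into \<open>A\<close>,
      which meets \<open>S\<close> only in 0.\<close>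
    fix t j assume t: "\<And>r. (\<Sum>j\<in>{..<m}. ?M r j (mk v x) * t j) = 0" and j: "j \<in> {..<m}"
    have "coef i (Z t v) = 0" for i
      using t[of "(None, i)"] by (simp add: Z_def coef_simps mult.commute)
    then have "Z t v = 0" by (intro coef_eqI) (simp add: coef_simps)
    moreover have "Z t (x u) = x (Z t u)" for u
    proof (rule coef_eqI)
      fix i
      show "coef i (Z t (x u)) = coef i (x (Z t u))"
        using t[of "(Some u, i)"]
        by (simp add: Z_def coef_simps x_simps endo_mk sum_subtractf left_diff_distrib
            right_diff_distrib mult.commute)
    qed
    ultimately have "Z t \<in> stabilizer_algebra v x" using ZE by (simp add: stabilizer_algebra_def)
    then show "t j = 0" using c_indep[of t j] j by (simp add: Z_fun)
  qed simp
  then obtain D where D: "D \<in> polynomial_functions C" "D (mk v x) \<noteq> 0"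
    and D_sol: "\<And>b. (\<And>r. b r \<in> polynomial_functions C) \<Longrightarrow>
      \<exists>\<tau>. (\<forall>j. \<tau> j \<in> polynomial_functions C) \<and>
        (\<forall>q t. (\<forall>r. (\<Sum>j\<in>{..<m}. ?M r j q * t j) = b r q) \<longrightarrow> (\<forall>j\<in>{..<m}. D q * t j = \<tau> j q))"
    by blast
  have rows: "(\<Sum>j\<in>{..<m}. ?M r j q * t j) = (case r of (None, i) \<Rightarrow> coef i (Z t v)
      | (Some u, i) \<Rightarrow> coef i (endo q (Z t u)) - coef i (Z t (x u)))"
    if "Vector_Spaces.linear smul smul (endo q)" for r q t
  proof (cases r)
    case (Pair s i)
    then show ?thesis
      by (cases s)
        (simp_all add: Z_def coef_simps linear_simps[OF that] sum_subtractf left_diff_distrib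
            right_diff_distrib mult.commute)
  qed
  \<comment> \<open>Zero right-hand side: where \<open>D q\<close> is nonzero, the homogeneous
    system has only the trivial solution.\<close>
  obtain \<tau>0 where \<tau>0: "\<And>q t j. (\<And>r. (\<Sum>j\<in>{..<m}. ?M r j q * t j) = 0) \<Longrightarrow> j < m \<Longrightarrow> D q * t j = \<tau>0 j q"
    using D_sol[of "\<lambda>_ _. 0"] polynomial_functions.const by blast
  \<comment> \<open>These right-hand sides express \<open>z t v = vec q\<close> and
    \<open>endo q (z t u) = z t (x u)\<close> after the contribution of the identity in
    \<open>z t\<close> has been moved across.\<close>
  let ?b = "\<lambda>(s, i) q. case s of None \<Rightarrow> coef i (vec q) - coef i v
    | Some u \<Rightarrow> coef i (x u) - coef i (endo q u)"
  have "?b r \<in> polynomial_functions C" for r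
  proof (cases r)
    case (Pair s i)
    then show ?thesis
      by (cases s)
        (simp_all add: polynomial_functions_diff[OF vec_polynomial[OF coef_linear] polynomial_functions.const]
          polynomial_functions_diff[OF polynomial_functions.const endo_polynomial[OF coef_linear]])
  qed
  from D_sol[of ?b, OF this] obtain \<tau> where \<tau>: "\<And>j. \<tau> j \<in> polynomial_functions C"
    and \<tau>_sol: "\<And>q t j. (\<And>r. (\<Sum>j\<in>{..<m}. ?M r j q * t j) = ?b r q) \<Longrightarrow> j < m \<Longrightarrow> D q * t j = \<tau> j q"
    by blast
  have solves: "D q * t j = \<tau> j q"
    if "Vector_Spaces.linear smul smul (endo q)" "\<And>u. endo q (z t u) = z t (x u)" "z t v = vec q" "j < m"
    for q t j
  proof (rule \<tau>_sol[OF _ that(4)])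
    fix r
    have "coef i (Z t v) = coef i (vec q) - coef i v" for i
      using that(3) by (simp add: z_def coef_simps flip: that(3))
    moreover have "coef i (endo q (Z t u)) - coef i (Z t (x u)) = coef i (x u) - coef i (endo q u)" for i u
    proof -
      have "endo q u + endo q (Z t u) = x u + Z t (x u)"
        using that(2)[of u] by (simp add: z_def linear_simps[OF that(1)])
      then have "coef i (endo q u + endo q (Z t u)) = coef i (x u + Z t (x u))" by simp
      then show ?thesis by (simp add: coef_simps algebra_simps)
    qed
    ultimately show "(\<Sum>j\<in>{..<m}. ?M r j q * t j) = ?b r q"
      unfolding rows[OF that(1)] by (auto split: prod.splits option.splits)
  qed
  have \<phi>_section: "D (\<phi> t) * t j = \<tau> j (\<phi> t)" if "\<delta> t \<noteq> 0" "j < m" for t j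
  proof (rule solves[OF _ _ _ that(2)])
    have "inj (z t)" using z_bij[OF that(1)] by (rule bij_is_inj)
    show "Vector_Spaces.linear smul smul (endo (\<phi> t))"
      unfolding \<phi>_def endo_mk
      by (rule linear_comp[OF z_lin linear_comp[OF x linear_inv[OF z_lin z_bij[OF that(1)]]]])
    show "endo (\<phi> t) (z t u) = z t (x u)" for u
      by (simp add: \<phi>_def endo_mk inv_f_f[OF \<open>inj (z t)\<close>])
    show "z t v = vec (\<phi> t)" by (simp add: \<phi>_def vec_mk W_linear[OF z_lin v])
  qed

  \<comment> \<open>The parameters recovered from \<open>q\<close>. The value 0 from
    \<open>m\<close> on makes the base point correspond to the zero sequence.\<close>
  define s where "s q j = (if j < m then \<tau> j q / D q else 0)" for q j
  have "\<exists>d. \<exists>F\<in>polynomial_functions C. \<forall>q. D q \<noteq> 0 \<longrightarrow> F q = D q ^ d * \<delta> (s q)"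
  proof (rule polynomial_functions_clear_denominators[OF \<delta>(1) D(1)])
    fix f :: "(nat \<Rightarrow> 'k) \<Rightarrow> 'k" assume "f \<in> affine_coords m"
    then obtain i where i: "i < m" "f = (\<lambda>t. t i)" by (auto simp: affine_coords_def)
    then show "\<exists>d. \<exists>F\<in>polynomial_functions C. \<forall>q. D q \<noteq> 0 \<longrightarrow> F q = D q ^ d * f (s q)"
      using \<tau>[of i] by (intro exI[of _ 1] bexI[of _ "\<tau> i"]) (auto simp: s_def)
  qed
  then obtain d F where F: "F \<in> polynomial_functions C" "\<And>q. D q \<noteq> 0 \<Longrightarrow> F q = D q ^ d * \<delta> (s q)"
    by blast
  \<comment> \<open>\<open>F\<close> is \<open>\<delta> (s q)\<close> cleared of denominators, so
    \<open>?h\<close> is nonzero exactly where both \<open>D q\<close> and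
    \<open>\<delta> (s q)\<close> are.\<close>
  let ?h = "\<lambda>q. D q * F q"
  have h: "?h \<in> polynomial_functions C" using D F by (intro polynomial_functions_intros)
  have h_base: "?h (mk v x) \<noteq> 0"
  proof -
    have "\<tau> j (mk v x) = 0" if "j < m" for j
      using solves[of "mk v x" "\<lambda>_. 0" j] that x v by (simp add: endo_mk vec_mk z_0)
    then have "s (mk v x) = (\<lambda>_. 0)" by (auto simp: s_def)
    then show ?thesis using F(2) D(2) \<delta>(2) by simp
  qed
  have cover: "\<exists>t. \<delta> t \<noteq> 0 \<and> \<phi> t = q" if q: "q \<in> orbit v x" "?h q \<noteq> 0" for q
  proof -
    obtain g where g: "g \<in> E" "bij g" and q_eq: "q = mk (g v) (\<lambda>u. g (x (inv g u)))"
      using q(1) by (auto simp: orbit_def)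
    note g_lin = E_linear[OF g(1)]
    have inv_g: "inv g (g u) = u" for u using g(2) by (simp add: bij_is_inj inv_f_f)
    have endo_q: "endo q = (\<lambda>u. g (x (inv g u)))" by (simp add: q_eq endo_mk)
    have endo_q_lin: "Vector_Spaces.linear smul smul (endo q)"
      unfolding endo_q by (rule linear_comp[OF g_lin linear_comp[OF x linear_inv[OF g_lin g(2)]]])
    have vec_q: "vec q = g v" by (simp add: q_eq vec_mk W_linear[OF g_lin v])
    have "D q \<noteq> 0" "\<delta> (s q) \<noteq> 0" using q(2) F(2)[of q] by auto
    \<comment> \<open>Transversality at \<open>q\<close>: an element \<open>Z t\<close> of
      \<open>gA\<close> solves the homogeneous system at \<open>q\<close>, hence vanishes.\<close>
    have inj: "a = 0 \<and> (\<forall>j<m. t j = 0)"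
      if a: "a \<in> stabilizer_algebra v x" and eq: "(\<lambda>u. g (a u)) = (\<Sum>j<m. (\<lambda>u. smul (t j) (c j u)))" for a t
    proof -
      have Z_eq: "Z t u = g (a u)" for u using eq unfolding Z_fun by metis
      have "(\<Sum>j\<in>{..<m}. ?M r j q * t j) = 0" for r
        unfolding rows[OF endo_q_lin] using a
        by (auto simp: Z_eq endo_q inv_g stabilizer_algebra_def linear_simps[OF g_lin] coef_simps
            split: prod.splits option.splits)
      then have "D q * t j = D q * 0" if "j < m" for j
        using \<tau>0[of q t j] \<tau>0[of q "\<lambda>_. 0" j] that by simp
      then have t0: "\<forall>j<m. t j = 0" using \<open>D q \<noteq> 0\<close> by simp
      then have "g (a u) = 0" for u unfolding Z_eq[symmetric] by (simp add: Z_def)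
      then have "a u = 0" for u using inv_g linear_simps(3)[OF linear_inv[OF g_lin g(2)]] by metis
      then have "a = 0" by auto
      with t0 show ?thesis by blast
    qed
    \<comment> \<open>Transversality allows \<open>g - 1\<close> to be split along \<open>gA\<close>
      and \<open>S\<close>. The resulting \<open>z t = g (1 - a)\<close> lies in
      \<open>g (1 + A)\<close>, so it moves the base point to \<open>q\<close> just as
      \<open>g\<close> does.\<close>
    have "\<exists>a\<in>stabilizer_algebra v x. \<exists>t. g - (\<lambda>u. u) = (\<lambda>u. g (a u)) + (\<Sum>j<m. (\<lambda>u. smul (t j) (c j u)))"
    proof (rule c_onto[rule_format], intro conjI ballI allI impI)
      show "g - (\<lambda>u. u) \<in> E" using fs.subspace_diff[OF E_subspace g(1) E_id] .
      show "(\<lambda>u. g (a u)) \<in> E" if "a \<in> stabilizer_algebra v x" for a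
        using that by (intro E_comp[OF g(1)]) (simp add: stabilizer_algebra_def)
      show "(\<lambda>u. g ((a + b) u)) = (\<lambda>u. g (a u)) + (\<lambda>u. g (b u))"
        "(\<lambda>u. g (smul r (a u))) = (\<lambda>u. smul r (g (a u)))" for a b r
        by (auto simp: linear_simps[OF g_lin])
    qed (use inj in auto)
    then obtain a t where a: "a \<in> stabilizer_algebra v x"
      and "g - (\<lambda>u. u) = (\<lambda>u. g (a u)) + Z t" unfolding Z_fun by blast
    then have g_diff: "g u - u = g (a u) + Z t u" for u by (metis minus_apply plus_fun_apply)
    have g_eq: "g u = g (a u) + Z t u + u" for u using g_diff[of u] unfolding diff_eq_eq .
    have z_eq: "z t u = g u - g (a u)" for u
      unfolding z_def g_eq[of u] by (simp add: algebra_simps)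
    have endo_z: "endo q (z t u) = z t (x u)" for u
      using a by (simp add: endo_q z_eq inv_g stabilizer_algebra_def flip: linear_simps(4)[OF g_lin])
        (simp add: x_simps linear_simps[OF g_lin])
    have vec_z: "z t v = vec q"
      using a by (simp add: z_eq vec_q stabilizer_algebra_def linear_simps[OF g_lin])
    have st: "s q j = t j" if "j < m" for j
      using solves[OF endo_q_lin endo_z vec_z that] that \<open>D q \<noteq> 0\<close> by (simp add: s_def field_simps)
    then have "\<delta> t \<noteq> 0"
      using \<open>\<delta> (s q) \<noteq> 0\<close> polynomial_functions_affine_cong[OF \<delta>(1), of "s q" t] by simp
    moreover have "\<phi> t = q"
    proof -
      have "z t (x (inv (z t) u)) = endo q u" for u
        using endo_z[of "inv (z t) u"] z_inv[OF \<open>\<delta> t \<noteq> 0\<close>] by simp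
      moreover have "z t v = g v" using vec_z vec_q by simp
      ultimately show ?thesis by (simp add: \<phi>_def q_eq endo_mk)
    qed
    ultimately show ?thesis by blast
  qed
  have "\<phi> (\<lambda>_. 0) = mk v x" by (simp add: \<phi>_def z_0 inv_id[unfolded id_def])
  from that[OF \<phi>_chart this \<delta>(2) D \<tau> \<phi>_section h h_base cover] show thesis .
qed

text \<open>The upper bound needs a chart around every point. Instead of translating one chart, the
  construction is repeated with each point as base point: the orbit is the same set, and conjugation
  preserves the dimension of the stabilizer algebra.\<close>

theorem krull_dim_orbit:
  assumes "infinite (UNIV :: 'k set)" and x: "Vector_Spaces.linear smul smul x" and v: "v \<in> W"
  shows "krull_dim (subtopology (zariski C) (orbit v x)) =
    enat (fs.dim E - fs.dim (stabilizer_algebra v x))"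
proof (rule antisym)
  let ?m = "fs.dim E - fs.dim (stabilizer_algebra v x)"
  show "krull_dim (subtopology (zariski C) (orbit v x)) \<le> enat ?m"
  proof (rule krull_dim_le_of_charts)
    fix p assume "p \<in> orbit v x"
    then obtain g where g: "g \<in> E" "bij g" and p: "p = mk (g v) (\<lambda>u. g (x (inv g u)))"
      by (auto simp: orbit_def)
    let ?x = "\<lambda>u. g (x (inv g u))"
    note g_lin = E_linear[OF g(1)]
    have x': "Vector_Spaces.linear smul smul ?x"
      by (rule linear_comp[OF g_lin linear_comp[OF x linear_inv[OF g_lin g(2)]]])
    have inv: "g (inv g u) = u" "inv g (g u) = u" for u
      using g(2) by (simp_all add: surj_f_inv_f bij_is_surj inv_f_f bij_is_inj)
    have "mk (h (g v)) (\<lambda>u. h (?x (inv h u))) \<in> orbit v x" if "h \<in> E" "bij h" for h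
    proof -
      let ?h = "\<lambda>u. h (g u)"
      have "bij ?h" using bij_comp[OF g(2) that(2)] by (simp add: o_def)
      moreover have "inv ?h = (\<lambda>u. inv g (inv h u))"
        using o_inv_distrib[OF that(2) g(2)] by (simp add: o_def)
      moreover have "?h \<in> E" using that(1) g(1) by (rule E_comp)
      ultimately show ?thesis
        unfolding orbit_def by (intro CollectI exI[of _ ?h] conjI) simp_all
    qed
    then have 1: "orbit (g v) ?x \<subseteq> orbit v x" unfolding orbit_def[of "g v"] by auto
    have "mk (h v) (\<lambda>u. h (x (inv h u))) \<in> orbit (g v) ?x" if "h \<in> E" "bij h" for h
    proof -
      let ?h = "\<lambda>u. h (inv g u)"
      have "bij ?h" using bij_comp[OF bij_imp_bij_inv[OF g(2)] that(2)] by (simp add: o_def)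
      moreover have "inv ?h = (\<lambda>u. g (inv h u))"
        using o_inv_distrib[OF that(2) bij_imp_bij_inv[OF g(2)]] by (simp add: o_def inv_inv_eq[OF g(2)])
      moreover have "?h \<in> E" by (rule E_comp[OF that(1) E_inv[OF g]])
      ultimately show ?thesis
        unfolding orbit_def by (intro CollectI exI[of _ ?h] conjI) (simp_all add: inv)
    qed
    then have "orbit v x \<subseteq> orbit (g v) ?x" unfolding orbit_def[of v] by auto
    with 1 have orbit: "orbit (g v) ?x = orbit v x" by (rule antisym)
    obtain \<phi> \<delta> D \<tau> h where "chart C (orbit (g v) ?x) ?m \<phi> \<delta>"
      "h \<in> polynomial_functions C" "h (mk (g v) ?x) \<noteq> 0"
      "\<And>q. q \<in> orbit (g v) ?x \<Longrightarrow> h q \<noteq> 0 \<Longrightarrow> \<exists>t. \<delta> t \<noteq> 0 \<and> \<phi> t = q"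
      by (rule orbit_chart[OF x' W_linear[OF g_lin v], of ?m])
        (simp_all add: dim_stabilizer_algebra_conj[OF x g])
    then show "\<exists>\<phi> \<delta> h. chart C (orbit v x) ?m \<phi> \<delta> \<and> h \<in> polynomial_functions C \<and> h p \<noteq> 0 \<and>
        (\<forall>q\<in>orbit v x. h q \<noteq> 0 \<longrightarrow> (\<exists>t. \<delta> t \<noteq> 0 \<and> \<phi> t = q))"
      unfolding orbit p by blast
  qed
  obtain \<phi> \<delta> D \<tau> h where "chart C (orbit v x) ?m \<phi> \<delta>" "\<phi> (\<lambda>_. 0) = mk v x" "\<delta> (\<lambda>_. 0) \<noteq> 0"
    "D \<in> polynomial_functions C" "D (mk v x) \<noteq> 0" "\<And>j. \<tau> j \<in> polynomial_functions C"
    "\<And>t j. \<delta> t \<noteq> 0 \<Longrightarrow> j < ?m \<Longrightarrow> D (\<phi> t) * t j = \<tau> j (\<phi> t)"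
    by (rule orbit_chart[OF x v refl]) (rule that)
  note c = this
  show "enat ?m \<le> krull_dim (subtopology (zariski C) (orbit v x))"
    by (rule krull_dim_ge_of_chart[OF assms(1) c(1,3,4) _ c(6,7)]) (simp add: c)
qed

end

section \<open>Endomorphisms and stabilizers in a Jordan basis\<close>

definition jordan_cells :: "(nat \<Rightarrow> nat) \<Rightarrow> (nat \<times> nat) set" where
  "jordan_cells lam = {(i, j). 1 \<le> j \<and> j \<le> lam i}"

text \<open>Since \<open>lam\<close> is decreasing, its support is an initial segment, and its
  cardinality is also where it ends.\<close>

lemma plen_iff:
  assumes "is_partition lam"
  shows "i < plen lam \<longleftrightarrow> 0 < lam i"
proof -
  obtain N where N: "\<And>i. i \<ge> N \<Longrightarrow> lam i = 0" using assms by (auto simp: is_partition_def)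
  have anti: "lam j \<le> lam i" if "i \<le> j" for i j
    using assms that by (auto simp: is_partition_def antimono_def)
  define l where "l = (LEAST i. lam i = 0)"
  have "lam l = 0" unfolding l_def by (rule LeastI[of _ N]) (simp add: N)
  have "{i. lam i > 0} = {..<l}"
  proof (intro set_eqI iffI)
    fix i assume "i \<in> {i. lam i > 0}"
    then show "i \<in> {..<l}" using anti[of l i] \<open>lam l = 0\<close> by (cases "l \<le> i") auto
  next
    fix i assume "i \<in> {..<l}"
    then show "i \<in> {i. lam i > 0}" using not_less_Least[of i "\<lambda>i. lam i = 0"] by (auto simp: l_def)
  qed
  then show ?thesis unfolding plen_def by auto
qed

lemma finite_jordan_cells:
  assumes "is_partition lam" shows "finite (jordan_cells lam)"
proof (rule finite_subset)
  have "j \<le> lam 0" if "j \<le> lam i" for i j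
    using assms that antimonoD[of lam 0 i] by (auto simp: is_partition_def)
  then show "jordan_cells lam \<subseteq> {..<plen lam} \<times> {..lam 0}"
    using plen_iff[OF assms] by (fastforce simp: jordan_cells_def)
qed simp

lemma (in vector_space) dim_zero: "dim {0} = 0"
  using dim_unique[of "{}" "{0}" 0] independent_empty by simp

text \<open>The coloring and \<open>x\<close> are described entirely in Jordan coordinates. In this
  form the data can be transported by the group and extended to a larger field by changing only
  \<open>e\<close> and \<open>coef\<close>.\<close>

locale colored_jordan = indexed_basis smul "jordan_cells lam" e coef
  for smul :: "'k::field \<Rightarrow> 'w::ab_group_add \<Rightarrow> 'w" and lam e coef +
  fixes n :: int and V :: "int \<Rightarrow> 'w set" and eps :: "nat \<Rightarrow> int" and x :: "'w \<Rightarrow> 'w"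
  assumes n_pos: "n \<ge> 1" and partition: "is_partition lam"
    and eps_range: "eps i \<in> {0..<n}"
    and V_eq: "m \<in> {0..<n} \<Longrightarrow> V m = {u. \<forall>(i, j)\<in>jordan_cells lam. coef (i, j) u \<noteq> 0 \<longrightarrow>
        (eps i + (int (lam i) - int j)) mod n = m}"
    and x_linear: "Vector_Spaces.linear smul smul x"
    and x_e: "(i, j) \<in> jordan_cells lam \<Longrightarrow> x (e (i, j)) = (if j > 1 then e (i, j - 1) else 0)"
begin

abbreviation "cells \<equiv> jordan_cells lam"

definition color :: "nat \<times> nat \<Rightarrow> int" where
  "color p = (eps (fst p) + (int (lam (fst p)) - int (snd p))) mod n"

lemma color_range: "color p \<in> {0..<n}"
  using n_pos by (simp add: color_def)

lemma V_iff: "m \<in> {0..<n} \<Longrightarrow> u \<in> V m \<longleftrightarrow> (\<forall>p\<in>cells. coef p u \<noteq> 0 \<longrightarrow> color p = m)"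
  by (simp add: V_eq color_def case_prod_unfold)

lemma e_in_V: "p \<in> cells \<Longrightarrow> e p \<in> V (color p)"
  using V_iff[OF color_range] by (auto simp: coef_e)

lemma subspace_V: "m \<in> {0..<n} \<Longrightarrow> subspace (V m)"
  unfolding subspace_def using V_iff by (fastforce simp: coef_simps)

lemma span_e: "span (e ` cells) = UNIV"
proof -
  have "(\<Sum>i\<in>cells. smul (coef i u) (e i)) \<in> span (e ` cells)" for u
    by (intro span_sum span_scale span_base) auto
  then show ?thesis unfolding expand by auto
qed

text \<open>The assumptions make \<open>S\<close> the span of the basis vectors indexed by
  \<open>Q\<close>, with the coordinates in \<open>Q\<close> as dual functionals.\<close>

lemma dim_by_coefs:
  assumes S: "subspace S" and Q: "Q \<subseteq> cells" "\<And>p. p \<in> Q \<Longrightarrow> e p \<in> S"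
    and zero: "\<And>u p. u \<in> S \<Longrightarrow> p \<in> cells \<Longrightarrow> p \<notin> Q \<Longrightarrow> coef p u = 0"
  shows "dim S = card Q"
proof -
  have "dim S = dim {u \<in> S. \<forall>p\<in>Q. coef p u = 0} + card Q"
  proof (rule dim_dual_functionals[OF _ S, of _ "e ` cells"])
    show "finite Q" using Q(1) finite_I by (rule finite_subset)
    show "coef p (e q) = (if p = q then 1 else 0)" if "p \<in> Q" "q \<in> Q" for p q
      using that Q(1) by (intro coef_e) auto
  qed (simp_all add: Q(2) finite_I span_e coef_simps)
  also have "{u \<in> S. \<forall>p\<in>Q. coef p u = 0} = {0}"
  proof (intro equalityI subsetI)
    fix u assume u: "u \<in> {u \<in> S. \<forall>p\<in>Q. coef p u = 0}"
    have "u = 0"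
    proof (rule coef_eqI)
      fix p assume "p \<in> cells"
      with u zero[of u p] show "coef p u = coef p 0" by (cases "p \<in> Q") (auto simp: coef_simps)
    qed
    then show "u \<in> {0}" by simp
  qed (use S subspace_0 in \<open>auto simp: coef_simps\<close>)
  also have "dim {0} = 0" by (rule dim_zero)
  finally show ?thesis by simp
qed

lemma dim_V: "m \<in> {0..<n} \<Longrightarrow> dim (V m) = card {p \<in> cells. color p = m}"
  by (rule dim_by_coefs) (use V_iff e_in_V subspace_V in auto)

lemma coef_x:
  assumes "(i, j) \<in> cells"
  shows "coef (i, j) (x u) = (if j < lam i then coef (i, Suc j) u else 0)"
proof -
  have "coef (i, j) (x (e q)) = (if q = (i, Suc j) then 1 else 0)" if "q \<in> cells" for q
  proof (cases q)
    case (Pair k l)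
    show ?thesis
    proof (cases "l > 1")
      case True
      then have "(k, l - 1) \<in> cells" using that Pair by (auto simp: jordan_cells_def)
      with True that assms show ?thesis by (auto simp: Pair x_e coef_e)
    next
      case False
      with that assms show ?thesis by (auto simp: Pair x_e coef_simps jordan_cells_def)
    qed
  qed
  then have "coef (i, j) (x u) = (\<Sum>q\<in>cells. if q = (i, Suc j) then coef q u else 0)"
    unfolding functional_expand[OF functional_comp[OF coef_linear x_linear], of _ u]
    by (intro sum.cong) auto
  then show ?thesis using finite_I by (auto simp: jordan_cells_def)
qed

lemma coef_funpow:
  "(i, j) \<in> cells \<Longrightarrow> coef (i, j) ((x ^^ k) u) = (if j + k \<le> lam i then coef (i, j + k) u else 0)"
proof (induction k arbitrary: j)
  case 0
  then show ?case by (auto simp: jordan_cells_def)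
next
  case (Suc k)
  show ?case
  proof (cases "j < lam i")
    case True
    then have "(i, Suc j) \<in> cells" by (simp add: jordan_cells_def)
    with Suc True show ?thesis by (simp add: coef_x)
  qed (use Suc coef_x in simp)
qed

lemma funpow_e: "(i, j) \<in> cells \<Longrightarrow> k < j \<Longrightarrow> (x ^^ k) (e (i, j)) = e (i, j - k)"
proof (induction k)
  case (Suc k)
  then have "(i, j - k) \<in> cells" "1 < j - k" "j - k - 1 = j - Suc k"
    by (auto simp: jordan_cells_def)
  with Suc show ?case by (simp add: x_e)
qed simp

lemma funpow_linear: "Vector_Spaces.linear smul smul (x ^^ k)"
proof (induction k)
  case 0
  show ?case by (rule linearI) simp_all
next
  case (Suc k)
  from linear_comp[OF x_linear Suc] show ?case by (simp add: o_def)
qed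

text \<open>The \<open>k\<close>-th power of \<open>x\<close> shifts every row by \<open>k\<close>
  columns, so its kernel is spanned by the first \<open>k\<close> columns.\<close>

lemma kernel_signature_eq:
  assumes "m \<in> {0..<n}"
  shows "kernel_signature smul V x k m = card {p \<in> cells. snd p \<le> k \<and> color p = m}"
  unfolding kernel_signature_def
proof (rule dim_by_coefs)
  have "{u \<in> V m. (x ^^ k) u = 0} = {u \<in> V m. \<forall>i\<in>cells. coef i ((x ^^ k) u) = 0}"
    using coef_eqI[of _ 0] by (auto simp: coef_simps)
  then show "subspace {u \<in> V m. (x ^^ k) u = 0}"
    using subspace_common_zeros[OF subspace_V[OF assms], of cells "\<lambda>i u. coef i ((x ^^ k) u)"]
    by (simp add: coef_simps linear_simps[OF funpow_linear])
next
  fix p assume p: "p \<in> {p \<in> cells. snd p \<le> k \<and> color p = m}"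
  have "(x ^^ k) (e p) = 0"
  proof (rule coef_eqI)
    fix q assume q: "q \<in> cells"
    obtain i j where ij: "q = (i, j)" by fastforce
    show "coef q ((x ^^ k) (e p)) = coef q 0"
    proof (cases "j + k \<le> lam i")
      case True
      then have "(i, j + k) \<in> cells" using q ij by (auto simp: jordan_cells_def)
      moreover have "(i, j + k) \<noteq> p" using p q ij by (auto simp: jordan_cells_def)
      ultimately show ?thesis using p q True by (simp add: ij coef_funpow coef_e coef_simps)
    qed (use q ij in \<open>simp add: coef_funpow coef_simps\<close>)
  qed
  then show "e p \<in> {u \<in> V m. (x ^^ k) u = 0}" using p e_in_V[of p] by simp
next
  fix u p assume u: "u \<in> {u \<in> V m. (x ^^ k) u = 0}" and p: "p \<in> cells"
    "p \<notin> {p \<in> cells. snd p \<le> k \<and> color p = m}"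
  obtain i j where ij: "p = (i, j)" by fastforce
  show "coef p u = 0"
  proof (cases "j \<le> k")
    case True
    then show ?thesis using u p ij V_iff[OF assms] by auto
  next
    case False
    then have "(i, j - k) \<in> cells" using p(1) ij by (auto simp: jordan_cells_def)
    from coef_funpow[OF this, of k u] False p(1) u show ?thesis
      by (simp add: ij jordan_cells_def coef_simps)
  qed
qed simp

section \<open>The algebra of color-preserving endomorphisms\<close>

definition colored_endos :: "('w \<Rightarrow> 'w) set" where
  "colored_endos = {g. Vector_Spaces.linear smul smul g \<and> (\<forall>m\<in>{0..<n}. g ` V m \<subseteq> V m)}"

definition linear_extension :: "(nat \<times> nat \<Rightarrow> 'w) \<Rightarrow> 'w \<Rightarrow> 'w" where
  "linear_extension f u = (\<Sum>q\<in>cells. smul (coef q u) (f q))"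

lemma colored_endoD:
  "g \<in> colored_endos \<Longrightarrow> m \<in> {0..<n} \<Longrightarrow> u \<in> V m \<Longrightarrow> g u \<in> V m"
  by (auto simp: colored_endos_def image_subset_iff)

lemma colored_endoI:
  assumes "\<And>u w. g (u + w) = g u + g w" "\<And>c u. g (smul c u) = smul c (g u)"
    and "\<And>m u. m \<in> {0..<n} \<Longrightarrow> u \<in> V m \<Longrightarrow> g u \<in> V m"
  shows "g \<in> colored_endos"
  using assms by (auto simp: colored_endos_def intro: linearI)

lemma linear_extension_linear: "Vector_Spaces.linear smul smul (linear_extension f)"
  by (rule linearI)
    (simp_all add: linear_extension_def coef_simps scale_left_distrib sum.distrib scale_sum_right)

lemma linear_extension_e:
  assumes "q \<in> cells" shows "linear_extension f (e q) = f q"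
proof -
  have "linear_extension f (e q) = (\<Sum>p\<in>cells. if p = q then f p else 0)"
    unfolding linear_extension_def using assms by (intro sum.cong) (auto simp: coef_e)
  then show ?thesis using assms finite_I by simp
qed

lemma linear_extension_colored:
  assumes "\<And>q. q \<in> cells \<Longrightarrow> f q \<in> V (color q)"
  shows "linear_extension f \<in> colored_endos"
  unfolding colored_endos_def
proof (intro CollectI conjI linear_extension_linear ballI image_subsetI)
  fix m u assume m: "m \<in> {0..<n}" and u: "u \<in> V m"
  have "smul (coef q u) (f q) \<in> V m" if "q \<in> cells" for q
  proof (cases "coef q u = 0")
    case True
    then show ?thesis using subspace_0[OF subspace_V[OF m]] by simp
  next
    case False
    then have "color q = m" using u V_iff[OF m] that by blast
    then show ?thesis using assms[OF that] subspace_scale[OF subspace_V[OF m]] by simp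
  qed
  then show "linear_extension f u \<in> V m" unfolding linear_extension_def by (rule subspace_sum[OF subspace_V[OF m]])
qed

lemma linear_eqI:
  assumes "Vector_Spaces.linear smul smul f" "Vector_Spaces.linear smul smul g"
    "\<And>q. q \<in> cells \<Longrightarrow> f (e q) = g (e q)"
  shows "f = g"
proof
  fix u show "f u = g u"
    unfolding linear_expand[OF assms(1), of u] linear_expand[OF assms(2), of u]
    by (intro sum.cong refl) (simp add: assms(3))
qed

lemma colored_endo_coef:
  assumes "g \<in> colored_endos" "p \<in> cells" "q \<in> cells" "coef p (g (e q)) \<noteq> 0"
  shows "color p = color q"
proof -
  have "g (e q) \<in> V (color q)"
    using assms(1) color_range e_in_V[OF assms(3)] by (rule colored_endoD)
  then show ?thesis using V_iff[OF color_range] assms by blast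
qed

text \<open>For \<open>w\<close> in \<open>V m\<close> the component of color \<open>m\<close> of a
  preimage is again a preimage, because the other components are sent to vectors without coordinates
  of color \<open>m\<close>. Hence the bijective elements of the algebra are precisely the group
  \<open>K\<close>.\<close>

lemma bij_colored_endo:
  assumes "g \<in> colored_endos" "bij g" "m \<in> {0..<n}"
  shows "g ` V m = V m"
proof
  have g: "Vector_Spaces.linear smul smul g" and gV: "\<And>m. m \<in> {0..<n} \<Longrightarrow> g ` V m \<subseteq> V m"
    using assms(1) by (auto simp: colored_endos_def)
  show "g ` V m \<subseteq> V m" using gV assms(3) .
  show "V m \<subseteq> g ` V m"
  proof
    fix w assume w: "w \<in> V m"
    obtain u where u: "w = g u" using assms(2) by (auto simp: bij_def surj_def)
    define u1 where "u1 = (\<Sum>p\<in>cells. smul (if color p = m then coef p u else 0) (e p))"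
    have coef_u1: "coef p u1 = (if color p = m then coef p u else 0)" if "p \<in> cells" for p
      unfolding u1_def by (rule coef_sum_e[OF that])
    have "coef p (g (u - u1)) = 0" if p: "p \<in> cells" "color p = m" for p
    proof -
      have "\<forall>q\<in>cells. coef q (u - u1) * coef p (g (e q)) = 0"
        using colored_endo_coef[OF assms(1) p(1)] p(2) by (auto simp: coef_simps coef_u1)
      then show ?thesis
        unfolding functional_expand[OF functional_comp[OF coef_linear g], of p "u - u1"]
        by (rule sum.neutral)
    qed
    moreover have "u1 \<in> V m" using V_iff[OF assms(3)] coef_u1 by auto
    moreover have "g u1 \<in> V m" using assms(1,3) \<open>u1 \<in> V m\<close> by (rule colored_endoD)
    ultimately have "w = g u1"
    proof (intro coef_eqI)
      fix p assume p: "p \<in> cells"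
      assume *: "\<And>p. p \<in> cells \<Longrightarrow> color p = m \<Longrightarrow> coef p (g (u - u1)) = 0" "g u1 \<in> V m"
      show "coef p w = coef p (g u1)"
      proof (cases "color p = m")
        case True
        with *(1)[OF p] show ?thesis by (simp add: u linear_simps[OF g] coef_simps)
      next
        case False
        then have "coef p w = 0" "coef p (g u1) = 0" using w *(2) V_iff[OF assms(3)] p by auto
        then show ?thesis by simp
      qed
    qed
    with \<open>u1 \<in> V m\<close> show "w \<in> g ` V m" by blast
  qed
qed

lemma colored_GL_eq: "colored_GL smul n V = {g \<in> colored_endos. bij g}"
proof (intro set_eqI iffI)
  fix g assume "g \<in> colored_GL smul n V"
  then show "g \<in> {g \<in> colored_endos. bij g}" by (simp add: colored_GL_def colored_endos_def)
next
  fix g assume g: "g \<in> {g \<in> colored_endos. bij g}"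
  then have "\<forall>m\<in>{0..<n}. g ` V m = V m" using bij_colored_endo by blast
  with g show "g \<in> colored_GL smul n V" by (simp add: colored_GL_def colored_endos_def)
qed

sublocale endomorphism_algebra smul cells e coef colored_endos
proof unfold_locales
  have lin: "Vector_Spaces.linear smul smul g" if "g \<in> colored_endos" for g
    using that by (simp add: colored_endos_def)
  show simps: "g (u + w) = g u + g w" "g (smul c u) = smul c (g u)"
    if "g \<in> colored_endos" for g u w c
    by (rule linear_simps[OF lin[OF that]])+
  show "(\<lambda>u. f (g u)) \<in> colored_endos" if "f \<in> colored_endos" "g \<in> colored_endos" for f g
    using that by (intro colored_endoI) (simp_all add: simps colored_endoD)
  show "(\<lambda>u. u) \<in> colored_endos" by (rule colored_endoI) simp_all
  have "f + g \<in> colored_endos" if "f \<in> colored_endos" "g \<in> colored_endos" for f g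
    using that by (intro colored_endoI)
      (simp_all add: simps scale_right_distrib colored_endoD subspace_add[OF subspace_V])
  moreover have "(\<lambda>u. smul c (g u)) \<in> colored_endos" if "g \<in> colored_endos" for c g
    using that by (intro colored_endoI)
      (simp_all add: simps scale_right_distrib scale_left_commute colored_endoD
        subspace_scale[OF subspace_V])
  moreover have "0 \<in> colored_endos"
    by (rule colored_endoI) (simp_all add: subspace_0[OF subspace_V])
  ultimately show "fs.subspace colored_endos" unfolding fs.subspace_def by blast
next
  fix g assume g: "g \<in> colored_endos" "bij g"
  then have lin: "Vector_Spaces.linear smul smul g" by (simp add: colored_endos_def)
  have "inv g ` V m \<subseteq> V m" if "m \<in> {0..<n}" for m
  proof -
    have "inv g ` (g ` V m) = V m"
      using bij_is_inj[OF g(2)] by (simp add: image_image inv_f_f)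
    then show ?thesis by (simp add: bij_colored_endo[OF g that])
  qed
  then show "inv g \<in> colored_endos"
    unfolding colored_endos_def using linear_inv[OF lin g(2)] by blast
qed

text \<open>The matrix entries at pairs of cells of equal color are coordinates on the algebra, with
  the matrix units as dual family; the pairs are then sorted by color.\<close>

lemma dim_colored_endos: "fs.dim colored_endos = (\<Sum>m\<in>{0..<n}. (dim (V m))\<^sup>2)"
proof -
  define P where "P = {(p, q). p \<in> cells \<and> q \<in> cells \<and> color p = color q}"
  have "P \<subseteq> cells \<times> cells" by (auto simp: P_def)
  then have "finite P" using finite_I by (auto intro: finite_subset)
  have "fs.dim colored_endos =
      fs.dim {g \<in> colored_endos. \<forall>r\<in>P. (\<lambda>(p, q) g. coef p (g (e q))) r g = 0} + card P"
  proof (rule fs.dim_dual_functionals[OF \<open>finite P\<close> E_subspace finite_elementary E_span,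
        where b = "\<lambda>(p, q). linear_extension (\<lambda>q'. if q' = q then e p else 0)"])
    fix r assume "r \<in> P"
    then show "(\<lambda>(p, q). linear_extension (\<lambda>q'. if q' = q then e p else 0)) r \<in> colored_endos"
    proof -
      obtain p q where Pair: "r = (p, q)" by (rule prod.exhaust)
      then have pq: "p \<in> cells" "color p = color q" using \<open>r \<in> P\<close> by (simp_all add: P_def)
      have "(if q' = q then e p else 0) \<in> V (color q')" for q'
        using e_in_V[OF pq(1)] pq(2) subspace_0[OF subspace_V[OF color_range]] by simp
      then show ?thesis unfolding Pair prod.case by (rule linear_extension_colored)
    qed
  next
    fix r s assume rs: "r \<in> P" "s \<in> P"
    obtain p q where r: "r = (p, q)" by (rule prod.exhaust)
    obtain p' q' where s: "s = (p', q')" by (rule prod.exhaust)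
    show "(\<lambda>(p, q) g. coef p (g (e q))) r
        ((\<lambda>(p, q). linear_extension (\<lambda>q'. if q' = q then e p else 0)) s) = (if r = s then 1 else 0)"
      using rs unfolding r s by (cases "q = q'") (simp_all add: P_def linear_extension_e coef_e coef_simps)
  qed (auto simp: coef_simps)
  also have "{g \<in> colored_endos. \<forall>r\<in>P. (\<lambda>(p, q) g. coef p (g (e q))) r g = 0} = {0}"
  proof (intro equalityI subsetI)
    fix g assume g: "g \<in> {g \<in> colored_endos. \<forall>r\<in>P. (\<lambda>(p, q) g. coef p (g (e q))) r g = 0}"
    have "coef p (g (e q)) = 0" if "p \<in> cells" "q \<in> cells" for p q
    proof (cases "color p = color q")
      case True
      then have "(p, q) \<in> P" using that by (simp add: P_def)
      with g have "(\<lambda>(p, q) g. coef p (g (e q))) (p, q) g = 0" by blast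
      then show ?thesis by simp
    qed (use colored_endo_coef[of g p q] g that in blast)
    then have "g (e q) = 0" if "q \<in> cells" for q using that by (intro coef_eqI) (simp add: coef_simps)
    then have "g = (\<lambda>u. 0)" using g by (intro linear_eqI E_linear linearI) auto
    then show "g \<in> {0}" by (simp add: zero_fun_def)
  qed (use fs.subspace_0[OF E_subspace] in \<open>auto simp: coef_simps\<close>)
  also have "fs.dim {0} = 0" by (rule fs.dim_zero)
  also have "card P = (\<Sum>m\<in>{0..<n}. (dim (V m))\<^sup>2)"
  proof -
    have "P = (\<Union>m\<in>{0..<n}. {p \<in> cells. color p = m} \<times> {p \<in> cells. color p = m})"
      using color_range by (auto simp: P_def)
    also have "card \<dots> = (\<Sum>m\<in>{0..<n}. card ({p \<in> cells. color p = m} \<times> {p \<in> cells. color p = m}))"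
      using finite_I by (intro card_UN_disjoint) auto
    finally show ?thesis by (simp add: dim_V card_cartesian_product power2_eq_square)
  qed
  finally show ?thesis by simp
qed

end

text \<open>The numbers counted are \<open>\<mu> - t * n\<close> for those \<open>t \<ge> 0\<close>
  with \<open>t * n < \<mu>\<close>, that is, for \<open>t\<close> below the ceiling. If
  \<open>- n < \<mu> \<le> 0\<close>, none exists and the ceiling is 0 as well; the lower bound on
  \<open>\<mu>\<close> prevents a negative ceiling.\<close>

lemma card_congruent_below:
  fixes n \<mu> :: int
  assumes "n \<ge> 1" "\<mu> > - n"
  shows "int (card {j :: nat. 1 \<le> j \<and> int j \<le> \<mu> \<and> (\<mu> - int j) mod n = 0}) =
    \<lceil>real_of_int \<mu> / real_of_int n\<rceil>"
proof -
  let ?c = "\<lceil>real_of_int \<mu> / real_of_int n\<rceil>"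
  have c: "?c - 1 < real_of_int \<mu> / real_of_int n" "real_of_int \<mu> / real_of_int n \<le> ?c"
    by linarith+
  have "real_of_int ?c * n - n < \<mu>"
    using c(1) assms(1) by (simp add: field_simps)
  then have c1: "?c * n - n < \<mu>" by (metis of_int_diff of_int_less_iff of_int_mult)
  have "real_of_int \<mu> \<le> real_of_int ?c * n"
    using assms(1) by (intro pos_divide_le_eq[THEN iffD1, OF _ c(2)]) simp
  then have c2: "\<mu> \<le> ?c * n" by (metis of_int_le_iff of_int_mult)
  have "bij_betw (\<lambda>t. nat (\<mu> - int t * n)) {..<nat ?c}
      {j. 1 \<le> j \<and> int j \<le> \<mu> \<and> (\<mu> - int j) mod n = 0}"
  proof (rule bij_betw_byWitness[where f' = "\<lambda>j. nat ((\<mu> - int j) div n)"])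
    have pos: "\<mu> - int t * n \<ge> 1" if "t < nat ?c" for t
    proof -
      have "int t * n \<le> (?c - 1) * n" using that assms(1) by (intro mult_right_mono) linarith+
      with c1 show ?thesis by (simp add: left_diff_distrib)
    qed
    show "\<forall>t\<in>{..<nat ?c}. nat ((\<mu> - int (nat (\<mu> - int t * n))) div n) = t"
      using pos assms(1) by force
    show "(\<lambda>t. nat (\<mu> - int t * n)) ` {..<nat ?c} \<subseteq>
        {j. 1 \<le> j \<and> int j \<le> \<mu> \<and> (\<mu> - int j) mod n = 0}"
    proof (rule image_subsetI)
      fix t assume t: "t \<in> {..<nat ?c}"
      with pos[of t] have p: "\<mu> - int t * n \<ge> 1" by simp
      then have "int (nat (\<mu> - int t * n)) = \<mu> - int t * n" by simp
      moreover have "0 \<le> int t * n" using assms(1) by simp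
      ultimately show "nat (\<mu> - int t * n) \<in> {j. 1 \<le> j \<and> int j \<le> \<mu> \<and> (\<mu> - int j) mod n = 0}"
        using p by auto
    qed
    have div: "n * ((\<mu> - int j) div n) = \<mu> - int j" "0 \<le> (\<mu> - int j) div n"
      if "int j \<le> \<mu>" "(\<mu> - int j) mod n = 0" for j
      using that assms(1) by (auto simp: pos_imp_zdiv_nonneg_iff)
    show "\<forall>j\<in>{j. 1 \<le> j \<and> int j \<le> \<mu> \<and> (\<mu> - int j) mod n = 0}.
        nat (\<mu> - int (nat ((\<mu> - int j) div n)) * n) = j"
      using div by (auto simp: mult.commute)
    show "(\<lambda>j. nat ((\<mu> - int j) div n)) ` {j. 1 \<le> j \<and> int j \<le> \<mu> \<and> (\<mu> - int j) mod n = 0} \<subseteq>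
        {..<nat ?c}"
    proof (rule image_subsetI)
      fix j assume "j \<in> {j. 1 \<le> j \<and> int j \<le> \<mu> \<and> (\<mu> - int j) mod n = 0}"
      then have j: "1 \<le> j" "int j \<le> \<mu>" "(\<mu> - int j) mod n = 0" by auto
      have "n * ((\<mu> - int j) div n) < n * ?c" using div[OF j(2,3)] c2 j(1) by (simp add: mult.commute)
      then have "(\<mu> - int j) div n < ?c" using assms(1) by simp
      then show "nat ((\<mu> - int j) div n) \<in> {..<nat ?c}"
        using div(2)[OF j(2,3)] by (simp only: lessThan_iff nat_less_eq_zless)
    qed
  qed
  then have "card {j :: nat. 1 \<le> j \<and> int j \<le> \<mu> \<and> (\<mu> - int j) mod n = 0} = nat ?c"
    by (simp add: bij_betw_same_card[symmetric])
  moreover have "?c \<ge> 0"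
  proof (rule ccontr)
    assume "\<not> ?c \<ge> 0"
    then have "?c \<le> - 1" by linarith
    then have "?c * n \<le> (- 1) * n" by (rule mult_right_mono) (use assms in simp)
    with c2 assms(2) show False by simp
  qed
  ultimately show ?thesis by simp
qed

section \<open>The centralizer of \<open>x\<close> and its action on the marked vector\<close>

context colored_jordan
begin

text \<open>
  The endomorphism commuting with \<open>x\<close> that sends the generator \<open>e (k, lam k)\<close> of row \<open>k\<close> to \<open>e p\<close> and the
  other generators to \<open>0\<close>.
\<close>

definition shift :: "nat \<Rightarrow> nat \<times> nat \<Rightarrow> 'w \<Rightarrow> 'w" where
  "shift k p = linear_extension (\<lambda>q. if fst q = k \<and> lam k < snd q + snd p
     then e (fst p, snd q + snd p - lam k) else 0)"

lemma shift_e: "(k', r) \<in> cells \<Longrightarrow> shift k (i, j) (e (k', r)) =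
    (if k' = k \<and> lam k < r + j then e (i, r + j - lam k) else 0)"
  by (simp add: shift_def linear_extension_e)

text \<open>The generator of row \<open>k\<close> is killed by the \<open>lam k\<close>-th power of
  \<open>x\<close>, and \<open>j \<le> lam k\<close> says the same of its image
  \<open>e (i, j)\<close>; therefore the map commutes with \<open>x\<close> at the end of the row
  too. The condition on colors makes the generator and its image agree in color.\<close>

lemma shift_stabilizer:
  assumes p: "(i, j) \<in> cells" "j \<le> lam k" "color (i, j) = eps k"
  shows "shift k (i, j) \<in> stabilizer_algebra 0 x"
proof -
  have E: "shift k (i, j) \<in> colored_endos"
    unfolding shift_def
  proof (rule linear_extension_colored)
    fix q assume q: "q \<in> cells"
    show "(if fst q = k \<and> lam k < snd q + snd (i, j) then e (fst (i, j), snd q + snd (i, j) - lam k) else 0)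
        \<in> V (color q)"
    proof (cases "fst q = k \<and> lam k < snd q + j")
      case True
      let ?p = "(i, snd q + j - lam k)"
      have "?p \<in> cells" using p(1) q True by (auto simp: jordan_cells_def)
      moreover have "color ?p = color q"
      proof -
        have "color ?p = ((eps i + (int (lam i) - int j)) mod n + (int (lam k) - int (snd q))) mod n"
          using True unfolding mod_add_left_eq by (simp add: color_def of_nat_diff algebra_simps)
        also have "\<dots> = color q" using p(3) True by (simp add: color_def)
        finally show ?thesis .
      qed
      ultimately show ?thesis using True e_in_V[of ?p] by simp
    qed (use subspace_0[OF subspace_V[OF color_range]] in auto)
  qed
  note lin = E_linear[OF E]
  have "(\<lambda>u. shift k (i, j) (x u)) = (\<lambda>u. x (shift k (i, j) u))"
  proof (rule linear_eqI[OF linear_comp[OF lin x_linear] linear_comp[OF x_linear lin]])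
    fix q assume q: "q \<in> cells"
    obtain k' r where kr: "q = (k', r)" by (rule prod.exhaust)
    show "shift k (i, j) (x (e q)) = x (shift k (i, j) (e q))"
    proof (cases "k' = k \<and> lam k < r + j")
      case True
      then have "(i, r + j - lam k) \<in> cells" using p q kr by (auto simp: jordan_cells_def)
      note x_p = x_e[OF this]
      show ?thesis
      proof (cases "r > 1")
        case r: True
        then have "(k', r - 1) \<in> cells" using q kr by (auto simp: jordan_cells_def)
        then show ?thesis
          using True q r p(2) x_p by (auto simp: kr x_e shift_e linear_simps[OF x_linear])
      next
        case False
        then have "r = 1" using q kr by (simp add: jordan_cells_def)
        then have "r + j - lam k = 1" using True p(2) by linarith
        then show ?thesis
          using True q \<open>r = 1\<close> x_p by (simp add: kr x_e shift_e linear_simps[OF lin])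
      qed
    next
      case False
      have "shift k (i, j) (e (k', r - 1)) = 0" if "r > 1"
      proof -
        have "(k', r - 1) \<in> cells" using q kr that by (auto simp: jordan_cells_def)
        with False show ?thesis by (auto simp: shift_e)
      qed
      moreover have "shift k (i, j) (e (k', r)) = 0"
        using False q kr by (auto simp: shift_e)
      ultimately show ?thesis
        using q by (simp add: kr x_e linear_simps[OF x_linear] linear_simps[OF lin])
    qed
  qed
  then show ?thesis
    using E linear_simps(3)[OF lin] by (simp add: stabilizer_algebra_def fun_eq_iff)
qed

lemma shift_top: "(i, j) \<in> cells \<Longrightarrow> k < plen lam \<Longrightarrow> (k', lam k') \<in> cells \<Longrightarrow>
    shift k (i, j) (e (k', lam k')) = (if k' = k then e (i, j) else 0)"
  by (auto simp: shift_e jordan_cells_def)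

lemma color_top: "color (k, lam k) = eps k"
  using eps_range[of k] by (simp add: color_def)

lemma top_cell: "k < plen lam \<Longrightarrow> (k, lam k) \<in> cells"
  by (simp add: plen_iff[OF partition] jordan_cells_def Suc_le_eq)

lemma stabilizer_funpow:
  assumes "a \<in> stabilizer_algebra 0 x" shows "a ((x ^^ k) u) = (x ^^ k) (a u)"
  using assms by (induction k) (simp_all add: stabilizer_algebra_def)

lemma stabilizer_row:
  assumes "a \<in> stabilizer_algebra 0 x" "(k, r) \<in> cells"
  shows "a (e (k, r)) = (x ^^ (lam k - r)) (a (e (k, lam k)))"
proof -
  have "(k, lam k) \<in> cells" using assms(2) by (auto simp: jordan_cells_def)
  then have "e (k, r) = (x ^^ (lam k - r)) (e (k, lam k))"
    using assms(2) by (subst funpow_e) (auto simp: jordan_cells_def)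
  then show ?thesis by (simp add: stabilizer_funpow[OF assms(1)])
qed

text \<open>Converse of \<open>shift_stabilizer\<close>: the image of a generator involves only
  those cells to which some \<open>shift\<close> sends it. The column bound holds because the
  \<open>lam k\<close>-th power of \<open>x\<close> kills the image.\<close>

lemma stabilizer_top_coef:
  assumes a: "a \<in> stabilizer_algebra 0 x" and k: "k < plen lam" and p: "p \<in> cells"
    and "coef p (a (e (k, lam k))) \<noteq> 0"
  shows "color p = eps k" "snd p \<le> lam k"
proof -
  have "a \<in> colored_endos" using a by (simp add: stabilizer_algebra_def)
  from colored_endo_coef[OF this p top_cell[OF k] assms(4)]
  show "color p = eps k" by (simp add: color_top)
  show "snd p \<le> lam k"
  proof (rule ccontr)
    assume "\<not> snd p \<le> lam k"
    obtain i j where ij: "p = (i, j)" by (rule prod.exhaust)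
    have "lam k \<ge> 1" using top_cell[OF k] by (simp add: jordan_cells_def)
    then have "(x ^^ (lam k - 1)) (e (k, lam k)) = e (k, 1)"
      using funpow_e[OF top_cell[OF k], of "lam k - 1"] by simp
    then have "x ((x ^^ (lam k - 1)) (e (k, lam k))) = 0"
      using \<open>lam k \<ge> 1\<close> x_e[of k 1] by (simp add: jordan_cells_def)
    then have "(x ^^ Suc (lam k - 1)) (e (k, lam k)) = 0" by simp
    then have "(x ^^ lam k) (e (k, lam k)) = 0" using \<open>lam k \<ge> 1\<close> by simp
    then have zero: "(x ^^ lam k) (a (e (k, lam k))) = 0"
      unfolding stabilizer_funpow[OF a, symmetric]
      using linear_simps(3)[OF E_linear[OF \<open>a \<in> colored_endos\<close>]] by simp
    have "(i, j - lam k) \<in> cells" "j - lam k + lam k = j" "j \<le> lam i"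
      using p \<open>\<not> snd p \<le> lam k\<close> ij by (auto simp: jordan_cells_def)
    with coef_funpow[of i "j - lam k" "lam k" "a (e (k, lam k))"] zero ij assms(4)
    show False by (simp add: coef_simps)
  qed
qed

text \<open>The functionals read off the coordinates of the images of the generators, and the maps
  \<open>shift\<close> are their dual family. An element on which all of them vanish kills the
  generators, hence everything.\<close>

lemma dim_stabilizer_algebra_0:
  "fs.dim (stabilizer_algebra 0 x) = (\<Sum>k<plen lam. kernel_signature smul V x (lam k) (eps k))"
proof -
  let ?A = "stabilizer_algebra 0 x"
  define Q where "Q k = {p \<in> cells. snd p \<le> lam k \<and> color p = eps k}" for k
  define P where "P = (SIGMA k:{..<plen lam}. Q k)"
  have fin_Q: "finite (Q k)" for k using finite_I by (simp add: Q_def)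
  then have "finite P" by (auto simp: P_def)
  have P: "k < plen lam" "p \<in> cells" "snd p \<le> lam k" "color p = eps k" if "(k, p) \<in> P" for k p
    using that by (auto simp: P_def Q_def)
  have "fs.dim ?A = fs.dim {a \<in> ?A. \<forall>r\<in>P. coef (snd r) (a (e (fst r, lam (fst r)))) = 0} + card P"
  proof (rule fs.dim_dual_functionals[OF \<open>finite P\<close> stabilizer_algebra_subspace(1)[OF x_linear]
        finite_elementary, where b = "\<lambda>r. shift (fst r) (snd r)"])
    show "?A \<subseteq> fs.span elementary_maps"
      using stabilizer_algebra_subspace(2)[OF x_linear] E_span by (rule subset_trans)
  next
    fix r assume r: "r \<in> P"
    obtain k i j where kij: "r = (k, (i, j))" by (metis surj_pair)
    show "shift (fst r) (snd r) \<in> ?A"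
      using P[of k "(i, j)"] r by (auto simp: kij intro: shift_stabilizer)
  next
    fix r s assume rs: "r \<in> P" "s \<in> P"
    obtain k p where r: "r = (k, p)" by (rule prod.exhaust)
    obtain k' i j where s: "s = (k', (i, j))" by (metis surj_pair)
    have "shift k' (i, j) (e (k, lam k)) = (if k = k' then e (i, j) else 0)"
      using P[of k p] P[of k' "(i, j)"] rs top_cell unfolding r s by (intro shift_top) auto
    then show "coef (snd r) (shift (fst s) (snd s) (e (fst r, lam (fst r)))) = (if r = s then 1 else 0)"
      using P[of k p] P[of k' "(i, j)"] rs by (simp add: r s coef_e coef_simps)
  qed (simp_all add: coef_simps)
  also have "{a \<in> ?A. \<forall>r\<in>P. coef (snd r) (a (e (fst r, lam (fst r)))) = 0} = {0}"
  proof (intro equalityI subsetI)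
    fix a assume a: "a \<in> {a \<in> ?A. \<forall>r\<in>P. coef (snd r) (a (e (fst r, lam (fst r)))) = 0}"
    have top: "a (e (k, lam k)) = 0" if k: "k < plen lam" for k
    proof (rule coef_eqI)
      fix p assume p: "p \<in> cells"
      have "coef p (a (e (k, lam k))) = 0"
      proof (rule ccontr)
        assume ne: "coef p (a (e (k, lam k))) \<noteq> 0"
        have "a \<in> ?A" using a by simp
        from stabilizer_top_coef[OF this k p ne] have "(k, p) \<in> P" using k p by (simp add: P_def Q_def)
        with a ne show False by auto
      qed
      then show "coef p (a (e (k, lam k))) = coef p 0" by (simp add: coef_simps)
    qed
    have "a (e q) = 0" if q: "q \<in> cells" for q
    proof -
      obtain k r where kr: "q = (k, r)" by (rule prod.exhaust)
      have "k < plen lam" using q kr by (auto simp: plen_iff[OF partition] jordan_cells_def)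
      then show ?thesis
        using stabilizer_row[of a k r] a q top linear_simps(3)[OF funpow_linear] by (simp add: kr)
    qed
    then have "a = (\<lambda>u. 0)"
      using a by (intro linear_eqI E_linear linearI) (auto simp: stabilizer_algebra_def)
    then show "a \<in> {0}" by (simp add: zero_fun_def)
  qed (use fs.subspace_0[OF stabilizer_algebra_subspace(1)[OF x_linear]] in \<open>auto simp: coef_simps\<close>)
  also have "fs.dim {0} = 0" by (rule fs.dim_zero)
  also have "card P = (\<Sum>k<plen lam. card (Q k))"
    unfolding P_def using fin_Q by (simp add: card_SigmaI)
  finally show ?thesis using eps_range by (simp add: Q_def kernel_signature_eq)
qed

text \<open>With \<open>nu = lam - mu\<close>, the equality of the classes of
  \<open>eps + nu\<close> gives that \<open>j\<close> is congruent to \<open>mu k\<close>. The two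
  column bounds read \<open>j \<le> mu i\<close> and \<open>j \<le> lam k - nu i\<close>. For
  \<open>i > k\<close> the first and \<open>mu i < mu k + n\<close> give
  \<open>j < mu k + n\<close>; for \<open>i < k\<close> the second and
  \<open>nu k < nu i + n\<close> give the same. Together with the congruence this yields
  \<open>j \<le> mu k\<close>.\<close>

lemma striped_column_bound:
  assumes striped: "striped_bipartition n lam eps mu"
    and "j + nat (int (lam i) - mu i) \<le> lam i" "j + nat (int (lam i) - mu i) \<le> lam k"
    and "color (k, j + nat (int (lam i) - mu i)) = eps i"
  shows "int j \<le> mu k" "(mu k - int j) mod n = 0"
proof -
  let ?nu = "\<lambda>i. int (lam i) - mu i"
  have mu: "mu i \<le> int (lam i)"
    and less_n: "\<And>i j. i < j \<Longrightarrow> mu j < mu i + n" "\<And>i j. i < j \<Longrightarrow> ?nu j < ?nu i + n"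
    and cong: "(eps i + ?nu i) mod n = (eps k + ?nu k) mod n"
    using striped by (auto simp: striped_bipartition_def Let_def)
  have "eps i = (eps k + (int (lam k) - (int j + ?nu i))) mod n"
    using assms(4) mu by (simp add: color_def)
  then have "(eps k + (int (lam k) - (int j + ?nu i)) + ?nu i) mod n = (eps k + ?nu k) mod n"
    unfolding cong[symmetric] by (simp add: mod_add_left_eq)
  then have "n dvd (eps k + (int (lam k) - (int j + ?nu i)) + ?nu i) - (eps k + ?nu k)"
    by (rule mod_eq_dvd_iff[THEN iffD1])
  then have dvd: "n dvd mu k - int j" by (simp add: algebra_simps)
  then show "(mu k - int j) mod n = 0" by simp
  have "int j \<le> mu i" "int j + ?nu i \<le> int (lam k)" using assms(2,3) mu by linarith+
  then have "int j < mu k + n"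
  proof (cases i k rule: linorder_cases)
    case less
    from \<open>i < k\<close> have "?nu k < ?nu i + n" by (rule less_n(2))
    with \<open>int j + ?nu i \<le> int (lam k)\<close> show ?thesis by linarith
  next
    case equal
    with \<open>int j \<le> mu i\<close> n_pos show ?thesis by simp
  next
    case greater
    then have "mu i < mu k + n" by (rule less_n(1))
    with \<open>int j \<le> mu i\<close> show ?thesis by linarith
  qed
  show "int j \<le> mu k"
  proof (rule ccontr)
    assume "\<not> int j \<le> mu k"
    then have "0 < int j - mu k" "int j - mu k < n" using \<open>int j < mu k + n\<close> by linarith+
    moreover have "n dvd int j - mu k" using dvd by (simp add: dvd_diff_commute)
    ultimately show False using zdvd_imp_le by fastforce
  qed
qed

text \<open>The functionals are the coordinates of \<open>a v\<close> at the cells of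
  \<open>P\<close>. The inequalities of the striped bipartition ensure that \<open>a v\<close> has
  no other coordinates, so their common kernel is the stabilizer algebra of the marked vector; the
  rows of \<open>P\<close> are counted by the ceilings.\<close>

lemma dim_stabilizer_algebra_marked:
  assumes striped: "striped_bipartition n lam eps mu"
  shows "int (fs.dim (stabilizer_algebra 0 x)) =
    int (fs.dim (stabilizer_algebra (marked_vector lam mu (\<lambda>i j. e (i, j))) x)) +
    (\<Sum>i<plen lam. \<lceil>real_of_int (mu i) / real_of_int n\<rceil>)"
proof -
  let ?A = "stabilizer_algebra 0 x"
  let ?v = "marked_vector lam mu (\<lambda>i j. e (i, j))"
  have mu: "\<And>i. mu i \<le> int (lam i)" "\<And>i. mu i > - n"
    using striped by (auto simp: striped_bipartition_def Let_def)
  define Q where "Q i = {j :: nat. 1 \<le> j \<and> int j \<le> mu i \<and> (mu i - int j) mod n = 0}" for i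
  define P where "P = (SIGMA i:{..<plen lam}. Q i)"
  have fin_Q: "finite (Q i)" for i
    by (rule finite_subset[of _ "{..nat (mu i)}"]) (auto simp: Q_def)
  then have "finite P" by (auto simp: P_def)
  have P: "i < plen lam" "1 \<le> j" "int j \<le> mu i" "(mu i - int j) mod n = 0" "(i, j) \<in> cells"
    if "(i, j) \<in> P" for i j
    using that mu(1)[of i] by (auto simp: P_def Q_def jordan_cells_def)
  have a_v: "a ?v = (\<Sum>i<plen lam. if mu i \<le> 0 then 0 else a (e (i, nat (mu i))))" if "a \<in> ?A" for a
  proof -
    have lin: "Vector_Spaces.linear smul smul a"
      using that E_linear by (simp add: stabilizer_algebra_def)
    show ?thesis
      unfolding marked_vector_def linear_simps(5)[OF lin]
      by (intro sum.cong) (auto simp: linear_simps(3)[OF lin])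
  qed
  \<comment> \<open>The target column is chosen so that \<open>e (i, mu i)\<close> goes to
    \<open>e (i, j)\<close>. Summands of the marked vector in other rows are killed, so the whole
    vector goes to \<open>e (i, j)\<close>.\<close>
  let ?b = "\<lambda>(i, j). shift i (i, j + lam i - nat (mu i))"
  have b: "?b (i, j) \<in> ?A" "?b (i, j) ?v = e (i, j)" if ij: "(i, j) \<in> P" for i j
  proof -
    let ?J = "j + lam i - nat (mu i)"
    have J: "(i, ?J) \<in> cells" "?J \<le> lam i" "int ?J = int j + int (lam i) - mu i"
      using P[OF ij] mu(1)[of i] by (auto simp: jordan_cells_def)
    have "color (i, ?J) = eps i"
    proof -
      have "color (i, ?J) = (eps i + (mu i - int j)) mod n" using J(3) by (simp add: color_def)
      also have "\<dots> = (eps i + (mu i - int j) mod n) mod n" by (simp add: mod_add_right_eq)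
      also have "\<dots> = eps i" using P(4)[OF ij] eps_range[of i] by simp
      finally show ?thesis .
    qed
    then show A: "?b (i, j) \<in> ?A" using J shift_stabilizer by simp
    have "?b (i, j) ?v = (\<Sum>k<plen lam. if k = i then e (i, j) else 0)"
      unfolding a_v[OF A]
    proof (rule sum.cong[OF refl])
      fix k assume k: "k \<in> {..<plen lam}"
      show "(if mu k \<le> 0 then 0 else ?b (i, j) (e (k, nat (mu k)))) = (if k = i then e (i, j) else 0)"
      proof (cases "mu k \<le> 0")
        case True
        then show ?thesis using P[OF ij] by auto
      next
        case False
        then have "(k, nat (mu k)) \<in> cells" using mu(1)[of k] by (auto simp: jordan_cells_def)
        moreover have "lam i < nat (mu i) + ?J" "nat (mu i) + ?J - lam i = j"
          using P[OF ij] mu(1)[of i] by auto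
        ultimately show ?thesis using False by (auto simp: shift_e)
      qed
    qed
    then show "?b (i, j) ?v = e (i, j)" using P(1)[OF ij] by simp
  qed
  have "fs.dim ?A = fs.dim {a \<in> ?A. \<forall>p\<in>P. coef p (a ?v) = 0} + card P"
  proof (rule fs.dim_dual_functionals[OF \<open>finite P\<close> stabilizer_algebra_subspace(1)[OF x_linear]
        finite_elementary, where b = ?b])
    show "?A \<subseteq> fs.span elementary_maps"
      using stabilizer_algebra_subspace(2)[OF x_linear] E_span by (rule subset_trans)
  next
    fix p assume p: "p \<in> P"
    obtain i j where ij: "p = (i, j)" by (rule prod.exhaust)
    show "?b p \<in> ?A" using b(1) p unfolding ij .
  next
    fix p q assume pq: "p \<in> P" "q \<in> P"
    obtain i j where ij: "q = (i, j)" by (rule prod.exhaust)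
    obtain k l where kl: "p = (k, l)" by (rule prod.exhaust)
    have "?b q ?v = e q" using b(2) pq(2) unfolding ij .
    moreover have "p \<in> cells" "q \<in> cells" using P(5) pq unfolding ij kl by blast+
    ultimately show "coef p (?b q ?v) = (if p = q then 1 else 0)" by (simp only: coef_e)
  qed (simp_all add: coef_simps)
  also have "{a \<in> ?A. \<forall>p\<in>P. coef p (a ?v) = 0} = stabilizer_algebra ?v x"
  proof (intro equalityI subsetI)
    fix a assume a: "a \<in> {a \<in> ?A. \<forall>p\<in>P. coef p (a ?v) = 0}"
    then have aA: "a \<in> ?A" by simp
    have "a ?v = 0"
    proof (rule coef_eqI)
      fix p assume p: "p \<in> cells"
      obtain k j where kj: "p = (k, j)" by (rule prod.exhaust)
      have k: "k < plen lam" using p kj by (auto simp: plen_iff[OF partition] jordan_cells_def)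
      show "coef p (a ?v) = coef p 0"
      proof (cases "p \<in> P")
        case True
        then show ?thesis using a by (auto simp: coef_simps)
      next
        case False
        have "coef p (if mu i \<le> 0 then 0 else a (e (i, nat (mu i)))) = 0" if i: "i < plen lam" for i
        proof (rule ccontr)
          assume ne: "coef p (if mu i \<le> 0 then 0 else a (e (i, nat (mu i)))) \<noteq> 0"
          then have pos: "mu i > 0" by (auto simp: coef_simps split: if_splits)
          \<comment> \<open>Applying the \<open>?d\<close>-th power of \<open>x\<close> to the
            generator gives the summand of row \<open>i\<close>. A coordinate of its image in column
            \<open>j\<close> therefore comes from column \<open>j + ?d\<close> of the image of the
            generator.\<close>
          let ?d = "nat (int (lam i) - mu i)"
          have "(i, nat (mu i)) \<in> cells" using pos mu(1)[of i] by (auto simp: jordan_cells_def)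
          moreover have "lam i - nat (mu i) = ?d" using pos mu(1)[of i] by auto
          ultimately have "a (e (i, nat (mu i))) = (x ^^ ?d) (a (e (i, lam i)))"
            using stabilizer_row[of a i "nat (mu i)"] a by simp
          then have ne': "coef (k, j) ((x ^^ ?d) (a (e (i, lam i)))) \<noteq> 0" using ne pos kj by simp
          then have d: "j + ?d \<le> lam k" "coef (k, j + ?d) (a (e (i, lam i))) \<noteq> 0"
            using coef_funpow[of k j ?d] p kj by (auto split: if_splits)
          then have "(k, j + ?d) \<in> cells" using p kj by (auto simp: jordan_cells_def)
          from stabilizer_top_coef[OF aA i this d(2)]
          have "color (k, j + ?d) = eps i" "j + ?d \<le> lam i" by auto
          from striped_column_bound[OF striped this(2) d(1) this(1)]
          have "p \<in> P" using p k by (auto simp: kj P_def Q_def jordan_cells_def)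
          with False show False ..
        qed
        then have "coef p (a ?v) = 0" using a by (simp add: a_v coef_simps)
        then show ?thesis by (simp add: coef_simps)
      qed
    qed
    then show "a \<in> stabilizer_algebra ?v x" using a by (simp add: stabilizer_algebra_def)
  next
    fix a assume a: "a \<in> stabilizer_algebra ?v x"
    then have "a 0 = 0" using linear_simps(3)[OF E_linear] by (simp add: stabilizer_algebra_def)
    with a show "a \<in> {a \<in> ?A. \<forall>p\<in>P. coef p (a ?v) = 0}"
      by (auto simp: stabilizer_algebra_def coef_simps)
  qed
  finally have "fs.dim ?A = fs.dim (stabilizer_algebra ?v x) + card P" .
  moreover have "card P = (\<Sum>i<plen lam. card (Q i))"
    unfolding P_def using fin_Q by (simp add: card_SigmaI)
  moreover have "int (card (Q i)) = \<lceil>real_of_int (mu i) / real_of_int n\<rceil>" for i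
    unfolding Q_def using n_pos mu(2) by (rule card_congruent_below)
  ultimately show ?thesis by simp
qed

end

section \<open>Extension of scalars\<close>

context colored_jordan
begin

lemma stabilizer_dim_le: "fs.dim (stabilizer_algebra v x) \<le> fs.dim colored_endos"
proof -
  obtain B where B: "B \<subseteq> colored_endos" "fs.independent B" "colored_endos \<subseteq> fs.span B"
    "card B = fs.dim colored_endos"
    by (rule fs.basis_exists)
  have "finite B" using fs.independent_span_bound[OF finite_elementary B(2)] B(1) E_span by blast
  moreover have "stabilizer_algebra v x \<subseteq> fs.span B"
    using stabilizer_algebra_subspace(2)[OF x_linear] B(3) by (rule subset_trans)
  ultimately show ?thesis using fs.dim_le_card B(4) by metis
qed

lemma dim_End_conj_orbit:
  assumes "infinite (UNIV :: 'k set)"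
  shows "dim_End smul (conj_orbit smul n V x) =
    enat (fs.dim colored_endos - fs.dim (stabilizer_algebra 0 x))"
proof -
  interpret orbit_coordinates smul cells e coef colored_endos "\<lambda>_ y. y" "\<lambda>_. 0" "\<lambda>y. y" "coords_End smul" "{0}"
  proof unfold_locales
    show "(\<lambda>p. \<psi> 0) \<in> polynomial_functions (coords_End smul)" for \<psi>
      by (rule polynomial_functions.const)
    show "(\<lambda>p. \<psi> (p u)) \<in> polynomial_functions (coords_End smul)"
      if "Vector_Spaces.linear smul (*) \<psi>" for \<psi> u
      using that by (intro polynomial_functions.coord) (auto simp: coords_End_def)
    show "(\<exists>\<psi>. Vector_Spaces.linear smul (*) \<psi> \<and> (\<forall>w y. f y = \<psi> w)) \<or>
        (\<exists>\<psi> u. Vector_Spaces.linear smul (*) \<psi> \<and> (\<forall>w y. f y = \<psi> (y u)))"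
      if "f \<in> coords_End smul" for f
      using that by (intro disjI2) (auto simp: coords_End_def)
    show "g w \<in> {0}" if "Vector_Spaces.linear smul smul g" "w \<in> {0}" for g w
      using that linear_simps(3)[OF that(1)] by simp
  qed auto
  have "conj_orbit smul n V x = orbit 0 x"
    unfolding conj_orbit_def orbit_def colored_GL_eq by (auto simp: o_def)
  then show ?thesis
    unfolding dim_End_def by (simp add: krull_dim_orbit[OF assms x_linear])
qed

lemma dim_pair_enhanced_orbit:
  assumes "infinite (UNIV :: 'k set)"
  shows "dim_pair smul (enhanced_orbit smul n V (v, x)) =
    enat (fs.dim colored_endos - fs.dim (stabilizer_algebra v x))"
proof -
  interpret orbit_coordinates smul cells e coef colored_endos Pair fst snd "coords_pair smul" UNIV
  proof unfold_locales
    show "(\<lambda>p. \<psi> (fst p)) \<in> polynomial_functions (coords_pair smul)"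
      if "Vector_Spaces.linear smul (*) \<psi>" for \<psi>
      using that by (intro polynomial_functions.coord) (auto simp: coords_pair_def)
    show "(\<lambda>p. \<psi> (snd p u)) \<in> polynomial_functions (coords_pair smul)"
      if "Vector_Spaces.linear smul (*) \<psi>" for \<psi> u
    proof (rule polynomial_functions.coord)
      have "(\<lambda>y. \<psi> (y u)) \<in> coords_End smul" using that by (auto simp: coords_End_def)
      then show "(\<lambda>p. \<psi> (snd p u)) \<in> coords_pair smul"
        unfolding coords_pair_def by (intro UnI2 CollectI exI[of _ "\<lambda>y. \<psi> (y u)"] conjI refl)
    qed
    show "(\<exists>\<psi>. Vector_Spaces.linear smul (*) \<psi> \<and> (\<forall>w y. f (w, y) = \<psi> w)) \<or>
        (\<exists>\<psi> u. Vector_Spaces.linear smul (*) \<psi> \<and> (\<forall>w y. f (w, y) = \<psi> (y u)))"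
      if f: "f \<in> coords_pair smul" for f
    proof -
      consider \<psi> where "Vector_Spaces.linear smul (*) \<psi>" "f = (\<lambda>p. \<psi> (fst p))"
        | \<psi> u where "Vector_Spaces.linear smul (*) \<psi>" "f = (\<lambda>p. \<psi> (snd p u))"
        using f unfolding coords_pair_def coords_End_def by auto
      then show ?thesis by cases auto
    qed
  qed auto
  have "enhanced_orbit smul n V (v, x) = orbit v x"
    unfolding enhanced_orbit_def orbit_def colored_GL_eq by (auto simp: o_def)
  then show ?thesis
    unfolding dim_pair_def by (simp add: krull_dim_orbit[OF assms x_linear])
qed

theorem orbit_dimensions:
  assumes "infinite (UNIV :: 'k set)" and "striped_bipartition n lam eps mu"
  defines "d \<equiv> (\<Sum>m\<in>{0..<n}. (int (dim (V m)))\<^sup>2)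
      - (\<Sum>k<plen lam. int (kernel_signature smul V x (lam k) (eps k)))"
  shows "ereal_of_enat (dim_End smul (conj_orbit smul n V x)) = ereal (of_int d)"
    and "ereal_of_enat (dim_pair smul (enhanced_orbit smul n V
        (marked_vector lam mu (\<lambda>i j. e (i, j)), x))) =
      ereal (of_int (d + (\<Sum>i<plen lam. \<lceil>real_of_int (mu i) / real_of_int n\<rceil>)))"
proof -
  \<comment> \<open>The truncated subtraction is a genuine difference because the stabilizer algebra
    lies in \<open>E\<close>.\<close>
  have of_enat: "ereal_of_enat (enat (a - b)) = ereal (of_int (int a - int b))" if "b \<le> a" for a b
    using that by (simp add: of_nat_diff)
  have d: "d = int (fs.dim colored_endos) - int (fs.dim (stabilizer_algebra 0 x))"
    unfolding d_def dim_colored_endos dim_stabilizer_algebra_0 by simp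
  show "ereal_of_enat (dim_End smul (conj_orbit smul n V x)) = ereal (of_int d)"
    unfolding dim_End_conj_orbit[OF assms(1)] d by (rule of_enat[OF stabilizer_dim_le])
  show "ereal_of_enat (dim_pair smul (enhanced_orbit smul n V
        (marked_vector lam mu (\<lambda>i j. e (i, j)), x))) =
      ereal (of_int (d + (\<Sum>i<plen lam. \<lceil>real_of_int (mu i) / real_of_int n\<rceil>)))"
    unfolding dim_pair_enhanced_orbit[OF assms(1)] of_enat[OF stabilizer_dim_le]
    using dim_stabilizer_algebra_marked[OF assms(2)] d by simp
qed

text \<open>Every point of the orbit of \<open>x\<close> has a Jordan basis of its own, so it can
  serve as base point, with its own kernel signatures in the formula.\<close>

lemma transport:
  assumes "g \<in> colored_endos" "bij g"
  shows "colored_jordan smul lam (\<lambda>p. g (e p)) (\<lambda>p u. coef p (inv g u)) n V eps (\<lambda>u. g (x (inv g u)))"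
proof -
  note lin = E_linear[OF assms(1)] and inv_E = E_inv[OF assms]
  note inv_lin = E_linear[OF inv_E]
  have inv: "g (inv g u) = u" "inv g (g u) = u" for u
    using assms(2) by (simp_all add: surj_f_inv_f bij_is_surj inv_f_f bij_is_inj)
  have basis: "indexed_basis smul cells (\<lambda>p. g (e p)) (\<lambda>p u. coef p (inv g u))"
  proof (rule indexed_basis.intro[OF vector_space_axioms], rule indexed_basis_axioms.intro)
    show "Vector_Spaces.linear smul (*) (\<lambda>u. coef p (inv g u))" for p
      by (rule functional_comp[OF coef_linear inv_lin])
    show "(\<Sum>p\<in>cells. smul (coef p (inv g u)) (g (e p))) = u" for u
      using linear_expand[OF lin, of "inv g u"] by (simp add: inv)
  qed (simp_all add: finite_I inv coef_e)
  show ?thesis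
  proof (rule colored_jordan.intro[OF basis], rule colored_jordan_axioms.intro)
    fix m assume m: "m \<in> {0..<n}"
    have "u \<in> V m \<longleftrightarrow> inv g u \<in> V m" for u
      using colored_endoD[OF assms(1) m, of "inv g u"] colored_endoD[OF inv_E m, of u]
      by (auto simp: inv)
    then show "V m = {u. \<forall>(i, j)\<in>cells. coef (i, j) (inv g u) \<noteq> 0 \<longrightarrow>
        (eps i + (int (lam i) - int j)) mod n = m}"
      using V_eq[OF m] by blast
  next
    show "Vector_Spaces.linear smul smul (\<lambda>u. g (x (inv g u)))"
      by (rule linear_comp[OF lin linear_comp[OF x_linear inv_lin]])
  qed (use n_pos partition eps_range x_e inv linear_simps(3)[OF lin] in auto)
qed

text \<open>A scalar extension provides some basis \<open>B\<close> that stays a basis, whereas here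
  the Jordan basis must stay one. The coordinate functionals of the Jordan basis are therefore
  extended linearly by means of \<open>B\<close>.\<close>

lemma extend_scalars:
  fixes smulW :: "'l::field \<Rightarrow> 'u::ab_group_add \<Rightarrow> 'u"
  assumes ext: "scalar_extension smul smulW \<iota> \<beta>" and y: "extends_endo smulW \<beta> x y"
  obtains coefW where "colored_jordan smulW lam (\<lambda>p. \<beta> (e p)) coefW n (extend_coloring smulW \<beta> V) eps y"
proof -
  interpret W: vector_space smulW using ext by (simp add: scalar_extension_def)
  have \<iota>: "\<iota> 1 = 1" "\<iota> (a + c) = \<iota> a + \<iota> c" "\<iota> (a * c) = \<iota> a * \<iota> c" for a c
    using ext by (simp_all add: scalar_extension_def)
  have \<beta>: "\<beta> (u + w) = \<beta> u + \<beta> w" "\<beta> (smul a u) = smulW (\<iota> a) (\<beta> u)" for u w a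
    using ext by (simp_all add: scalar_extension_def)
  have \<iota>0: "\<iota> 0 = 0" using \<iota>(2)[of 0 0] by (simp only: add_0_left add_cancel_right_right)
  have \<beta>0: "\<beta> 0 = 0" using \<beta>(1)[of 0 0] by simp
  have \<iota>_sum: "\<iota> (\<Sum>j\<in>J. f j) = (\<Sum>j\<in>J. \<iota> (f j))" for f and J :: "'w set"
    by (induction J rule: infinite_finite_induct) (simp_all add: \<iota>0 \<iota>)
  have \<beta>_sum: "\<beta> (\<Sum>j\<in>J. f j) = (\<Sum>j\<in>J. \<beta> (f j))" for f and J :: "'w set"
    by (induction J rule: infinite_finite_induct) (simp_all add: \<beta>0 \<beta>)
  obtain B where B: "independent B" "span B = UNIV" "inj_on \<beta> B"
    "W.independent (\<beta> ` B)" "W.span (\<beta> ` B) = UNIV"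
    using ext unfolding scalar_extension_def by blast
  have fin: "finite B"
    using independent_span_bound[of "e ` cells" B] finite_I B(1) span_e by simp
  define \<rho> where "\<rho> b w = W.representation (\<beta> ` B) w (\<beta> b)" for b w
  have \<rho>_add: "\<rho> b (u + w) = \<rho> b u + \<rho> b w" and \<rho>_scale: "\<rho> b (smulW a u) = a * \<rho> b u" for b u w a
    by (simp_all add: \<rho>_def W.representation_add W.representation_scale B)
  have \<rho>_sum: "\<rho> b (\<Sum>j\<in>J. f j) = (\<Sum>j\<in>J. \<rho> b (f j))" for b f and J :: "'w set"
    by (simp add: \<rho>_def W.representation_sum B)
  have \<rho>_basis: "\<rho> b (\<beta> b') = (if b = b' then 1 else 0)" if "b \<in> B" "b' \<in> B" for b b'
    using that B(3) by (auto simp: \<rho>_def W.representation_basis[OF B(4)] inj_on_eq_iff)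
  have \<rho>_expand: "(\<Sum>b\<in>B. smulW (\<rho> b w) (\<beta> b)) = w" for w
    using W.sum_representation_eq[OF B(4), of w "\<beta> ` B"] fin
    by (simp add: B \<rho>_def sum.reindex[OF B(3)])
  \<comment> \<open>The \<open>'l\<close>-linear functional that agrees with
    \<open>\<iota> (coef p b)\<close> at \<open>\<beta> b\<close> for \<open>b\<close> in
    \<open>B\<close>.\<close>
  define coefW where "coefW p w = (\<Sum>b\<in>B. \<rho> b w * \<iota> (coef p b))" for p w
  have coefW_\<beta>: "coefW p (\<beta> u) = \<iota> (coef p u)" for p u
  proof -
    let ?r = "representation B u"
    have u: "u = (\<Sum>b\<in>B. smul (?r b) b)"
      using sum_representation_eq[OF B(1), of u B] fin B(2) by simp
    have "\<rho> b (\<beta> u) = \<iota> (?r b)" if b: "b \<in> B" for b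
    proof -
      have "\<rho> b (\<beta> u) = (\<Sum>b'\<in>B. \<iota> (?r b') * \<rho> b (\<beta> b'))"
        by (subst u) (simp add: \<beta>_sum \<beta> \<rho>_sum \<rho>_scale)
      also have "\<dots> = (\<Sum>b'\<in>B. if b' = b then \<iota> (?r b') else 0)"
        using b by (intro sum.cong) (auto simp: \<rho>_basis)
      finally show ?thesis using b fin by simp
    qed
    then have "coefW p (\<beta> u) = (\<Sum>b\<in>B. \<iota> (?r b) * \<iota> (coef p b))" by (simp add: coefW_def)
    also have "\<dots> = \<iota> (\<Sum>b\<in>B. ?r b * coef p b)" by (simp add: \<iota>_sum \<iota>)
    also have "(\<Sum>b\<in>B. ?r b * coef p b) = coef p u"
      by (subst (2) u) (simp add: coef_simps)
    finally show ?thesis .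
  qed
  have coefW_add: "coefW p (u + w) = coefW p u + coefW p w"
    and coefW_scale: "coefW p (smulW a u) = a * coefW p u" for p u w a
    by (simp_all add: coefW_def \<rho>_add \<rho>_scale distrib_right sum.distrib sum_distrib_left mult.assoc)
  have \<beta>_expand: "\<beta> u = (\<Sum>p\<in>cells. smulW (\<iota> (coef p u)) (\<beta> (e p)))" for u
  proof -
    have "\<beta> (\<Sum>p\<in>J. f p) = (\<Sum>p\<in>J. \<beta> (f p))" for J :: "(nat \<times> nat) set" and f
      by (induction J rule: infinite_finite_induct) (simp_all add: \<beta>0 \<beta>)
    from this[of "\<lambda>p. smul (coef p u) (e p)" cells] show ?thesis by (simp add: expand \<beta>)
  qed
  have expandW: "(\<Sum>p\<in>cells. smulW (coefW p w) (\<beta> (e p))) = w" for w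
  proof -
    have "(\<Sum>p\<in>cells. smulW (coefW p w) (\<beta> (e p))) =
        (\<Sum>p\<in>cells. \<Sum>b\<in>B. smulW (\<rho> b w) (smulW (\<iota> (coef p b)) (\<beta> (e p))))"
      by (simp add: coefW_def W.scale_sum_left)
    also have "\<dots> = (\<Sum>b\<in>B. smulW (\<rho> b w) (\<Sum>p\<in>cells. smulW (\<iota> (coef p b)) (\<beta> (e p))))"
      by (subst sum.swap) (simp only: W.scale_sum_right)
    also have "\<dots> = (\<Sum>b\<in>B. smulW (\<rho> b w) (\<beta> b))" by (simp only: \<beta>_expand[symmetric])
    finally show ?thesis by (simp add: \<rho>_expand)
  qed
  have y_lin: "Vector_Spaces.linear smulW smulW y" and y\<beta>: "y (\<beta> u) = \<beta> (x u)" for u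
    using y by (simp_all add: extends_endo_def)
  have basis: "indexed_basis smulW cells (\<lambda>p. \<beta> (e p)) coefW"
  proof (rule indexed_basis.intro[OF W.vector_space_axioms], rule indexed_basis_axioms.intro)
    show "Vector_Spaces.linear smulW (*) (coefW p)" for p
      unfolding Vector_Spaces.linear_iff
      by (auto simp: coefW_add coefW_scale W.vector_space_axioms)
        (unfold_locales; simp add: algebra_simps)
  qed (simp_all add: finite_I coefW_\<beta> coef_e \<iota> \<iota>0 expandW)
  have "colored_jordan smulW lam (\<lambda>p. \<beta> (e p)) coefW n (extend_coloring smulW \<beta> V) eps y"
  proof (rule colored_jordan.intro[OF basis], rule colored_jordan_axioms.intro)
    fix m assume m: "m \<in> {0..<n}"
    let ?S = "{w. \<forall>p\<in>cells. coefW p w \<noteq> 0 \<longrightarrow> color p = m}"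
    have "coefW p 0 = 0" for p using coefW_scale[of p 0 0] by simp
    then have "W.subspace ?S"
      unfolding W.subspace_def by (fastforce simp: coefW_add coefW_scale)
    moreover have "\<beta> ` V m \<subseteq> ?S"
      using V_iff[OF m] by (force simp: coefW_\<beta> \<iota>0)
    ultimately have 1: "W.span (\<beta> ` V m) \<subseteq> ?S" by (intro W.span_minimal)
    have 2: "w \<in> W.span (\<beta> ` V m)" if w: "w \<in> ?S" for w
    proof -
      have "smulW (coefW p w) (\<beta> (e p)) \<in> W.span (\<beta> ` V m)" if p: "p \<in> cells" for p
      proof (cases "coefW p w = 0")
        case False
        then have "color p = m" using w p by blast
        then show ?thesis using e_in_V[OF p] by (intro W.span_scale W.span_base) auto
      qed (simp add: W.span_zero)
      then have "(\<Sum>p\<in>cells. smulW (coefW p w) (\<beta> (e p))) \<in> W.span (\<beta> ` V m)" by (rule W.span_sum)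
      then show ?thesis by (simp add: expandW)
    qed
    have "extend_coloring smulW \<beta> V m = ?S"
      unfolding extend_coloring_def using 1 2 by blast
    then show "extend_coloring smulW \<beta> V m = {w. \<forall>(i, j)\<in>cells. coefW (i, j) w \<noteq> 0 \<longrightarrow>
        (eps i + (int (lam i) - int j)) mod n = m}"
      by (simp add: color_def case_prod_unfold)
  qed (use n_pos partition eps_range y_lin y\<beta> x_e \<beta>0 in auto)
  then show thesis by (rule that)
qed

end

text \<open>The coloring is an abstract direct sum; since the Jordan basis is homogeneous,
  membership in \<open>V m\<close> can be read off the coordinates.\<close>

lemma colored_Jordan_basis_locale:
  fixes smul :: "'f::field \<Rightarrow> 'v::ab_group_add \<Rightarrow> 'v"
  assumes space: "colored_space smul n V" and jordan: "colored_Jordan_basis smul n V lam eps x b"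
    and partition: "colored_partition n lam eps" and x: "Vector_Spaces.linear smul smul x"
  obtains coef where "colored_jordan smul lam (\<lambda>(i, j). b i j) coef n V eps x"
proof -
  interpret colored_space smul n V by (rule space)
  define e where "e = (\<lambda>(i, j). b i j)"
  define cells where "cells = jordan_cells lam"
  have part: "is_partition lam" "\<And>i. eps i \<in> {0..<n}"
    using partition by (auto simp: colored_partition_def)
  have cells_eq: "cells = {(i, j). i < plen lam \<and> 1 \<le> j \<and> j \<le> lam i}"
    by (auto simp: cells_def jordan_cells_def plen_iff[OF part(1)])
  have fin: "finite cells" unfolding cells_def by (rule finite_jordan_cells[OF part(1)])
  let ?color = "\<lambda>p. (eps (fst p) + (int (lam (fst p)) - int (snd p))) mod n"
  have inj: "inj_on e cells" and indep: "independent (e ` cells)" and span: "span (e ` cells) = UNIV"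
    using jordan unfolding colored_Jordan_basis_def Let_def cells_eq e_def by auto
  have rows: "\<forall>(i, j)\<in>cells. b i j \<in> V ((eps i + (int (lam i) - int j)) mod n) \<and>
      x (b i j) = (if j > 1 then b i (j - 1) else 0)"
    using jordan unfolding colored_Jordan_basis_def Let_def cells_eq by (elim conjE)
  have e_V: "e p \<in> V (?color p)" if "p \<in> cells" for p
    using rows that by (auto simp: e_def)
  define coef where "coef p u = representation (e ` cells) u (e p)" for p u
  have basis: "indexed_basis smul cells e coef"
  proof (rule indexed_basis.intro[OF vector_space_axioms], rule indexed_basis_axioms.intro)
    show "Vector_Spaces.linear smul (*) (coef p)" for p
      unfolding Vector_Spaces.linear_iff
      by (auto simp: coef_def representation_add representation_scale indep span vector_space_axioms)
        (unfold_locales; simp add: algebra_simps)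
    show "coef p (e q) = (if p = q then 1 else 0)" if "p \<in> cells" "q \<in> cells" for p q
      using that inj by (auto simp: coef_def representation_basis[OF indep] inj_on_eq_iff)
    show "(\<Sum>p\<in>cells. smul (coef p u) (e p)) = u" for u
      using sum_representation_eq[OF indep, of u "e ` cells"] fin span
      by (simp add: coef_def sum.reindex[OF inj])
  qed (rule fin)
  interpret basis: indexed_basis smul cells e coef by (rule basis)
  have V_iff: "V m = {u. \<forall>p\<in>cells. coef p u \<noteq> 0 \<longrightarrow> ?color p = m}" if m: "m \<in> {0..<n}" for m
  proof (intro equalityI subsetI CollectI ballI impI)
    fix u assume "u \<in> {u. \<forall>p\<in>cells. coef p u \<noteq> 0 \<longrightarrow> ?color p = m}"
    then have "smul (coef p u) (e p) \<in> V m" if "p \<in> cells" for p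
      using that e_V[OF that] subspace_scale[OF subspace_V[OF m]] subspace_0[OF subspace_V[OF m]]
      by (cases "coef p u = 0") auto
    then have "(\<Sum>p\<in>cells. smul (coef p u) (e p)) \<in> V m" by (rule subspace_sum[OF subspace_V[OF m]])
    then show "u \<in> V m" by (simp only: basis.expand)
  next
    fix u p assume u: "u \<in> V m" and p: "p \<in> cells" and ne: "coef p u \<noteq> 0"
    let ?P = "\<lambda>c. (\<forall>m. if m \<in> {0..<n} then c m \<in> V m else c m = 0) \<and> u = (\<Sum>m\<in>{0..<n}. c m)"
    \<comment> \<open>Two decompositions of \<open>u\<close>: one sorts its basis expansion by
      color, the other has \<open>u\<close> itself in degree \<open>m\<close>. Uniqueness in the
      direct sum identifies them.\<close>
    define c1 where "c1 m' = (\<Sum>q\<in>{q \<in> cells. ?color q = m'}. smul (coef q u) (e q))" for m'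
    define c2 where "c2 m' = (if m' = m then u else 0)" for m'
    have color_range: "?color q \<in> {0..<n}" for q using n_ge_1 by simp
    have "?P c1"
    proof (intro conjI allI)
      fix m'
      show "if m' \<in> {0..<n} then c1 m' \<in> V m' else c1 m' = 0"
      proof (cases "m' \<in> {0..<n}")
        case True
        have "c1 m' \<in> V m'"
          unfolding c1_def using e_V subspace_V[OF True]
          by (intro subspace_sum subspace_scale) auto
        with True show ?thesis by simp
      next
        case False
        then have empty: "{q \<in> cells. ?color q = m'} = {}" using color_range by blast
        have "c1 m' = 0" unfolding c1_def empty by simp
        then show ?thesis unfolding if_not_P[OF False] .
      qed
      have "(\<Sum>m\<in>{0..<n}. c1 m) = (\<Sum>q\<in>cells. smul (coef q u) (e q))"
        unfolding c1_def using fin color_range by (intro sum.group) auto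
      then show "u = (\<Sum>m\<in>{0..<n}. c1 m)" by (simp only: basis.expand)
    qed
    moreover have "?P c2"
      using u m subspace_0[OF subspace_V] by (auto simp: c2_def)
    ultimately have "c1 = c2" using direct_sum[of u] by (elim ex1E) metis
    then have "coef p (c1 (?color p)) = coef p (c2 (?color p))" by simp
    moreover have "coef p (c1 (?color p)) = coef p u"
    proof -
      have "coef p (c1 (?color p)) = (\<Sum>q\<in>{q \<in> cells. ?color q = ?color p}. if q = p then coef q u else 0)"
        unfolding c1_def using p by (auto simp: basis.coef_simps basis.coef_e intro!: sum.cong)
      then show ?thesis using p fin by simp
    qed
    ultimately show "?color p = m" using ne by (auto simp: c2_def basis.coef_simps split: if_splits)
  qed
  have "colored_jordan smul lam e coef n V eps x"
  proof (rule colored_jordan.intro[OF basis[unfolded cells_def]], rule colored_jordan_axioms.intro)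
    show "V m = {u. \<forall>(i, j)\<in>jordan_cells lam. coef (i, j) u \<noteq> 0 \<longrightarrow>
        (eps i + (int (lam i) - int j)) mod n = m}" if "m \<in> {0..<n}" for m
      unfolding V_iff[OF that] by (simp add: cells_def case_prod_unfold)
    show "x (e (i, j)) = (if j > 1 then e (i, j - 1) else 0)" if "(i, j) \<in> jordan_cells lam" for i j
      using rows that by (auto simp: e_def cells_def)
  qed (use n_ge_1 part x in auto)
  then show thesis unfolding e_def by (rule that)
qed

theorem corollary5p7:
  fixes smulV :: "'f::field \<Rightarrow> 'v::ab_group_add \<Rightarrow> 'v"
    and n :: int
    and V :: "int \<Rightarrow> 'v set"
    and lam :: "nat \<Rightarrow> nat" and eps :: "nat \<Rightarrow> int" and mu :: "nat \<Rightarrow> int"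
    and v :: 'v and x :: "'v \<Rightarrow> 'v"
    and smulW :: "'k::field \<Rightarrow> 'w::ab_group_add \<Rightarrow> 'w"
    and \<iota> :: "'f \<Rightarrow> 'k" and \<beta> :: "'v \<Rightarrow> 'w" and y :: "'w \<Rightarrow> 'w"
  assumes "colored_space smulV n V"
    and "striped_bipartition n lam eps mu"
    and "\<forall>m\<in>{0..<n}. partition_signature n lam eps m = vector_space.dim smulV (V m)"
    and "(v, x) \<in> striped_orbit smulV n V lam eps mu"
    and "infinite (UNIV :: 'k set)"
    and "scalar_extension smulV smulW \<iota> \<beta>"
    and "extends_endo smulW \<beta> x y"
  shows "ereal_of_enat (dim_End smulW (conj_orbit smulW n (extend_coloring smulW \<beta> V) y)) =
      ereal (of_int (
        (\<Sum>m\<in>{0..<n}. (int (vector_space.dim smulV (V m)))\<^sup>2)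
        - (\<Sum>k<plen lam. int (kernel_signature smulV V x (lam k) (eps k))))) \<and>
    ereal_of_enat
        (dim_pair smulW (enhanced_orbit smulW n (extend_coloring smulW \<beta> V) (\<beta> v, y))) =
      ereal (of_int (
        (\<Sum>m\<in>{0..<n}. (int (vector_space.dim smulV (V m)))\<^sup>2)
        - (\<Sum>k<plen lam. int (kernel_signature smulV V x (lam k) (eps k)))
        + (\<Sum>i<plen lam. \<lceil>real_of_int (mu i) / real_of_int n\<rceil>)))"proof -
  interpret V: colored_space smulV n V by (rule assms(1))
  have partition: "colored_partition n lam eps"
    using assms(2) by (simp add: striped_bipartition_def Let_def)
  obtain x0 b where x0: "x0 \<in> colored_nilpotents smulV n V"
    and b: "colored_Jordan_basis smulV n V lam eps x0 b"
    and orbit: "(v, x) \<in> enhanced_orbit smulV n V (marked_vector lam mu b, x0)"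
    using assms(4) unfolding striped_orbit_def by blast
  have x0_lin: "Vector_Spaces.linear smulV smulV x0"
    using x0 by (simp add: colored_nilpotents_def)
  obtain coef0 where "colored_jordan smulV lam (\<lambda>(i, j). b i j) coef0 n V eps x0"
    by (rule colored_Jordan_basis_locale[OF assms(1) b partition x0_lin])
  then interpret J0: colored_jordan smulV lam "\<lambda>(i, j). b i j" coef0 n V eps x0 .
  obtain g where g: "g \<in> J0.colored_endos" "bij g"
    and v: "v = g (marked_vector lam mu b)" and x: "x = (\<lambda>u. g (x0 (inv g u)))"
    using orbit unfolding enhanced_orbit_def J0.colored_GL_eq by (auto simp: o_def)
  \<comment> \<open>The Jordan basis of \<open>x\<close> itself, carried over from that of
    \<open>x0\<close>; it also expresses \<open>v\<close> as a marked vector.\<close>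
  define e where "e = (\<lambda>p. g (case p of (i, j) \<Rightarrow> b i j))"
  have "colored_jordan smulV lam e (\<lambda>p u. coef0 p (inv g u)) n V eps x"
    unfolding e_def x by (rule J0.transport[OF g])
  then interpret J: colored_jordan smulV lam e "\<lambda>p u. coef0 p (inv g u)" n V eps x .
  obtain coefW where "colored_jordan smulW lam (\<lambda>p. \<beta> (e p)) coefW n (extend_coloring smulW \<beta> V) eps y"
    by (rule J.extend_scalars[OF assms(6,7)])
  then interpret W: colored_jordan smulW lam "\<lambda>p. \<beta> (e p)" coefW n "extend_coloring smulW \<beta> V" eps y .
  have \<beta>: "\<beta> (u + w) = \<beta> u + \<beta> w" for u w
    using assms(6) by (simp add: scalar_extension_def)
  have \<beta>0: "\<beta> 0 = 0" using \<beta>[of 0 0] by simp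
  have \<beta>_sum: "\<beta> (\<Sum>i\<in>A. f i) = (\<Sum>i\<in>A. \<beta> (f i))" for f and A :: "nat set"
    by (induction A rule: infinite_finite_induct) (simp_all add: \<beta> \<beta>0)
  have \<beta>v: "\<beta> v = marked_vector lam mu (\<lambda>i j. \<beta> (e (i, j)))"
    unfolding v marked_vector_def J0.linear_simps(5)[OF J0.E_linear[OF g(1)]] \<beta>_sum
    by (intro sum.cong) (auto simp: e_def \<beta>0 J0.linear_simps(3)[OF J0.E_linear[OF g(1)]])
  \<comment> \<open>Dimensions of color spaces and kernel signatures count cells of
    \<open>lam\<close>, so they are the same over both fields.\<close>
  have dim: "W.dim (extend_coloring smulW \<beta> V m) = V.dim (V m)" if "m \<in> {0..<n}" for m
    by (simp only: W.dim_V[OF that] J.dim_V[OF that])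
  have kernel: "kernel_signature smulW (extend_coloring smulW \<beta> V) y k (eps i) =
      kernel_signature smulV V x k (eps i)" for k i
    by (simp only: W.kernel_signature_eq[OF J.eps_range] J.kernel_signature_eq[OF J.eps_range])
  have sum_dim: "(\<Sum>m\<in>{0..<n}. (int (W.dim (extend_coloring smulW \<beta> V m)))\<^sup>2) =
      (\<Sum>m\<in>{0..<n}. (int (V.dim (V m)))\<^sup>2)"
    by (intro sum.cong refl) (simp only: dim)
  show ?thesis
    using W.orbit_dimensions[OF assms(5,2)] unfolding \<beta>v sum_dim kernel by (intro conjI)
qed

end
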